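(* Let $X=\mathcal B^2/\Gamma_X$ and $Y=\mathcal B^2/\Gamma_Y$ be the fake projective planes $(a=7,p=2,\emptyset,D_3X_7)$ and $(a=7,p=2,\emptyset,D_3 2_7)$ respectively, and let $Z=\mathcal B^2/\Gamma_Z$ and $W=\mathcal B^2/\Gamma_W$, where the groups $\Gamma_X,\Gamma_Y,\Gamma_Z,\Gamma_W$ are those defined in the context. Then there exists a diagram of maps of surfaces $$ Y \stackrel{\mu}{\longleftarrow} W \stackrel{\pi}{\longleftarrow} Z \stackrel{\rho}{\longrightarrow} X $$ where (1) $\mu$ is an unramified cyclic $C_2$ quotient map; (2) $\pi$ is an unramified cyclic $C_7$ quotient map; (3) $\mu\circ\pi$ is an unramified quotient map by a group isomorphic to the dihedral group $D_{14}$ of $14$ elements; (4) $\rho$ is an unramified cyclic $C_{14}$ quotient map.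
   Context: $\mathcal B^2=\{|z_1|^2+|z_2|^2<1\}\subset\mathbb C^2$ is the complex $2$-ball, on which $\operatorname{PU}(2,1)$ acts by holomorphic automorphisms. $\bar\Gamma\subset\operatorname{PU}(2,1)$ is the maximal arithmetic subgroup (a cocompact discrete subgroup) of the class $(a=7,p=2,\emptyset)$ computed by Cartwright and Steger. As an abstract group it is finitely presented with generators $z,b$ and relators $$z^7,\ (b^{-2}z)^3,\ (b^2z^{-2}b^2z^2)^3,\ (b^2z^{-2}b^2z^4)^3,\ b^3z^{-2}b^{-1}z^2b^{-2}z,$$ $$b^3zb^3z^3bz^2b^{-1}z^{-1},\ b^3z^2b^2z^{-2}b^{-1}z^{-1}b^{-3}zb^{-1}z^{-1}.$$ $\Gamma_X=\langle b^3,\ zb^3z,\ bz^2b^{-1}z\rangle$ and $\Gamma_Y=\langle b^3,\ (zbz^{-1})^3,\ bzb^2z^{-2},\ zbz^3b^{-1}\rangle$ are subgroups of $\bar\Gamma$, both of index $21$ and acting freely on $\mathcal B^2$; the quotients $X=\mathcal B^2/\Gamma_X$ and $Y=\mathcal B^2/\Gamma_Y$ are fake projective planes (complex surfaces of general type with the Hodge numbers of $\mathbb{CP}^2$). $\Gamma_Z=[\Gamma_X,\Gamma_X]$ is the commutator subgroup of $\Gamma_X$, and $\Gamma_W$ is the subgroup of $\bar\Gamma$ generated by $\Gamma_Z$ and $bzb^2z^{-2}b^3$. $C_n$ denotes the cyclic group of order $n$. *)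

theory Defs
  imports "HOL-Analysis.Analysis" "HOL-Algebra.Group_Action" "HOL-Algebra.Elementary_Groups"
begin

section \<open>Quotient topology\<close>

definition quot_top :: "'a topology \<Rightarrow> ('a \<Rightarrow> 'b) \<Rightarrow> 'b topology" where
  "quot_top X q =
     topology (\<lambda>V. V \<subseteq> q ` topspace X \<and> openin X {x \<in> topspace X. q x \<in> V})"

lemma openin_quot_top:
  "openin (quot_top X q) V \<longleftrightarrow>
     V \<subseteq> q ` topspace X \<and> openin X {x \<in> topspace X. q x \<in> V}"
proof -
  have "istopology (\<lambda>V. V \<subseteq> q ` topspace X \<and> openin X {x \<in> topspace X. q x \<in> V})"
    unfolding istopology_def
  proof (intro conjI allI impI)
    fix S T
    assume S: "S \<subseteq> q ` topspace X \<and> openin X {x \<in> topspace X. q x \<in> S}"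
      and T: "T \<subseteq> q ` topspace X \<and> openin X {x \<in> topspace X. q x \<in> T}"
    show "S \<inter> T \<subseteq> q ` topspace X" using S by blast
    have "{x \<in> topspace X. q x \<in> S \<inter> T} =
        {x \<in> topspace X. q x \<in> S} \<inter> {x \<in> topspace X. q x \<in> T}" by blast
    then show "openin X {x \<in> topspace X. q x \<in> S \<inter> T}" using S T by auto
  next
    fix K
    assume K: "\<forall>V\<in>K. V \<subseteq> q ` topspace X \<and> openin X {x \<in> topspace X. q x \<in> V}"
    show "\<Union>K \<subseteq> q ` topspace X" using K by blast
    have "{x \<in> topspace X. q x \<in> \<Union>K} = (\<Union>V\<in>K. {x \<in> topspace X. q x \<in> V})" by blast
    then show "openin X {x \<in> topspace X. q x \<in> \<Union>K}" using K by auto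
  qed
  then show ?thesis unfolding quot_top_def by (simp add: topology_inverse')
qed

lemma topspace_quot_top: "topspace (quot_top X q) = q ` topspace X"
proof
  show "topspace (quot_top X q) \<subseteq> q ` topspace X"
    using openin_quot_top[of X q "topspace (quot_top X q)"] by auto
  have "{x \<in> topspace X. q x \<in> q ` topspace X} = topspace X" by blast
  then have "openin (quot_top X q) (q ` topspace X)" by (simp add: openin_quot_top)
  then show "q ` topspace X \<subseteq> topspace (quot_top X q)" by (rule openin_subset)
qed

lemma quotient_map_quot_top: "quotient_map X (quot_top X q) q"
  by (auto simp: quotient_map_def topspace_quot_top openin_quot_top)


section \<open>Complex surfaces and unramified quotient maps\<close>

text \<open>A complex surface is a topological space together with its sheaf of holomorphic functions
  (a complex-valued function space for every open set) that is locally isomorphic to an open subset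
  of complex 2-space. Functions are total in HOL, so sections over an open set are determined
  by their values on that set only.\<close>

record 'a fspace =
  Top :: "'a topology"
  Hol :: "'a set \<Rightarrow> ('a \<Rightarrow> complex) set"

definition holomorphic2_on :: "(complex^2 \<Rightarrow> complex) \<Rightarrow> (complex^2) set \<Rightarrow> bool" where
  "holomorphic2_on h U \<longleftrightarrow>
     (\<forall>p\<in>U. \<exists>D. (h has_derivative D) (at p) \<and> (\<forall>c v. D (c *s v) = c * D v))"

definition C2_domain :: "(complex^2) set \<Rightarrow> (complex^2) fspace" where
  "C2_domain V = \<lparr>Top = top_of_set V, Hol = (\<lambda>U. {h. holomorphic2_on h U})\<rparr>"

definition open_subspace :: "'a fspace \<Rightarrow> 'a set \<Rightarrow> 'a fspace" where
  "open_subspace S U = \<lparr>Top = subtopology (Top S) U, Hol = Hol S\<rparr>"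

definition holomorphic_map :: "'a fspace \<Rightarrow> 'b fspace \<Rightarrow> ('a \<Rightarrow> 'b) \<Rightarrow> bool" where
  "holomorphic_map S T f \<longleftrightarrow>
     continuous_map (Top S) (Top T) f \<and>
     (\<forall>U h. openin (Top T) U \<and> h \<in> Hol T U \<longrightarrow>
        h \<circ> f \<in> Hol S {x \<in> topspace (Top S). f x \<in> U})"

definition biholomorphic_map :: "'a fspace \<Rightarrow> 'b fspace \<Rightarrow> ('a \<Rightarrow> 'b) \<Rightarrow> bool" where
  "biholomorphic_map S T f \<longleftrightarrow>
     holomorphic_map S T f \<and>
     (\<exists>g. holomorphic_map T S g \<and>
        (\<forall>x\<in>topspace (Top S). g (f x) = x) \<and> (\<forall>y\<in>topspace (Top T). f (g y) = y))"

definition function_sheaf :: "'a fspace \<Rightarrow> bool" where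
  "function_sheaf S \<longleftrightarrow>
     (\<forall>U V h k. openin (Top S) U \<and> openin (Top S) V \<and> V \<subseteq> U \<and>
        h \<in> Hol S U \<and> (\<forall>x\<in>V. k x = h x) \<longrightarrow> k \<in> Hol S V) \<and>
     (\<forall>U h. openin (Top S) U \<and>
        (\<forall>p\<in>U. \<exists>V. openin (Top S) V \<and> p \<in> V \<and> V \<subseteq> U \<and> h \<in> Hol S V) \<longrightarrow> h \<in> Hol S U)"

definition complex_surface :: "'a fspace \<Rightarrow> bool" where
  "complex_surface S \<longleftrightarrow>
     topspace (Top S) \<noteq> {} \<and> connected_space (Top S) \<and>
     Hausdorff_space (Top S) \<and> second_countable (Top S) \<and> function_sheaf S \<and>
     (\<forall>p\<in>topspace (Top S). \<exists>U V c.
        openin (Top S) U \<and> p \<in> U \<and> open V \<and>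
        biholomorphic_map (open_subspace S U) (C2_domain V) c)"

definition unramified_map :: "'a fspace \<Rightarrow> 'b fspace \<Rightarrow> ('a \<Rightarrow> 'b) \<Rightarrow> bool" where
  "unramified_map S T f \<longleftrightarrow>
     holomorphic_map S T f \<and>
     (\<forall>p\<in>topspace (Top S). \<exists>U. openin (Top S) U \<and> p \<in> U \<and> openin (Top T) (f ` U) \<and>
        biholomorphic_map (open_subspace S U) (open_subspace T (f ` U)) f)"

text \<open>The group acts freely by biholomorphisms of the source, and the map is an unramified surjection
  whose fibres are exactly the orbits.\<close>

definition unramified_quotient_map ::
    "('g, 'm) monoid_scheme \<Rightarrow> 'a fspace \<Rightarrow> 'b fspace \<Rightarrow> ('a \<Rightarrow> 'b) \<Rightarrow> bool" where
  "unramified_quotient_map G S T f \<longleftrightarrow>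
     unramified_map S T f \<and> f ` topspace (Top S) = topspace (Top T) \<and>
     (\<exists>\<phi>. group_action G (topspace (Top S)) \<phi> \<and>
        (\<forall>g\<in>carrier G. biholomorphic_map S S (\<phi> g)) \<and>
        (\<forall>g\<in>carrier G. \<forall>x\<in>topspace (Top S). \<phi> g x = x \<longrightarrow> g = \<one>\<^bsub>G\<^esub>) \<and>
        (\<forall>x\<in>topspace (Top S). \<forall>y\<in>topspace (Top S). f x = f y \<longleftrightarrow> y \<in> orbit G \<phi> x))"

text \<open>The dihedral group with \<open>2n\<close> elements (\<open>n > 0\<close>): the pair \<open>(i, s)\<close> is the
  rotation \<open>r\<^sup>i\<close> if \<open>s\<close> is false, and \<open>r\<^sup>i\<close> followed on the right by the
  reflection if \<open>s\<close> is true.\<close>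

definition dihedral_group :: "nat \<Rightarrow> (int \<times> bool) monoid" where
  "dihedral_group n =
     \<lparr>carrier = {0..<int n} \<times> UNIV,
      mult = (\<lambda>(i, s) (j, t). ((if s then i - j else i + j) mod int n, s \<noteq> t)),
      one = (0, False)\<rparr>"

lemma group_dihedral_group:
  assumes "n > 0" shows "group (dihedral_group n)"
proof (rule groupI)
  fix x y z
  assume "x \<in> carrier (dihedral_group n)" "y \<in> carrier (dihedral_group n)"
    "z \<in> carrier (dihedral_group n)"
  then show "x \<otimes>\<^bsub>dihedral_group n\<^esub> y \<otimes>\<^bsub>dihedral_group n\<^esub> z
      = x \<otimes>\<^bsub>dihedral_group n\<^esub> (y \<otimes>\<^bsub>dihedral_group n\<^esub> z)"
    by (auto simp: dihedral_group_def mod_simps algebra_simps)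
next
  fix x assume "x \<in> carrier (dihedral_group n)"
  then show "\<exists>y\<in>carrier (dihedral_group n). y \<otimes>\<^bsub>dihedral_group n\<^esub> x = \<one>\<^bsub>dihedral_group n\<^esub>"
    using assms
    by (intro bexI[of _ "if snd x then x else ((- fst x) mod int n, False)"])
       (auto simp: dihedral_group_def mod_simps)
qed (use assms in \<open>auto simp: dihedral_group_def\<close>)

lemma order_dihedral_group: "order (dihedral_group n) = 2 * n"
  by (simp add: order_def dihedral_group_def card_cartesian_product)


section \<open>The ball and the projective unitary group\<close>

definition ball2 :: "(complex^2) set" where
  "ball2 = {p. (cmod (p $ 1))\<^sup>2 + (cmod (p $ 2))\<^sup>2 < 1}"

definition herm_form :: "complex^3^3" where
  "herm_form = (\<chi> i j. if i = j then (if i = 3 then - 1 else 1) else 0)"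

definition adjoint_mat :: "complex^3^3 \<Rightarrow> complex^3^3" where
  "adjoint_mat A = (\<chi> i j. cnj (A $ j $ i))"

definition U21 :: "(complex^3^3) monoid" where
  "U21 = \<lparr>carrier = {A. adjoint_mat A ** herm_form ** A = herm_form},
          mult = (**), one = mat 1\<rparr>"

definition U21_scalars :: "(complex^3^3) set" where
  "U21_scalars = {mat c | c. cmod c = 1}"

definition PU21 :: "(complex^3^3) set monoid" where
  "PU21 = U21 Mod U21_scalars"

definition PU21_top :: "(complex^3^3) set topology" where
  "PU21_top = quot_top (top_of_set (carrier U21)) (\<lambda>A. U21_scalars #>\<^bsub>U21\<^esub> A)"

definition mat_act :: "complex^3^3 \<Rightarrow> complex^2 \<Rightarrow> complex^2" where
  "mat_act A p = (let w = A *v vector [p $ 1, p $ 2, 1]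
                  in vector [w $ 1 / w $ 3, w $ 2 / w $ 3])"

definition PU21_act :: "(complex^3^3) set \<Rightarrow> complex^2 \<Rightarrow> complex^2" where
  "PU21_act g p = mat_act (SOME A. A \<in> g) p"

lemma adjoint_mat_mult: "adjoint_mat (A ** B) = adjoint_mat B ** adjoint_mat A"
  by (simp add: adjoint_mat_def matrix_matrix_mult_def vec_eq_iff mult.commute)

lemma herm_form_square: "herm_form ** herm_form = mat 1"
  by (auto simp: herm_form_def matrix_matrix_mult_def mat_def vec_eq_iff sum_3 forall_3)

lemma group_U21: "group U21"
proof (rule groupI)
  fix A B assume "A \<in> carrier U21" "B \<in> carrier U21"
  then have A: "adjoint_mat A ** herm_form ** A = herm_form"
    and B: "adjoint_mat B ** herm_form ** B = herm_form"
    by (auto simp: U21_def)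
  have "adjoint_mat (A ** B) ** herm_form ** (A ** B)
      = adjoint_mat B ** (adjoint_mat A ** herm_form ** A) ** B"
    by (simp add: adjoint_mat_mult matrix_mul_assoc)
  then show "A \<otimes>\<^bsub>U21\<^esub> B \<in> carrier U21" by (simp add: U21_def A B)
next
  show "\<one>\<^bsub>U21\<^esub> \<in> carrier U21"
    by (simp add: U21_def adjoint_mat_def herm_form_def mat_def matrix_matrix_mult_def
        vec_eq_iff sum_3 forall_3)
next
  fix A assume "A \<in> carrier U21"
  then have A: "adjoint_mat A ** herm_form ** A = herm_form"
    by (auto simp: U21_def)
  define B where "B = herm_form ** adjoint_mat A ** herm_form"
  have BA: "B ** A = mat 1"
    using A by (simp add: B_def herm_form_square flip: matrix_mul_assoc)
  then have AB: "A ** B = mat 1" by (simp add: matrix_left_right_inverse)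
  have "adjoint_mat (A ** B) = mat 1"
    unfolding AB by (auto simp: adjoint_mat_def mat_def vec_eq_iff)
  then have *: "adjoint_mat B ** adjoint_mat A = mat 1" by (simp add: adjoint_mat_mult)
  have "adjoint_mat B ** herm_form ** B
      = adjoint_mat B ** (adjoint_mat A ** herm_form ** A) ** B" by (simp add: A)
  also have "\<dots> = (adjoint_mat B ** adjoint_mat A) ** herm_form ** (A ** B)"
    by (simp add: matrix_mul_assoc)
  finally have "B \<in> carrier U21" by (simp add: U21_def * AB)
  with BA show "\<exists>B\<in>carrier U21. B \<otimes>\<^bsub>U21\<^esub> A = \<one>\<^bsub>U21\<^esub>" by (auto simp: U21_def)
qed (auto simp: U21_def matrix_mul_assoc)

lemma mat_mult_left: "(mat c ** (A :: complex^3^3)) $ i $ j = c * A $ i $ j"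
  by (simp add: matrix_matrix_mult_def mat_def if_distrib[of "\<lambda>x. x * _"] cong: if_cong)

lemma mat_mult_right: "((A :: complex^3^3) ** mat c) $ i $ j = c * A $ i $ j"
  by (simp add: matrix_matrix_mult_def mat_def if_distrib[of "\<lambda>x. _ * x"] mult.commute
      cong: if_cong)

lemma normal_U21_scalars: "normal U21_scalars U21"
proof -
  interpret group U21 by (rule group_U21)
  have comm: "mat c ** A = A ** mat c" for c and A :: "complex^3^3"
    by (simp add: vec_eq_iff mat_mult_left mat_mult_right)
  have mm: "mat c ** mat d = (mat (c * d) :: complex^3^3)" for c d :: complex
    by (simp add: vec_eq_iff mat_mult_left) (simp add: mat_def)
  have mem: "mat c \<in> carrier U21" if "cmod c = 1" for c
  proof -
    have "adjoint_mat (mat c) = mat (cnj c)"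
      by (auto simp: adjoint_mat_def mat_def vec_eq_iff)
    moreover have "c * cnj c = 1"
      using that by (metis complex_norm_square of_real_1 one_power2)
    ultimately show ?thesis
      by (simp add: U21_def comm[of _ herm_form])
        (simp add: mm mult.commute flip: matrix_mul_assoc)
  qed
  have "subgroup U21_scalars U21"
  proof (rule subgroupI)
    show "U21_scalars \<subseteq> carrier U21" using mem by (auto simp: U21_scalars_def)
    show "U21_scalars \<noteq> {}" by (auto simp: U21_scalars_def intro: exI[of _ 1])
  next
    fix A assume "A \<in> U21_scalars"
    then obtain c where c: "cmod c = 1" "A = mat c" by (auto simp: U21_scalars_def)
    have nz: "c \<noteq> 0" and n: "cmod (inverse c) = 1" using c by (auto simp: norm_inverse)
    have "inv\<^bsub>U21\<^esub> A = mat (inverse c)"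
      using c nz mem[OF n] mem[OF c(1)] by (intro inv_equality) (auto simp: U21_def mm)
    then show "inv\<^bsub>U21\<^esub> A \<in> U21_scalars" using n by (auto simp: U21_scalars_def)
  next
    fix A B assume "A \<in> U21_scalars" "B \<in> U21_scalars"
    then obtain c d where c: "cmod c = 1" "A = mat c" and d: "cmod d = 1" "B = mat d"
      by (auto simp: U21_scalars_def)
    have "A \<otimes>\<^bsub>U21\<^esub> B = mat (c * d)" using c d by (simp add: U21_def mm)
    moreover have "cmod (c * d) = 1" using c d by (simp add: norm_mult)
    ultimately show "A \<otimes>\<^bsub>U21\<^esub> B \<in> U21_scalars" unfolding U21_scalars_def by blast
  qed
  then show ?thesis
  proof (rule normalI, intro ballI)
    fix A assume "A \<in> carrier U21"
    show "U21_scalars #>\<^bsub>U21\<^esub> A = A <#\<^bsub>U21\<^esub> U21_scalars"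
      by (auto simp: r_coset_def l_coset_def U21_scalars_def U21_def comm)
  qed
qed

lemma group_PU21: "group PU21"
  unfolding PU21_def by (rule normal.factorgroup_is_group[OF normal_U21_scalars])

lemma mat_act_scalar:
  assumes "c \<noteq> 0" shows "mat_act (mat c ** A) p = mat_act A p"
proof -
  have "(mat c ** A) *v x = (\<chi> i. c * (A *v x) $ i)" for x
    by (simp add: vec_eq_iff matrix_vector_mult_def mat_mult_left sum_distrib_left mult.assoc)
  then show ?thesis using assms by (simp add: mat_act_def Let_def)
qed

lemma PU21_act_coset:
  assumes "A \<in> carrier U21"
  shows "PU21_act (U21_scalars #>\<^bsub>U21\<^esub> A) p = mat_act A p"
proof -
  define C where "C = U21_scalars #>\<^bsub>U21\<^esub> A"
  have "mat 1 \<in> U21_scalars" unfolding U21_scalars_def using norm_one by blast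
  then have "mat 1 ** A \<in> C" unfolding C_def r_coset_def U21_def by auto (metis matrix_mul_lid)
  then have "(SOME B. B \<in> C) \<in> C" by (rule someI)
  then obtain c where c: "cmod c = 1" "(SOME B. B \<in> C) = mat c ** A"
    by (auto simp: C_def r_coset_def U21_scalars_def U21_def)
  then have "c \<noteq> 0" by auto
  then show ?thesis
    using mat_act_scalar[of c A p] c(2) by (simp add: PU21_act_def flip: C_def)
qed

definition acts_freely_on_ball :: "(complex^3^3) set set \<Rightarrow> bool" where
  "acts_freely_on_ball \<Gamma> \<longleftrightarrow>
     (\<forall>g\<in>\<Gamma>. \<forall>p\<in>ball2. PU21_act g p = p \<longrightarrow> g = \<one>\<^bsub>PU21\<^esub>)"

definition ball_orbit :: "(complex^3^3) set set \<Rightarrow> complex^2 \<Rightarrow> (complex^2) set" where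
  "ball_orbit \<Gamma> p = orbit (PU21\<lparr>carrier := \<Gamma>\<rparr>) PU21_act p"

text \<open>A function on an open subset of the quotient is holomorphic iff its pull-back to the ball is.\<close>

definition ball_quotient :: "(complex^3^3) set set \<Rightarrow> (complex^2) set fspace" where
  "ball_quotient \<Gamma> =
     \<lparr>Top = quot_top (top_of_set ball2) (ball_orbit \<Gamma>),
      Hol = (\<lambda>U. {h. holomorphic2_on (h \<circ> ball_orbit \<Gamma>) {p \<in> ball2. ball_orbit \<Gamma> p \<in> U}})\<rparr>"


section \<open>Lattices in the projective unitary group\<close>

definition discrete_subgroup :: "(complex^3^3) set set \<Rightarrow> bool" where
  "discrete_subgroup \<Gamma> \<longleftrightarrow>
     subgroup \<Gamma> PU21 \<and> subtopology PU21_top \<Gamma> = discrete_topology \<Gamma>"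

definition cocompact_subgroup :: "(complex^3^3) set set \<Rightarrow> bool" where
  "cocompact_subgroup \<Gamma> \<longleftrightarrow>
     subgroup \<Gamma> PU21 \<and> compact_space (quot_top PU21_top (\<lambda>g. \<Gamma> #>\<^bsub>PU21\<^esub> g))"

definition commensurable :: "('a, 'm) monoid_scheme \<Rightarrow> 'a set \<Rightarrow> 'a set \<Rightarrow> bool" where
  "commensurable G A B \<longleftrightarrow>
     finite (rcosets\<^bsub>G\<lparr>carrier := A\<rparr>\<^esub> (A \<inter> B)) \<and>
     finite (rcosets\<^bsub>G\<lparr>carrier := B\<rparr>\<^esub> (A \<inter> B))"

text \<open>The size of the matrices below varies inside the definition of arithmeticity, so real
  \<open>n \<times> n\<close> matrices are functions of two indices that vanish unless both indices are below \<open>n\<close>;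
  they carry the product topology.\<close>

definition mats :: "nat \<Rightarrow> (nat \<Rightarrow> nat \<Rightarrow> real) set" where
  "mats n = {A. \<forall>i j. \<not> (i < n \<and> j < n) \<longrightarrow> A i j = 0}"

definition mats_mult ::
    "nat \<Rightarrow> (nat \<Rightarrow> nat \<Rightarrow> real) \<Rightarrow> (nat \<Rightarrow> nat \<Rightarrow> real) \<Rightarrow> nat \<Rightarrow> nat \<Rightarrow> real" where
  "mats_mult n A B = (\<lambda>i j. \<Sum>k<n. A i k * B k j)"

definition mats_one :: "nat \<Rightarrow> nat \<Rightarrow> nat \<Rightarrow> real" where
  "mats_one n = (\<lambda>i j. if i = j \<and> i < n then 1 else 0)"

definition GL_real :: "nat \<Rightarrow> (nat \<Rightarrow> nat \<Rightarrow> real) monoid" where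
  "GL_real n =
     \<lparr>carrier = {A \<in> mats n. \<exists>B\<in>mats n. mats_mult n A B = mats_one n \<and> mats_mult n B A = mats_one n},
      mult = mats_mult n, one = mats_one n\<rparr>"

definition GL_int :: "nat \<Rightarrow> (nat \<Rightarrow> nat \<Rightarrow> real) set" where
  "GL_int n = {A \<in> carrier (GL_real n).
     (\<forall>i j. A i j \<in> \<int>) \<and> (\<forall>i j. (inv\<^bsub>GL_real n\<^esub> A) i j \<in> \<int>)}"

inductive_set rat_polys :: "nat \<Rightarrow> ((nat \<Rightarrow> nat \<Rightarrow> real) \<Rightarrow> real) set" for n where
  const: "(\<lambda>A. real_of_rat q) \<in> rat_polys n"
| entry: "i < n \<Longrightarrow> j < n \<Longrightarrow> (\<lambda>A. A i j) \<in> rat_polys n"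
| add: "f \<in> rat_polys n \<Longrightarrow> g \<in> rat_polys n \<Longrightarrow> (\<lambda>A. f A + g A) \<in> rat_polys n"
| mult: "f \<in> rat_polys n \<Longrightarrow> g \<in> rat_polys n \<Longrightarrow> (\<lambda>A. f A * g A) \<in> rat_polys n"

text \<open>\<open>\<Gamma>\<close> is arithmetic if it is commensurable with the image of the integral points under a
  continuous surjection with compact kernel from the identity component of the real points of a
  linear algebraic group over the rationals.\<close>

definition arithmetic_subgroup :: "(complex^3^3) set set \<Rightarrow> bool" where
  "arithmetic_subgroup \<Gamma> \<longleftrightarrow> subgroup \<Gamma> PU21 \<and>
     (\<exists>n P H H0 \<phi>. P \<subseteq> rat_polys n \<and>
        H = {A \<in> carrier (GL_real n). \<forall>f\<in>P. f A = 0} \<and> subgroup H (GL_real n) \<and>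
        H0 = connected_component_set H (mats_one n) \<and>
        \<phi> \<in> hom (GL_real n\<lparr>carrier := H0\<rparr>) PU21 \<and>
        continuous_map (top_of_set H0) PU21_top \<phi> \<and>
        \<phi> ` H0 = carrier PU21 \<and>
        compact {A \<in> H0. \<phi> A = \<one>\<^bsub>PU21\<^esub>} \<and>
        commensurable PU21 (\<phi> ` (H0 \<inter> GL_int n)) \<Gamma>)"

definition maximal_arithmetic_subgroup :: "(complex^3^3) set set \<Rightarrow> bool" where
  "maximal_arithmetic_subgroup \<Gamma> \<longleftrightarrow>
     arithmetic_subgroup \<Gamma> \<and>
     (\<forall>\<Lambda>. arithmetic_subgroup \<Lambda> \<and> \<Gamma> \<subseteq> \<Lambda> \<longrightarrow> \<Lambda> = \<Gamma>)"


section \<open>The group presentation\<close>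

datatype letter = Zg | Bg

text \<open>A word is a list of syllables; \<open>[(Bg, 2), (Zg, - 1)]\<close> stands for \<open>b\<^sup>2z\<^sup>-\<^sup>1\<close>.\<close>

type_synonym word = "(letter \<times> int) list"

fun word_val :: "('a, 'm) monoid_scheme \<Rightarrow> 'a \<Rightarrow> 'a \<Rightarrow> word \<Rightarrow> 'a" where
  "word_val G z b [] = \<one>\<^bsub>G\<^esub>"
| "word_val G z b ((x, k) # w) =
     (case x of Zg \<Rightarrow> z | Bg \<Rightarrow> b) [^]\<^bsub>G\<^esub> k \<otimes>\<^bsub>G\<^esub> word_val G z b w"

text \<open>Equality of words in the group presented by the relators \<open>R\<close>; \<open>merge\<close> and \<open>null\<close>
  are the identities of the free group.\<close>

inductive pres_eq :: "word set \<Rightarrow> word \<Rightarrow> word \<Rightarrow> bool" for R where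
  refl: "pres_eq R u u"
| sym: "pres_eq R u v \<Longrightarrow> pres_eq R v u"
| trans: "pres_eq R u v \<Longrightarrow> pres_eq R v w \<Longrightarrow> pres_eq R u w"
| append: "pres_eq R u u' \<Longrightarrow> pres_eq R v v' \<Longrightarrow> pres_eq R (u @ v) (u' @ v')"
| merge: "pres_eq R [(x, j), (x, k)] [(x, j + k)]"
| null: "pres_eq R [(x, 0)] []"
| relator: "r \<in> R \<Longrightarrow> pres_eq R r []"

definition presented_by :: "('a, 'm) monoid_scheme \<Rightarrow> 'a \<Rightarrow> 'a \<Rightarrow> word set \<Rightarrow> bool" where
  "presented_by G z b R \<longleftrightarrow>
     group G \<and> z \<in> carrier G \<and> b \<in> carrier G \<and> generate G {z, b} = carrier G \<and>
     (\<forall>w. word_val G z b w = \<one>\<^bsub>G\<^esub> \<longleftrightarrow> pres_eq R w [])"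

definition word_power :: "word \<Rightarrow> nat \<Rightarrow> word" where
  "word_power w n = concat (replicate n w)"

definition CS_relators :: "word set" where
  "CS_relators =
    {[(Zg, 7)],
     word_power [(Bg, - 2), (Zg, 1)] 3,
     word_power [(Bg, 2), (Zg, - 2), (Bg, 2), (Zg, 2)] 3,
     word_power [(Bg, 2), (Zg, - 2), (Bg, 2), (Zg, 4)] 3,
     [(Bg, 3), (Zg, - 2), (Bg, - 1), (Zg, 2), (Bg, - 2), (Zg, 1)],
     [(Bg, 3), (Zg, 1), (Bg, 3), (Zg, 3), (Bg, 1), (Zg, 2), (Bg, - 1), (Zg, - 1)],
     [(Bg, 3), (Zg, 2), (Bg, 2), (Zg, - 2), (Bg, - 1), (Zg, - 1), (Bg, - 3), (Zg, 1), (Bg, - 1), (Zg, - 1)]}"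

definition Gamma_X :: "(complex^3^3) set \<Rightarrow> (complex^3^3) set \<Rightarrow> (complex^3^3) set set" where
  "Gamma_X z b = generate PU21 (word_val PU21 z b `
    {[(Bg, 3)],
     [(Zg, 1), (Bg, 3), (Zg, 1)],
     [(Bg, 1), (Zg, 2), (Bg, - 1), (Zg, 1)]})"

definition Gamma_Y :: "(complex^3^3) set \<Rightarrow> (complex^3^3) set \<Rightarrow> (complex^3^3) set set" where
  "Gamma_Y z b = generate PU21 (word_val PU21 z b `
    {[(Bg, 3)],
     word_power [(Zg, 1), (Bg, 1), (Zg, - 1)] 3,
     [(Bg, 1), (Zg, 1), (Bg, 2), (Zg, - 2)],
     [(Zg, 1), (Bg, 1), (Zg, 3), (Bg, - 1)]})"

definition Gamma_Z :: "(complex^3^3) set \<Rightarrow> (complex^3^3) set \<Rightarrow> (complex^3^3) set set" where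
  "Gamma_Z z b = derived PU21 (Gamma_X z b)"

definition Gamma_W :: "(complex^3^3) set \<Rightarrow> (complex^3^3) set \<Rightarrow> (complex^3^3) set set" where
  "Gamma_W z b = generate PU21
    (Gamma_Z z b \<union> {word_val PU21 z b [(Bg, 1), (Zg, 1), (Bg, 2), (Zg, - 2), (Bg, 3)]})"

end

theory Submission
  imports Defs "HOL-Algebra.FiniteProduct"
begin

text \<open>
  A discrete group acting freely on the ball acts properly discontinuously, since the matrices
  moving a compact set back to itself are bounded; so its quotient is a complex surface, and a
  homomorphism from the group onto \<open>G\<close> with kernel \<open>N\<close> turns the map between the quotients by \<open>N\<close>
  and by the whole group into an unramified quotient by \<open>G\<close>. It remains to find homomorphisms
  from \<open>\<Gamma>\<^sub>X\<close> onto \<open>C\<^sub>1\<^sub>4\<close> and from \<open>\<Gamma>\<^sub>Y\<close> onto \<open>D\<^sub>1\<^sub>4\<close>, both with kernel \<open>\<Gamma>\<^sub>Z\<close>.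

  Label the edges of the coset graph of an index 21 subgroup by elements of a group such that every
  relator is trivial along every closed path it describes. Multiplying labels along a word
  then defines a homomorphism on the stabiliser of the base vertex, and this stabiliser is
  the subgroup because both have index 21. The two kernels agree because the covering graphs
  belonging to the labels are isomorphic as graphs with base point. That the kernel in \<open>\<Gamma>\<^sub>X\<close> is not
  larger than the commutator subgroup follows by rewriting the relators in the abelianisation.
\<close>

section \<open>The action on the ball\<close>

text \<open>\<open>Gamma_Z\<close> is given only as a commutator subgroup inside
  \<open>Gamma_X\<close>, yet it has to be recognised inside \<open>Gamma_Y\<close>, and neither
  subgroup comes with a presentation of its own. Everything is therefore expressed through the
  relators of the whole lattice. A vertex together with the label collected so far is a vertex of a
  graph with 21 * 14 = 294 vertices, and from either side this is the coset graph of
  \<open>Gamma_Z\<close> in the lattice. Membership in \<open>Gamma_Z\<close> becomes closing up of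
  a path there, which a finite table can compare. The bound on the abelianisation of
  \<open>Gamma_X\<close> rests on explicit integer combinations of relator loops in which every edge
  cancels, so that only an identity between integers has to be checked. \<open>Gamma_W\<close> turns
  out to be the preimage of the rotations in the dihedral group; hence \<mu> comes from the sign of
  a dihedral element and \<pi> from the angle of a rotation.\<close>

lemma U21_closed_mult: "A \<in> carrier U21 \<Longrightarrow> B \<in> carrier U21 \<Longrightarrow> A ** B \<in> carrier U21"
  using group.is_monoid[OF group_U21] monoid.m_closed[of U21 A B] by (simp add: U21_def)

text \<open>The Hermitian form of signature (2,1) evaluated at a vector. Points of the ball are the
  lines on which it is negative.\<close>

definition herm_norm :: "complex^3 \<Rightarrow> real" where
  "herm_norm v = (cmod (v $ 1))\<^sup>2 + (cmod (v $ 2))\<^sup>2 - (cmod (v $ 3))\<^sup>2"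

definition lift_pt :: "complex^2 \<Rightarrow> complex^3" where
  "lift_pt p = vector [p $ 1, p $ 2, 1]"

lemma lift_pt_nth [simp]: "lift_pt p $ 1 = p $ 1" "lift_pt p $ 2 = p $ 2" "lift_pt p $ 3 = 1"
  by (simp_all add: lift_pt_def vector_def)

lemma mat_act_nth: "mat_act A p $ 1 = (A *v lift_pt p) $ 1 / (A *v lift_pt p) $ 3"
  "mat_act A p $ 2 = (A *v lift_pt p) $ 2 / (A *v lift_pt p) $ 3"
  by (simp_all add: mat_act_def Let_def lift_pt_def)

text \<open>The same form as a double sum over matrix entries, the shape into which the defining
  identity of \<open>U21\<close> can be substituted entry by entry.\<close>

definition herm_prod :: "complex^3 \<Rightarrow> complex" where
  "herm_prod v = (\<Sum>i\<in>UNIV. \<Sum>j\<in>UNIV. cnj (v $ i) * herm_form $ i $ j * v $ j)"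

lemma herm_prod_eq: "herm_prod v = of_real (herm_norm v)"
  by (simp add: herm_prod_def herm_norm_def sum_3 herm_form_def complex_norm_square mult.commute
      flip: of_real_power)

lemma herm_norm_mult:
  assumes "A \<in> carrier U21"
  shows "herm_norm (A *v v) = herm_norm v"
proof -
  have A: "adjoint_mat A ** herm_form ** A = herm_form" using assms by (simp add: U21_def)
  have entries: "(\<Sum>k\<in>UNIV. (\<Sum>m\<in>UNIV. cnj (A $ m $ i) * herm_form $ m $ k) * A $ k $ j) = herm_form $ i $ j" for i j
    using arg_cong[OF A, of "\<lambda>M. M $ i $ j"] by (simp add: matrix_matrix_mult_def adjoint_mat_def)
  have "herm_prod v = (\<Sum>i\<in>UNIV. \<Sum>j\<in>UNIV. cnj (v $ i) *
      (\<Sum>k\<in>UNIV. (\<Sum>m\<in>UNIV. cnj (A $ m $ i) * herm_form $ m $ k) * A $ k $ j) * v $ j)"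
    by (simp add: herm_prod_def entries)
  also have "\<dots> = herm_prod (A *v v)"
    by (simp add: herm_prod_def matrix_vector_mult_def sum_3 algebra_simps)
  finally have "complex_of_real (herm_norm v) = of_real (herm_norm (A *v v))"
    by (simp add: herm_prod_eq)
  then show ?thesis by simp
qed

lemma ball2_iff: "p \<in> ball2 \<longleftrightarrow> herm_norm (lift_pt p) < 0"
  by (simp add: ball2_def herm_norm_def)

text \<open>A vector with vanishing third coordinate has nonnegative form, whereas the image of a
  lifted ball point keeps a negative value.\<close>

lemma denom_nonzero:
  assumes "A \<in> carrier U21" "p \<in> ball2"
  shows "(A *v lift_pt p) $ 3 \<noteq> 0"
proof
  assume "(A *v lift_pt p) $ 3 = 0"
  then have "0 \<le> herm_norm (A *v lift_pt p)" by (simp add: herm_norm_def)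
  then show False using assms by (simp add: herm_norm_mult ball2_iff)
qed

text \<open>The third coordinate of the image is the automorphy factor by which the linear action
  and the action on normalised lifts differ.\<close>

lemma lift_mat_act:
  assumes "A \<in> carrier U21" "p \<in> ball2"
  shows "A *v lift_pt p = (A *v lift_pt p) $ 3 *s lift_pt (mat_act A p)"
  using denom_nonzero[OF assms]
  by (simp add: vec_eq_iff forall_3 mat_act_nth)

lemma herm_norm_scale: "herm_norm (c *s v) = (cmod c)\<^sup>2 * herm_norm v"
  by (simp add: herm_norm_def norm_mult power_mult_distrib algebra_simps)

lemma mat_act_ball2:
  assumes "A \<in> carrier U21" "p \<in> ball2"
  shows "mat_act A p \<in> ball2"
proof -
  have "(cmod ((A *v lift_pt p) $ 3))\<^sup>2 * herm_norm (lift_pt (mat_act A p)) = herm_norm (lift_pt p)"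
    using herm_norm_mult[OF assms(1), of "lift_pt p"] lift_mat_act[OF assms] herm_norm_scale by metis
  also have "\<dots> < 0" using assms by (simp add: ball2_iff)
  finally show ?thesis by (simp add: ball2_iff mult_less_0_iff not_less)
qed

lemma mat_act_mult:
  assumes "A \<in> carrier U21" "B \<in> carrier U21" "p \<in> ball2"
  shows "mat_act (A ** B) p = mat_act A (mat_act B p)"
proof -
  let ?c = "(B *v lift_pt p) $ 3"
  have "(A ** B) *v lift_pt p = A *v (?c *s lift_pt (mat_act B p))"
    using lift_mat_act[OF assms(2,3)] by (simp flip: matrix_vector_mul_assoc)
  also have "\<dots> = ?c *s (A *v lift_pt (mat_act B p))"
    by (simp add: vector_scalar_commute)
  finally show ?thesis
    using denom_nonzero[OF assms(2,3)] by (simp add: vec_eq_iff forall_2 mat_act_nth)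
qed

lemma mat_act_one: "mat_act (mat 1) p = p"
  by (simp add: vec_eq_iff forall_2 mat_act_nth)

lemma PU21_cases:
  assumes "g \<in> carrier PU21"
  obtains A where "A \<in> carrier U21" "g = U21_scalars #>\<^bsub>U21\<^esub> A"
  using assms by (auto simp: PU21_def FactGroup_def RCOSETS_def)

lemma coset_in_PU21: "A \<in> carrier U21 \<Longrightarrow> U21_scalars #>\<^bsub>U21\<^esub> A \<in> carrier PU21"
  by (auto simp: PU21_def FactGroup_def RCOSETS_def)

lemma coset_mult:
  assumes "A \<in> carrier U21" "B \<in> carrier U21"
  shows "(U21_scalars #>\<^bsub>U21\<^esub> A) \<otimes>\<^bsub>PU21\<^esub> (U21_scalars #>\<^bsub>U21\<^esub> B) = U21_scalars #>\<^bsub>U21\<^esub> (A ** B)"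
  using normal.rcos_sum[OF normal_U21_scalars assms] by (simp add: PU21_def FactGroup_def U21_def)

lemma one_PU21: "\<one>\<^bsub>PU21\<^esub> = U21_scalars #>\<^bsub>U21\<^esub> mat 1"
proof -
  have "U21_scalars #>\<^bsub>U21\<^esub> \<one>\<^bsub>U21\<^esub> = U21_scalars"
    using normal_imp_subgroup[OF normal_U21_scalars]
    by (intro group.coset_mult_one group_U21 subgroup.subset)
  then show ?thesis by (simp add: PU21_def FactGroup_def U21_def)
qed

lemma PU21_act_ball2: "g \<in> carrier PU21 \<Longrightarrow> p \<in> ball2 \<Longrightarrow> PU21_act g p \<in> ball2"
  by (elim PU21_cases) (simp add: PU21_act_coset mat_act_ball2)

lemma PU21_act_mult:
  assumes "g \<in> carrier PU21" "h \<in> carrier PU21" "p \<in> ball2"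
  shows "PU21_act (g \<otimes>\<^bsub>PU21\<^esub> h) p = PU21_act g (PU21_act h p)"
proof -
  obtain A where A: "A \<in> carrier U21" "g = U21_scalars #>\<^bsub>U21\<^esub> A" using PU21_cases assms(1) .
  obtain B where B: "B \<in> carrier U21" "h = U21_scalars #>\<^bsub>U21\<^esub> B" using PU21_cases assms(2) .
  show ?thesis
    using A B assms(3) by (simp add: coset_mult PU21_act_coset U21_closed_mult mat_act_mult)
qed

lemma PU21_act_one: "PU21_act \<one>\<^bsub>PU21\<^esub> p = p"
proof -
  have "mat 1 \<in> carrier U21" using monoid.one_closed[OF group.is_monoid[OF group_U21]] by (simp add: U21_def)
  then show ?thesis by (simp add: one_PU21 PU21_act_coset mat_act_one)
qed

lemma open_ball2: "open ball2"
  unfolding ball2_def by (intro open_Collect_less continuous_intros)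

lemma ball2_eq_ball: "ball2 = ball 0 1"
proof -
  have *: "p \<in> ball2 \<longleftrightarrow> norm p < 1" for p
    by (simp add: ball2_def norm_vec_def L2_set_def sum_2)
  show ?thesis by (intro Set.set_eqI) (simp only: * mem_ball dist_0_norm)
qed

section \<open>Holomorphy of the action\<close>

text \<open>Both coordinates are quotients of affine functions whose denominator does not vanish on
  the ball, and the quotient rule preserves complex linearity of the derivative.\<close>

lemma mat_act_has_derivative:
  assumes "A \<in> carrier U21" "p \<in> ball2"
  shows "\<exists>D. (mat_act A has_derivative D) (at p) \<and> (\<forall>c v. D (c *s v) = c *s D v)"
proof -
  define num where "num i q = A $ i $ 1 * (q::complex^2) $ 1 + A $ i $ 2 * q $ 2 + A $ i $ 3" for i q
  define dnum where "dnum i v = A $ i $ 1 * (v::complex^2) $ 1 + A $ i $ 2 * v $ 2" for i v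
  have num: "(A *v lift_pt q) $ i = num i q" for i q
    by (simp add: matrix_vector_mult_def sum_3 num_def)
  have nz: "num 3 p \<noteq> 0" using denom_nonzero[OF assms] by (simp add: num)
  have dn: "(num i has_derivative dnum i) (at p)" for i
    unfolding num_def dnum_def
    by (auto intro!: derivative_eq_intros bounded_linear_imp_has_derivative bounded_linear_vec_nth)
  define f where "f i q = num i q / num 3 q" for i q
  define df where "df i v = (dnum i v * num 3 p - num i p * dnum 3 v) / (num 3 p * num 3 p)" for i v
  have df: "(f i has_derivative df i) (at p)" for i
    unfolding f_def df_def using nz by (intro has_derivative_divide' dn)
  have eq: "mat_act A = (\<lambda>q. \<chi> i. if i = 1 then f 1 q else f 2 q)"
    by (auto simp: fun_eq_iff vec_eq_iff forall_2 mat_act_nth num f_def)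
  \<comment> \<open>Differentiability is tested against the real basis vectors
    \<open>axis i a\<close>, whose inner product with a vector only sees coordinate i.\<close>
  have "((\<lambda>q. (if i = (1::2) then f 1 q else f 2 q) \<bullet> a) has_derivative
      (\<lambda>v. (if i = (1::2) then df 1 v else df 2 v) \<bullet> a)) (at p)" for i a
    using df by (cases "i = 1") (auto intro!: has_derivative_inner_left)
  then have "((\<lambda>q. \<chi> i. if i = 1 then f 1 q else f 2 q) has_derivative
      (\<lambda>v. \<chi> i. if i = (1::2) then df 1 v else df 2 v)) (at p)"
    by (subst has_derivative_componentwise_within) (auto simp: Basis_vec_def inner_axis)
  moreover have "df i (c *s v) = c * df i v" for i c v
    by (simp add: df_def dnum_def algebra_simps divide_simps)
  ultimately show ?thesis unfolding eq
    by (intro exI[of _ "\<lambda>v. \<chi> i. if i = (1::2) then df 1 v else df 2 v"])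
      (simp add: vec_eq_iff)
qed

section \<open>Proper discontinuity\<close>

lemma tendsto_matrix_mult:
  fixes f :: "'x \<Rightarrow> complex^3^3"
  assumes "(f \<longlongrightarrow> A) F" "(g \<longlongrightarrow> B) F"
  shows "((\<lambda>x. f x ** g x) \<longlongrightarrow> A ** B) F"
  unfolding matrix_matrix_mult_def
  by (intro vec_tendstoI) (simp, intro tendsto_intros assms)

lemma tendsto_adjoint_mat:
  assumes "(f \<longlongrightarrow> A) F"
  shows "((\<lambda>x. adjoint_mat (f x)) \<longlongrightarrow> adjoint_mat A) F"
  unfolding adjoint_mat_def
  by (intro vec_tendstoI) (simp, intro tendsto_intros assms)

lemma closed_U21: "closed (carrier U21)"
proof -
  have "continuous_on UNIV (\<lambda>A. adjoint_mat A ** herm_form ** A)"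
    unfolding continuous_on_def
    by (intro ballI tendsto_matrix_mult tendsto_adjoint_mat tendsto_const tendsto_ident_at)
  then show ?thesis unfolding U21_def by (simp add: closed_Collect_eq)
qed

text \<open>The inverse is a continuous expression in the matrix, so inverses can be taken to the
  limit along a convergent sequence of matrices.\<close>

lemma herm_inverse:
  assumes "A \<in> carrier U21"
  shows "(herm_form ** adjoint_mat A ** herm_form) ** A = mat 1"
    and "A ** (herm_form ** adjoint_mat A ** herm_form) = mat 1"
proof -
  show "(herm_form ** adjoint_mat A ** herm_form) ** A = mat 1"
    using assms by (simp add: U21_def herm_form_square flip: matrix_mul_assoc)
  then show "A ** (herm_form ** adjoint_mat A ** herm_form) = mat 1"
    by (simp add: matrix_left_right_inverse)
qed

lemma herm_inverse_in_U21:
  assumes "A \<in> carrier U21"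
  shows "herm_form ** adjoint_mat A ** herm_form \<in> carrier U21"
proof -
  obtain B where B: "B \<in> carrier U21" "B ** A = mat 1"
    using group.l_inv_ex[OF group_U21 assms] by (auto simp: U21_def)
  then have "B = herm_form ** adjoint_mat A ** herm_form"
    using herm_inverse(2)[OF assms] by (metis matrix_mul_assoc matrix_mul_lid matrix_mul_rid)
  then show ?thesis using B by simp
qed

text \<open>A left inverse of a square matrix is a right inverse, so the adjoint of A also preserves
  the form. These are the diagonal entries of that identity.\<close>

lemma U21_rows:
  assumes "A \<in> carrier U21"
  shows "(cmod (A $ i $ 1))\<^sup>2 + (cmod (A $ i $ 2))\<^sup>2 - (cmod (A $ i $ 3))\<^sup>2 = (if i = 3 then - 1 else 1)"
proof -
  have "A ** herm_form ** adjoint_mat A = (A ** (herm_form ** adjoint_mat A ** herm_form)) ** herm_form"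
    by (simp add: herm_form_square flip: matrix_mul_assoc)
  also have "\<dots> = herm_form" using herm_inverse(2)[OF assms] by simp
  finally have "(A ** herm_form ** adjoint_mat A) $ i $ i = (if i = 3 then - 1 else 1)"
    by (simp add: herm_form_def)
  then have "complex_of_real ((cmod (A $ i $ 1))\<^sup>2 + (cmod (A $ i $ 2))\<^sup>2 - (cmod (A $ i $ 3))\<^sup>2)
      = of_real (if i = 3 then - 1 else 1)"
    by (simp add: matrix_matrix_mult_def adjoint_mat_def herm_form_def sum_3 complex_norm_square
        flip: of_real_power split: if_splits)
  then show ?thesis using of_real_eq_iff by blast
qed

text \<open>The last row and the last column bound their other entries by the corner entry; feeding
  the column bound into the first two row identities bounds the rest. One entry thus controls the
  whole matrix.\<close>

lemma U21_entry_le: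
  assumes "A \<in> carrier U21"
  shows "cmod (A $ i $ j) \<le> cmod (A $ 3 $ 3)"
proof -
  have "A *v axis 3 1 = (\<chi> i. A $ i $ 3)" by (simp add: vec_eq_iff matrix_vector_mult_def axis_def sum_3)
  then have col: "(cmod (A $ 1 $ 3))\<^sup>2 + (cmod (A $ 2 $ 3))\<^sup>2 - (cmod (A $ 3 $ 3))\<^sup>2 = - 1"
    using herm_norm_mult[OF assms, of "axis 3 1"] by (simp add: herm_norm_def axis_def)
  note rows = U21_rows[OF assms, of 1, simplified] U21_rows[OF assms, of 2, simplified]
    U21_rows[OF assms, of 3, simplified]
  have sq: "0 \<le> (cmod (A $ k $ l))\<^sup>2" for k l by simp
  have "(cmod (A $ i $ j))\<^sup>2 \<le> (cmod (A $ 3 $ 3))\<^sup>2"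
    using exhaust_3[of i] exhaust_3[of j] rows col sq[of 1 1] sq[of 1 2] sq[of 1 3] sq[of 2 1]
      sq[of 2 2] sq[of 2 3] sq[of 3 1] sq[of 3 2]
    by (elim disjE; hypsubst; linarith)
  then show ?thesis by (rule power2_le_imp_le) simp
qed

lemma norm_matrix_le:
  fixes A :: "complex^3^3"
  assumes "\<And>i j. cmod (A $ i $ j) \<le> c"
  shows "norm A \<le> 9 * c"
proof -
  have "norm (A $ i) \<le> 3 * c" for i
  proof -
    have "norm (A $ i) \<le> (\<Sum>j\<in>UNIV. cmod (A $ i $ j))"
      unfolding norm_vec_def by (rule L2_set_le_sum) simp
    also have "\<dots> \<le> 3 * c" using assms[of i 1] assms[of i 2] assms[of i 3] by (simp add: sum_3)
    finally show ?thesis .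
  qed note row = this
  have "norm A \<le> (\<Sum>i\<in>UNIV. norm (A $ i))"
    unfolding norm_vec_def[of A] by (rule L2_set_le_sum) simp
  also have "\<dots> \<le> 9 * c" using row[of 1] row[of 2] row[of 3] by (simp add: sum_3)
  finally show ?thesis .
qed

text \<open>By the Cauchy-Schwarz inequality the first two entries of the last row contribute at
  most r times the corner entry, because \<open>U21_rows\<close> makes their norm at most that of
  the corner.\<close>

lemma denom_ge:
  assumes "A \<in> carrier U21" and "norm p \<le> r"
  shows "cmod (A $ 3 $ 3) * (1 - r) \<le> cmod ((A *v lift_pt p) $ 3)"
proof -
  let ?a = "A $ 3 $ 1" and ?b = "A $ 3 $ 2" and ?c = "A $ 3 $ 3"
  have r: "0 \<le> r" using assms(2) norm_ge_zero order_trans by blast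
  have "cmod (?a * p $ 1 + ?b * p $ 2) \<le> cmod ?a * cmod (p $ 1) + cmod ?b * cmod (p $ 2)"
    by (metis norm_mult norm_triangle_ineq)
  also have "\<dots> \<le> sqrt ((cmod ?a)\<^sup>2 + (cmod ?b)\<^sup>2) * sqrt ((cmod (p $ 1))\<^sup>2 + (cmod (p $ 2))\<^sup>2)"
  proof (rule power2_le_imp_le)
    show "(cmod ?a * cmod (p $ 1) + cmod ?b * cmod (p $ 2))\<^sup>2
      \<le> (sqrt ((cmod ?a)\<^sup>2 + (cmod ?b)\<^sup>2) * sqrt ((cmod (p $ 1))\<^sup>2 + (cmod (p $ 2))\<^sup>2))\<^sup>2"
      \<comment> \<open>With x = |a||p2| and y = |b||p1|, the bound 2xy \<le> x^2 + y^2 is precisely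
        the gap in the Cauchy-Schwarz inequality for pairs.\<close>
      using sum_squares_bound[of "cmod ?a * cmod (p $ 2)" "cmod ?b * cmod (p $ 1)"]
      by (simp add: power_mult_distrib) (simp add: power2_eq_square algebra_simps)
  qed simp
  also have "\<dots> \<le> cmod ?c * r"
  proof (rule mult_mono)
    have "(cmod ?a)\<^sup>2 + (cmod ?b)\<^sup>2 \<le> (cmod ?c)\<^sup>2" using U21_rows[OF assms(1), of 3] by simp
    then show "sqrt ((cmod ?a)\<^sup>2 + (cmod ?b)\<^sup>2) \<le> cmod ?c" by (simp add: real_le_lsqrt)
    show "sqrt ((cmod (p $ 1))\<^sup>2 + (cmod (p $ 2))\<^sup>2) \<le> r"
      using assms(2) by (simp add: norm_vec_def L2_set_def sum_2)
  qed (use r in auto)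
  finally have "cmod (?a * p $ 1 + ?b * p $ 2) \<le> cmod ?c * r" .
  moreover have "(A *v lift_pt p) $ 3 = ?c + (?a * p $ 1 + ?b * p $ 2)"
    by (simp add: matrix_vector_mult_def sum_3)
  moreover have "cmod ?c - cmod (?a * p $ 1 + ?b * p $ 2) \<le> cmod (?c + (?a * p $ 1 + ?b * p $ 2))"
    by (rule norm_diff_ineq)
  ultimately show ?thesis by (simp add: algebra_simps)
qed

text \<open>Invariance of the form bounds the automorphy factor from above when both p and its image
  stay in K, while \<open>denom_ge\<close> bounds it from below by a multiple of the corner
  entry.\<close>

lemma bounded_return_set:
  assumes "compact K" "K \<subseteq> ball2"
  shows "bounded {A \<in> carrier U21. \<exists>p\<in>K. mat_act A p \<in> K}"
proof (cases "K = {}")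
  case False
  then obtain k where k: "k \<in> K" "\<And>p. p \<in> K \<Longrightarrow> norm p \<le> norm k"
    using continuous_attains_sup[OF assms(1) _ continuous_on_norm_id] by auto
  define r where "r = norm k"
  \<comment> \<open>The largest norm on K is attained, hence strictly below 1. This keeps both 1 - r
    and 1 - r^2 positive.\<close>
  have r: "0 \<le> r" "r < 1" using k(1) assms(2) by (auto simp: r_def ball2_eq_ball)
  have r2: "r\<^sup>2 < 1" using r by (simp add: power_less_one_iff abs_square_less_1)
  define s where "s = sqrt (1 / (1 - r\<^sup>2)) / (1 - r)"
  have "norm A \<le> 9 * s" if A: "A \<in> carrier U21" and p: "p \<in> K" and q: "mat_act A p \<in> K" for A p
  proof (rule norm_matrix_le)
    have pb: "p \<in> ball2" using p assms(2) by blast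
    have hn: "herm_norm (lift_pt x) = (norm x)\<^sup>2 - 1" for x
      by (simp add: herm_norm_def norm_vec_def L2_set_def sum_2)
    let ?w = "cmod ((A *v lift_pt p) $ 3)"
    have "?w\<^sup>2 * herm_norm (lift_pt (mat_act A p)) = herm_norm (lift_pt p)"
      using herm_norm_mult[OF A, of "lift_pt p"] lift_mat_act[OF A pb] herm_norm_scale by metis
    then have "?w\<^sup>2 * (1 - (norm (mat_act A p))\<^sup>2) = 1 - (norm p)\<^sup>2"
      by (simp add: hn algebra_simps)
    also have "\<dots> \<le> 1" by simp
    finally have "?w\<^sup>2 * (1 - (norm (mat_act A p))\<^sup>2) \<le> 1" .
    moreover have "(norm (mat_act A p))\<^sup>2 \<le> r\<^sup>2" using k(2)[OF q] by (simp add: r_def power_mono)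
    then have "?w\<^sup>2 * (1 - r\<^sup>2) \<le> ?w\<^sup>2 * (1 - (norm (mat_act A p))\<^sup>2)"
      by (intro mult_left_mono) auto
    ultimately have "?w\<^sup>2 \<le> 1 / (1 - r\<^sup>2)" using r2 by (simp add: pos_le_divide_eq)
    then have w: "?w \<le> sqrt (1 / (1 - r\<^sup>2))" by (rule real_le_rsqrt)
    have "cmod (A $ 3 $ 3) * (1 - r) \<le> ?w" using k(2)[OF p] by (intro denom_ge[OF A]) (simp add: r_def)
    with w have "cmod (A $ 3 $ 3) \<le> s" using r by (simp add: s_def pos_le_divide_eq)
    then show "cmod (A $ i $ j) \<le> s" for i j using U21_entry_le[OF A, of i j] by simp
  qed
  then show ?thesis by (auto simp: bounded_iff)
qed simp

text \<open>Discreteness is stated in the quotient topology on cosets. The isolated identity is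
  pulled back to a neighbourhood of the identity matrix, where sequences of matrices can be
  tested.\<close>

lemma discrete_neighbourhood:
  assumes "discrete_subgroup \<Gamma>"
  obtains V where "open V" "mat 1 \<in> V"
    "\<And>A. A \<in> carrier U21 \<Longrightarrow> A \<in> V \<Longrightarrow> U21_scalars #>\<^bsub>U21\<^esub> A \<in> \<Gamma> \<Longrightarrow> U21_scalars #>\<^bsub>U21\<^esub> A = \<one>\<^bsub>PU21\<^esub>"
proof -
  have sub: "subgroup \<Gamma> PU21" and top: "subtopology PU21_top \<Gamma> = discrete_topology \<Gamma>"
    using assms by (auto simp: discrete_subgroup_def)
  have "openin (subtopology PU21_top \<Gamma>) {\<one>\<^bsub>PU21\<^esub>}"
    using subgroup.one_closed[OF sub] by (simp add: top)
  then obtain Q where Q: "openin PU21_top Q" "{\<one>\<^bsub>PU21\<^esub>} = Q \<inter> \<Gamma>"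
    by (auto simp: openin_subtopology)
  have "openin (top_of_set (carrier U21)) {A \<in> carrier U21. U21_scalars #>\<^bsub>U21\<^esub> A \<in> Q}"
    using Q(1) by (simp add: PU21_top_def openin_quot_top)
  then obtain V where V: "open V" "{A \<in> carrier U21. U21_scalars #>\<^bsub>U21\<^esub> A \<in> Q} = carrier U21 \<inter> V"
    by (auto simp: openin_open)
  show ?thesis
  proof (rule that[OF V(1)])
    have "mat 1 \<in> carrier U21" using monoid.one_closed[OF group.is_monoid[OF group_U21]] by (simp add: U21_def)
    then show "mat 1 \<in> V" using V(2) Q(2) one_PU21 by blast
  qed (use V(2) Q(2) in blast)
qed

text \<open>Infinitely many such elements would have bounded matrix representatives, hence a
  convergent subsequence, whose consecutive quotients lie in the lattice and approach the
  identity.\<close>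

lemma finite_return_set:
  assumes \<Gamma>: "discrete_subgroup \<Gamma>" and K: "compact K" "K \<subseteq> ball2"
  shows "finite {g \<in> \<Gamma>. \<exists>p\<in>K. PU21_act g p \<in> K}"
proof (rule ccontr)
  let ?coset = "\<lambda>A. U21_scalars #>\<^bsub>U21\<^esub> A"
  interpret P: group PU21 by (rule group_PU21)
  have sub: "subgroup \<Gamma> PU21" using \<Gamma> by (simp add: discrete_subgroup_def)
  assume "infinite {g \<in> \<Gamma>. \<exists>p\<in>K. PU21_act g p \<in> K}"
  then obtain f :: "nat \<Rightarrow> _" where f: "inj f" "range f \<subseteq> {g \<in> \<Gamma>. \<exists>p\<in>K. PU21_act g p \<in> K}"
    using infinite_countable_subset by blast
  have "\<exists>A. A \<in> carrier U21 \<and> f n = ?coset A \<and> (\<exists>p\<in>K. mat_act A p \<in> K)" for n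
  proof -
    have "f n \<in> \<Gamma>" "\<exists>p\<in>K. PU21_act (f n) p \<in> K" using f(2) by auto
    moreover from this(1) have "f n \<in> carrier PU21" using subgroup.subset[OF sub] by blast
    then obtain A where "A \<in> carrier U21" "f n = ?coset A" by (rule PU21_cases)
    ultimately show ?thesis using PU21_act_coset by metis
  qed
  then obtain A where A: "\<And>n. A n \<in> carrier U21" "\<And>n. f n = ?coset (A n)" "\<And>n. \<exists>p\<in>K. mat_act (A n) p \<in> K"
    by metis
  have "bounded (range A)"
    by (rule bounded_subset[OF bounded_return_set[OF K]]) (use A in auto)
  then obtain L r where r: "strict_mono r" "(A \<circ> r) \<longlonglongrightarrow> L"
    using bounded_imp_convergent_subsequence by blast
  have L: "L \<in> carrier U21" using closed_sequentially[OF closed_U21 _ r(2)] A(1) by simp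
  define I where "I M = herm_form ** adjoint_mat M ** herm_form" for M :: "complex^3^3"
  \<comment> \<open>The quotient of two consecutive members of the subsequence. Its limit is the
    identity, so discreteness forces it to be trivial for some n, against injectivity of
    \<open>f\<close>.\<close>
  define B where "B n = I (A (r n)) ** A (r (Suc n))" for n
  have "(\<lambda>n. A (r n)) \<longlonglongrightarrow> L" "(\<lambda>n. A (r (Suc n))) \<longlonglongrightarrow> L"
    using r(2) LIMSEQ_Suc[OF r(2)] by (simp_all add: o_def)
  then have "B \<longlonglongrightarrow> I L ** L"
    unfolding B_def I_def by (intro tendsto_matrix_mult tendsto_adjoint_mat tendsto_const)
  then have lim: "B \<longlonglongrightarrow> mat 1" using herm_inverse(1)[OF L] by (simp add: I_def)
  obtain V where V: "open V" "mat 1 \<in> V"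
    "\<And>A. A \<in> carrier U21 \<Longrightarrow> A \<in> V \<Longrightarrow> ?coset A \<in> \<Gamma> \<Longrightarrow> ?coset A = \<one>\<^bsub>PU21\<^esub>"
    using discrete_neighbourhood[OF \<Gamma>] by blast
  obtain n where n: "B n \<in> V"
    using topological_tendstoD[OF lim V(1,2)] eventually_sequentially by auto
  have B: "B n \<in> carrier U21"
    using herm_inverse_in_U21 A(1) by (simp add: B_def I_def U21_closed_mult)
  have "A (r n) ** B n = A (r (Suc n))"
    using herm_inverse(2)[OF A(1), of "r n"] by (simp add: B_def I_def matrix_mul_assoc)
  then have fr: "f (r n) \<otimes>\<^bsub>PU21\<^esub> ?coset (B n) = f (r (Suc n))"
    using coset_mult[OF A(1) B] by (simp add: A(2))
  have fG: "f m \<in> \<Gamma>" "f m \<in> carrier PU21" for m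
    using f(2) subgroup.subset[OF sub] by auto
  have "?coset (B n) = inv\<^bsub>PU21\<^esub> f (r n) \<otimes>\<^bsub>PU21\<^esub> f (r (Suc n))"
    using fr fG coset_in_PU21[OF B] P.inv_solve_left by metis
  then have "?coset (B n) \<in> \<Gamma>"
    using fG sub by (simp add: subgroup.m_closed subgroup.m_inv_closed)
  then have "?coset (B n) = \<one>\<^bsub>PU21\<^esub>" using V(3)[OF B n] by simp
  then have "f (r n) = f (r (Suc n))" using fr fG by simp
  then have "r n = r (Suc n)" using f(1) by (simp add: inj_eq)
  then show False using r(1) by (metis lessI less_irrefl strict_mono_less)
qed

lemma continuous_on_PU21_act:
  assumes "g \<in> carrier PU21"
  shows "continuous_on ball2 (PU21_act g)"
proof -
  obtain A where A: "A \<in> carrier U21" "g = U21_scalars #>\<^bsub>U21\<^esub> A" using assms by (rule PU21_cases)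
  have "isCont (mat_act A) p" if "p \<in> ball2" for p
    using mat_act_has_derivative[OF A(1) that] has_derivative_continuous by blast
  then have "continuous_on ball2 (mat_act A)" by (simp add: continuous_at_imp_continuous_on)
  then show ?thesis using A by (simp add: PU21_act_coset[OF A(1)] cong: continuous_on_cong)
qed

lemma open_PU21_vimage:
  assumes "g \<in> carrier PU21" "open W"
  shows "open {p \<in> ball2. PU21_act g p \<in> W}"
proof -
  have "open (PU21_act g -` W \<inter> ball2)"
    using continuous_on_open_vimage[OF open_ball2] continuous_on_PU21_act[OF assms(1)] assms(2) by blast
  then show ?thesis by (simp add: vimage_def Int_def conj_commute)
qed

text \<open>One statement serves two purposes: with p = q it yields evenly covered neighbourhoods,
  and with p and q in different orbits it separates the orbits.\<close>

lemma orbit_neighbourhoods: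
  assumes \<Gamma>: "discrete_subgroup \<Gamma>" and p: "p \<in> ball2" and q: "q \<in> ball2"
  obtains U V where "open U" "open V" "p \<in> U" "q \<in> V" "U \<subseteq> ball2" "V \<subseteq> ball2"
    "\<And>g x. g \<in> \<Gamma> \<Longrightarrow> x \<in> U \<Longrightarrow> PU21_act g x \<in> V \<Longrightarrow> PU21_act g p = q"
proof -
  have sub: "\<Gamma> \<subseteq> carrier PU21" using \<Gamma> subgroup.subset by (auto simp: discrete_subgroup_def)
  obtain d where d: "d > 0" "cball p d \<subseteq> ball2" using open_ball2 p open_contains_cball by blast
  obtain e where e: "e > 0" "cball q e \<subseteq> ball2" using open_ball2 q open_contains_cball by blast
  \<comment> \<open>The union of both closed balls is a single compact set that catches every
    element moving a point near p to a point near q.\<close>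
  define F where "F = {g \<in> \<Gamma>. \<exists>x\<in>cball p d \<union> cball q e. PU21_act g x \<in> cball p d \<union> cball q e}"
  have F: "finite F"
    unfolding F_def using d e by (intro finite_return_set[OF \<Gamma>] compact_Un compact_cball) auto
  have "\<exists>U V. open U \<and> open V \<and> p \<in> U \<and> q \<in> V \<and>
      (\<forall>x\<in>U. PU21_act g x \<in> V \<longrightarrow> PU21_act g p = q)" if "g \<in> F" for g
  proof (cases "PU21_act g p = q")
    case True
    then show ?thesis by (intro exI[of _ UNIV]) simp
  next
    case False
    then obtain W V where W: "open W" "open V" "PU21_act g p \<in> W" "q \<in> V" "W \<inter> V = {}"
      using separation_t2 by metis
    have g: "g \<in> carrier PU21" using that sub by (auto simp: F_def)
    show ?thesis
      using W p open_PU21_vimage[OF g W(1)]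
      by (intro exI[of _ "{x \<in> ball2. PU21_act g x \<in> W}"] exI[of _ V]) auto
  qed
  then obtain U V where UV: "\<And>g. g \<in> F \<Longrightarrow> open (U g) \<and> open (V g) \<and> p \<in> U g \<and> q \<in> V g \<and>
      (\<forall>x\<in>U g. PU21_act g x \<in> V g \<longrightarrow> PU21_act g p = q)" by metis
  show ?thesis
  proof (rule that[of "ball p d \<inter> (\<Inter>g\<in>F. U g)" "ball q e \<inter> (\<Inter>g\<in>F. V g)"])
    show "open (ball p d \<inter> (\<Inter>g\<in>F. U g))" "open (ball q e \<inter> (\<Inter>g\<in>F. V g))"
      using F UV by (auto intro!: open_INT)
    show "p \<in> ball p d \<inter> (\<Inter>g\<in>F. U g)" "q \<in> ball q e \<inter> (\<Inter>g\<in>F. V g)"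
      using d e UV by auto
    show "ball p d \<inter> (\<Inter>g\<in>F. U g) \<subseteq> ball2" "ball q e \<inter> (\<Inter>g\<in>F. V g) \<subseteq> ball2"
      using d e ball_subset_cball by blast+
    fix g x assume g: "g \<in> \<Gamma>" and x: "x \<in> ball p d \<inter> (\<Inter>g\<in>F. U g)"
      and y: "PU21_act g x \<in> ball q e \<inter> (\<Inter>g\<in>F. V g)"
    have "x \<in> cball p d \<union> cball q e" "PU21_act g x \<in> cball p d \<union> cball q e"
      using x y ball_subset_cball by blast+
    then have "g \<in> F" using g unfolding F_def by blast
    then show "PU21_act g p = q" using UV x y by blast
  qed
qed

lemma holomorphic2_on_cong:
  assumes "holomorphic2_on h U" "open U" "\<And>x. x \<in> U \<Longrightarrow> k x = h x"
  shows "holomorphic2_on k U"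
  unfolding holomorphic2_on_def
proof
  fix p assume p: "p \<in> U"
  then obtain D where "(h has_derivative D) (at p)" "\<forall>c v. D (c *s v) = c * D v"
    using assms(1) by (auto simp: holomorphic2_on_def)
  then show "\<exists>D. (k has_derivative D) (at p) \<and> (\<forall>c v. D (c *s v) = c * D v)"
    using has_derivative_transform_within_open[OF _ assms(2) p, of h D UNIV k] assms(3) by metis
qed

lemma holomorphic2_on_subset: "holomorphic2_on h U \<Longrightarrow> V \<subseteq> U \<Longrightarrow> holomorphic2_on h V"
  by (auto simp: holomorphic2_on_def)

lemma holomorphic2_on_locally:
  assumes "\<And>p. p \<in> U \<Longrightarrow> \<exists>V. p \<in> V \<and> holomorphic2_on h V"
  shows "holomorphic2_on h U"
  using assms by (fastforce simp: holomorphic2_on_def)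

lemma holomorphic2_on_PU21_act:
  assumes g: "g \<in> carrier PU21" and h: "holomorphic2_on h V"
    and U: "U \<subseteq> ball2" "\<And>p. p \<in> U \<Longrightarrow> PU21_act g p \<in> V"
  shows "holomorphic2_on (\<lambda>p. h (PU21_act g p)) U"
  unfolding holomorphic2_on_def
proof
  fix p assume p: "p \<in> U"
  obtain A where A: "A \<in> carrier U21" "g = U21_scalars #>\<^bsub>U21\<^esub> A" using g by (rule PU21_cases)
  have eq: "PU21_act g = mat_act A" using A by (simp add: PU21_act_coset fun_eq_iff)
  obtain D where D: "(mat_act A has_derivative D) (at p)" "\<forall>c v. D (c *s v) = c *s D v"
    using mat_act_has_derivative[OF A(1)] U(1) p by blast
  obtain E where E: "(h has_derivative E) (at (mat_act A p))" "\<forall>c v. E (c *s v) = c * E v"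
    using h U(2)[OF p] by (auto simp: holomorphic2_on_def eq)
  have "((\<lambda>q. h (mat_act A q)) has_derivative (\<lambda>v. E (D v))) (at p)"
    using diff_chain_at[OF D(1) E(1)] by (simp add: o_def)
  then show "\<exists>D. ((\<lambda>q. h (PU21_act g q)) has_derivative D) (at p) \<and> (\<forall>c v. D (c *s v) = c * D v)"
    unfolding eq using D(2) E(2) by (intro exI[of _ "\<lambda>v. E (D v)"]) simp
qed

section \<open>Ball quotients as complex surfaces\<close>

lemma holomorphic_map_compose:
  assumes f: "holomorphic_map S T f" and g: "holomorphic_map T R g"
  shows "holomorphic_map S R (g \<circ> f)"
  unfolding holomorphic_map_def
proof (intro conjI allI impI)
  have cf: "continuous_map (Top S) (Top T) f" and cg: "continuous_map (Top T) (Top R) g"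
    using f g by (auto simp: holomorphic_map_def)
  show "continuous_map (Top S) (Top R) (g \<circ> f)" using cf cg by (rule continuous_map_compose)
  fix U h assume U: "openin (Top R) U \<and> h \<in> Hol R U"
  let ?V = "{y \<in> topspace (Top T). g y \<in> U}"
  have "openin (Top T) ?V" using cg U by (auto simp: continuous_map_def)
  moreover have "h \<circ> g \<in> Hol T ?V" using g U by (auto simp: holomorphic_map_def)
  ultimately have "h \<circ> g \<circ> f \<in> Hol S {x \<in> topspace (Top S). f x \<in> ?V}"
    using f unfolding holomorphic_map_def by blast
  moreover have "{x \<in> topspace (Top S). f x \<in> ?V} = {x \<in> topspace (Top S). (g \<circ> f) x \<in> U}"
    using continuous_map_funspace[OF cf] by auto
  ultimately show "h \<circ> (g \<circ> f) \<in> Hol S {x \<in> topspace (Top S). (g \<circ> f) x \<in> U}"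
    by (simp add: comp_assoc)
qed

text \<open>The preimage of an open set shrinks to its intersection with U, and the restriction
  axiom of a function sheaf supplies the pulled-back functions there.\<close>

lemma holomorphic_map_restrict:
  assumes S: "function_sheaf S" and f: "holomorphic_map S T f"
    and U: "openin (Top S) U" and V: "openin (Top T) V" and "f ` U \<subseteq> V"
  shows "holomorphic_map (open_subspace S U) (open_subspace T V) f"
  unfolding holomorphic_map_def
proof (intro conjI allI impI)
  have cf: "continuous_map (Top S) (Top T) f" using f by (auto simp: holomorphic_map_def)
  show "continuous_map (Top (open_subspace S U)) (Top (open_subspace T V)) f"
    using assms(5) cf openin_subset[OF U]
    by (auto simp: open_subspace_def continuous_map_in_subtopology continuous_map_from_subtopology)
  fix W h assume W: "openin (Top (open_subspace T V)) W \<and> h \<in> Hol (open_subspace T V) W"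
  then have W': "openin (Top T) W" "h \<in> Hol T W"
    using openin_trans_full[OF _ V] by (auto simp: open_subspace_def)
  let ?P = "{x \<in> topspace (Top S). f x \<in> W}"
  let ?Q = "{x \<in> topspace (Top (open_subspace S U)). f x \<in> W}"
  have P: "openin (Top S) ?P" "h \<circ> f \<in> Hol S ?P"
    using f W' cf by (auto simp: holomorphic_map_def continuous_map_def)
  have eq: "?Q = ?P \<inter> U" by (auto simp: open_subspace_def)
  have "openin (Top S) ?Q" unfolding eq using P U by blast
  then have "h \<circ> f \<in> Hol S ?Q"
    using S P eq unfolding function_sheaf_def by (metis (no_types, lifting) inf_le1)
  then show "h \<circ> f \<in> Hol (open_subspace S U) ?Q" by (simp add: open_subspace_def)
qed

lemma discrete_subgroup_subset:
  assumes \<Gamma>: "discrete_subgroup \<Gamma>" and N: "subgroup N PU21" "N \<subseteq> \<Gamma>"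
  shows "discrete_subgroup N"
proof -
  have "subtopology PU21_top N = subtopology (subtopology PU21_top \<Gamma>) N"
    using N(2) by (simp add: subtopology_subtopology Int_absorb1)
  also have "\<dots> = discrete_topology N"
    using \<Gamma> N(2) by (simp add: discrete_subgroup_def Int_absorb1)
  finally show ?thesis using N(1) by (simp add: discrete_subgroup_def)
qed

locale ball_lattice =
  fixes \<Gamma> :: "(complex^3^3) set set"
  assumes discrete: "discrete_subgroup \<Gamma>" and free: "acts_freely_on_ball \<Gamma>"
begin

lemma subgroup: "subgroup \<Gamma> PU21"
  using discrete by (simp add: discrete_subgroup_def)

lemma \<Gamma>_closed: "g \<in> \<Gamma> \<Longrightarrow> g \<in> carrier PU21"
  using subgroup.subset[OF subgroup] by blast

lemma ball_orbit_eq: "ball_orbit \<Gamma> p = (\<lambda>g. PU21_act g p) ` \<Gamma>"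
  by (auto simp: ball_orbit_def orbit_def)

lemma inv_act:
  assumes "g \<in> carrier PU21" "p \<in> ball2"
  shows "PU21_act (inv\<^bsub>PU21\<^esub> g) (PU21_act g p) = p"
  using PU21_act_mult[of "inv\<^bsub>PU21\<^esub> g" g p] assms group.inv_closed[OF group_PU21]
    group.l_inv[OF group_PU21] by (simp add: PU21_act_one)

lemma ball_orbit_act:
  assumes "g \<in> \<Gamma>" "p \<in> ball2"
  shows "ball_orbit \<Gamma> (PU21_act g p) = ball_orbit \<Gamma> p"
proof -
  have sub: "ball_orbit \<Gamma> (PU21_act h q) \<subseteq> ball_orbit \<Gamma> q" if h: "h \<in> \<Gamma>" and q: "q \<in> ball2" for h q
  proof
    fix x assume "x \<in> ball_orbit \<Gamma> (PU21_act h q)"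
    then obtain k where k: "k \<in> \<Gamma>" "x = PU21_act k (PU21_act h q)" by (auto simp: ball_orbit_eq)
    then have "x = PU21_act (k \<otimes>\<^bsub>PU21\<^esub> h) q" using h q by (simp add: PU21_act_mult \<Gamma>_closed)
    then show "x \<in> ball_orbit \<Gamma> q"
      using subgroup.m_closed[OF subgroup k(1) h] by (auto simp: ball_orbit_eq)
  qed
  have "inv\<^bsub>PU21\<^esub> g \<in> \<Gamma>" using subgroup.m_inv_closed[OF subgroup assms(1)] .
  then have "ball_orbit \<Gamma> p \<subseteq> ball_orbit \<Gamma> (PU21_act g p)"
    using sub[of "inv\<^bsub>PU21\<^esub> g" "PU21_act g p"] assms
    by (simp add: inv_act PU21_act_ball2 \<Gamma>_closed)
  then show ?thesis using sub[OF assms] by blast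
qed

lemma mem_ball_orbit: "p \<in> ball_orbit \<Gamma> p"
  using subgroup.one_closed[OF subgroup] PU21_act_one[of p] unfolding ball_orbit_eq
  by (metis image_eqI)

lemma ball_orbit_eq_iff:
  assumes "p \<in> ball2"
  shows "ball_orbit \<Gamma> p = ball_orbit \<Gamma> q \<longleftrightarrow> (\<exists>g\<in>\<Gamma>. q = PU21_act g p)"
proof
  assume "ball_orbit \<Gamma> p = ball_orbit \<Gamma> q"
  then show "\<exists>g\<in>\<Gamma>. q = PU21_act g p" using mem_ball_orbit[of q] by (auto simp: ball_orbit_eq)
next
  assume "\<exists>g\<in>\<Gamma>. q = PU21_act g p"
  then show "ball_orbit \<Gamma> p = ball_orbit \<Gamma> q" using ball_orbit_act assms by auto
qed

lemma topspace_quotient: "topspace (Top (ball_quotient \<Gamma>)) = ball_orbit \<Gamma> ` ball2"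
  by (simp add: ball_quotient_def topspace_quot_top)

lemma openin_quotient:
  "openin (Top (ball_quotient \<Gamma>)) V \<longleftrightarrow>
    V \<subseteq> ball_orbit \<Gamma> ` ball2 \<and> open {p \<in> ball2. ball_orbit \<Gamma> p \<in> V}"
  by (auto simp: ball_quotient_def openin_quot_top openin_open_eq[OF open_ball2])

text \<open>The saturation of U is the union of its translates. This is why the projection to the
  quotient is an open map.\<close>

lemma vimage_image_orbit:
  "{p \<in> ball2. ball_orbit \<Gamma> p \<in> ball_orbit \<Gamma> ` U} = (\<Union>g\<in>\<Gamma>. {p \<in> ball2. PU21_act g p \<in> U})"
proof -
  have "ball_orbit \<Gamma> p \<in> ball_orbit \<Gamma> ` U \<longleftrightarrow> (\<exists>g\<in>\<Gamma>. PU21_act g p \<in> U)" if "p \<in> ball2" for p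
    unfolding image_iff ball_orbit_eq_iff[OF that] by blast
  then show ?thesis by blast
qed

lemma openin_image_orbit:
  assumes "open U" "U \<subseteq> ball2"
  shows "openin (Top (ball_quotient \<Gamma>)) (ball_orbit \<Gamma> ` U)"
proof -
  have "open (\<Union>g\<in>\<Gamma>. {p \<in> ball2. PU21_act g p \<in> U})"
    by (intro open_UN ballI open_PU21_vimage \<Gamma>_closed assms)
  then show ?thesis
    using assms(2) by (simp only: openin_quotient vimage_image_orbit image_mono simp_thms)
qed

lemma Hol_quotient:
  "h \<in> Hol (ball_quotient \<Gamma>) U \<longleftrightarrow>
    holomorphic2_on (\<lambda>p. h (ball_orbit \<Gamma> p)) {p \<in> ball2. ball_orbit \<Gamma> p \<in> U}"
  by (simp add: ball_quotient_def o_def)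

lemma function_sheaf_quotient: "function_sheaf (ball_quotient \<Gamma>)"
  unfolding function_sheaf_def
proof (intro conjI allI impI)
  fix U V h k
  assume *: "openin (Top (ball_quotient \<Gamma>)) U \<and> openin (Top (ball_quotient \<Gamma>)) V \<and> V \<subseteq> U \<and>
    h \<in> Hol (ball_quotient \<Gamma>) U \<and> (\<forall>x\<in>V. k x = h x)"
  then have V: "open {p \<in> ball2. ball_orbit \<Gamma> p \<in> V}" and "V \<subseteq> U"
    and h: "holomorphic2_on (\<lambda>p. h (ball_orbit \<Gamma> p)) {p \<in> ball2. ball_orbit \<Gamma> p \<in> U}"
    and k: "\<And>x. x \<in> V \<Longrightarrow> k x = h x"
    unfolding openin_quotient Hol_quotient by blast+
  have "holomorphic2_on (\<lambda>p. h (ball_orbit \<Gamma> p)) {p \<in> ball2. ball_orbit \<Gamma> p \<in> V}"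
    by (rule holomorphic2_on_subset[OF h]) (use \<open>V \<subseteq> U\<close> in blast)
  then show "k \<in> Hol (ball_quotient \<Gamma>) V"
    unfolding Hol_quotient by (rule holomorphic2_on_cong) (rule V, rule k, simp)
next
  fix U h
  assume *: "openin (Top (ball_quotient \<Gamma>)) U \<and> (\<forall>p\<in>U. \<exists>V. openin (Top (ball_quotient \<Gamma>)) V \<and>
    p \<in> V \<and> V \<subseteq> U \<and> h \<in> Hol (ball_quotient \<Gamma>) V)"
  show "h \<in> Hol (ball_quotient \<Gamma>) U"
    unfolding Hol_quotient
  proof (rule holomorphic2_on_locally)
    fix p assume p: "p \<in> {p \<in> ball2. ball_orbit \<Gamma> p \<in> U}"
    then have "ball_orbit \<Gamma> p \<in> U" by blast
    then obtain V where "ball_orbit \<Gamma> p \<in> V" "h \<in> Hol (ball_quotient \<Gamma>) V" using * by metis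
    then show "\<exists>W. p \<in> W \<and> holomorphic2_on (\<lambda>p. h (ball_orbit \<Gamma> p)) W"
      using p by (intro exI[of _ "{p \<in> ball2. ball_orbit \<Gamma> p \<in> V}"]) (simp add: Hol_quotient)
  qed
qed

text \<open>Evenly covered open sets: translates by distinct lattice elements are disjoint, so the
  projection is injective on each of them and its inverse serves as a chart.\<close>

definition small :: "(complex^2) set \<Rightarrow> bool" where
  "small U \<longleftrightarrow> open U \<and> U \<subseteq> ball2 \<and>
    (\<forall>g\<in>\<Gamma>. \<forall>x\<in>U. PU21_act g x \<in> U \<longrightarrow> g = \<one>\<^bsub>PU21\<^esub>)"

lemma small_neighbourhood:
  assumes "p \<in> ball2"
  obtains U where "small U" "p \<in> U"
proof -
  obtain U V where UV: "open U" "open V" "p \<in> U" "p \<in> V" "U \<subseteq> ball2" "V \<subseteq> ball2"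
    "\<And>g x. g \<in> \<Gamma> \<Longrightarrow> x \<in> U \<Longrightarrow> PU21_act g x \<in> V \<Longrightarrow> PU21_act g p = p"
    using orbit_neighbourhoods[OF discrete assms assms] by metis
  have "small (U \<inter> V)"
    using UV free assms unfolding small_def acts_freely_on_ball_def by blast
  then show ?thesis using that UV by blast
qed

lemma inj_on_small: "small U \<Longrightarrow> inj_on (ball_orbit \<Gamma>) U"
proof (rule inj_onI)
  fix x y assume U: "small U" "x \<in> U" "y \<in> U" "ball_orbit \<Gamma> x = ball_orbit \<Gamma> y"
  then have "x \<in> ball2" by (auto simp: small_def)
  then obtain g where "g \<in> \<Gamma>" "y = PU21_act g x" using U(4) ball_orbit_eq_iff by blast
  then show "x = y" using U PU21_act_one by (auto simp: small_def)
qed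

lemma holomorphic_map_orbit:
  assumes "small U"
  shows "holomorphic_map (C2_domain U) (open_subspace (ball_quotient \<Gamma>) (ball_orbit \<Gamma> ` U)) (ball_orbit \<Gamma>)"
  unfolding holomorphic_map_def
proof (intro conjI allI impI)
  have U: "open U" "U \<subseteq> ball2" using assms by (auto simp: small_def)
  have "continuous_map (top_of_set ball2) (Top (ball_quotient \<Gamma>)) (ball_orbit \<Gamma>)"
    using quotient_imp_continuous_map[OF quotient_map_quot_top] by (simp add: ball_quotient_def)
  then have "continuous_map (top_of_set U) (Top (ball_quotient \<Gamma>)) (ball_orbit \<Gamma>)"
    using U(2) continuous_map_from_subtopology_mono by blast
  then show "continuous_map (Top (C2_domain U))
      (Top (open_subspace (ball_quotient \<Gamma>) (ball_orbit \<Gamma> ` U))) (ball_orbit \<Gamma>)"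
    by (auto simp: C2_domain_def open_subspace_def continuous_map_in_subtopology)
  fix W h assume W: "openin (Top (open_subspace (ball_quotient \<Gamma>) (ball_orbit \<Gamma> ` U))) W \<and>
    h \<in> Hol (open_subspace (ball_quotient \<Gamma>) (ball_orbit \<Gamma> ` U)) W"
  then have "holomorphic2_on (\<lambda>p. h (ball_orbit \<Gamma> p)) {p \<in> ball2. ball_orbit \<Gamma> p \<in> W}"
    by (simp add: open_subspace_def Hol_quotient)
  then have "holomorphic2_on (h \<circ> ball_orbit \<Gamma>) {x \<in> U. ball_orbit \<Gamma> x \<in> W}"
    unfolding o_def by (rule holomorphic2_on_subset) (use U in auto)
  then show "h \<circ> ball_orbit \<Gamma> \<in> Hol (C2_domain U) {x \<in> topspace (Top (C2_domain U)). ball_orbit \<Gamma> x \<in> W}"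
    by (simp add: C2_domain_def)
qed

lemma holomorphic_map_chart:
  assumes "small U"
  shows "holomorphic_map (open_subspace (ball_quotient \<Gamma>) (ball_orbit \<Gamma> ` U)) (C2_domain U)
    (inv_into U (ball_orbit \<Gamma>))"
  unfolding holomorphic_map_def
proof (intro conjI allI impI)
  let ?q = "ball_orbit \<Gamma>" and ?c = "inv_into U (ball_orbit \<Gamma>)"
  have U: "open U" "U \<subseteq> ball2" using assms by (auto simp: small_def)
  note inj = inj_on_small[OF assms]
  have cq: "?c (?q x) = x" if "x \<in> U" for x using inj that by simp
  have top: "topspace (Top (open_subspace (ball_quotient \<Gamma>) (?q ` U))) = ?q ` U"
    using U(2) by (auto simp: open_subspace_def topspace_quotient)
  have pre: "{x \<in> ?q ` U. ?c x \<in> W} = ?q ` W" if "W \<subseteq> U" for W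
    using that cq by force
  show "continuous_map (Top (open_subspace (ball_quotient \<Gamma>) (?q ` U))) (Top (C2_domain U)) ?c"
    unfolding continuous_map_def top
  proof (intro conjI allI impI)
    show "?c \<in> ?q ` U \<rightarrow> topspace (Top (C2_domain U))"
      using cq by (auto simp: C2_domain_def)
    fix W assume "openin (Top (C2_domain U)) W"
    then have W: "open W" "W \<subseteq> U" using U(1) by (auto simp: C2_domain_def openin_open_eq)
    have "openin (Top (ball_quotient \<Gamma>)) (?q ` W)" using W U by (intro openin_image_orbit) auto
    then show "openin (Top (open_subspace (ball_quotient \<Gamma>) (?q ` U))) {x \<in> ?q ` U. ?c x \<in> W}"
      unfolding pre[OF W(2)] using W(2) by (auto simp: open_subspace_def openin_subtopology)
  qed
  fix W h assume "openin (Top (C2_domain U)) W \<and> h \<in> Hol (C2_domain U) W"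
  then have W: "open W" "W \<subseteq> U" "holomorphic2_on h W"
    using U(1) by (auto simp: C2_domain_def openin_open_eq)
  have "holomorphic2_on (\<lambda>p. (h \<circ> ?c) (?q p)) {p \<in> ball2. ?q p \<in> ?q ` W}"
  \<comment> \<open>The saturation of W contains points far from W. Near such a point p the
    pulled-back function is h composed with an element g that carries p into W.\<close>
  proof (rule holomorphic2_on_locally)
    fix p assume p: "p \<in> {p \<in> ball2. ?q p \<in> ?q ` W}"
    then obtain g where g: "g \<in> \<Gamma>" "PU21_act g p \<in> W"
      using vimage_image_orbit[of W] by blast
    let ?N = "{p \<in> ball2. PU21_act g p \<in> W}"
    have gc: "g \<in> carrier PU21" using g \<Gamma>_closed by blast
    have "holomorphic2_on (\<lambda>p. h (PU21_act g p)) ?N"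
      by (rule holomorphic2_on_PU21_act[OF gc W(3)]) auto
    moreover have "open ?N" using open_PU21_vimage[OF gc W(1)] .
    moreover have "(h \<circ> ?c) (?q x) = h (PU21_act g x)" if "x \<in> ?N" for x
      using that cq[of "PU21_act g x"] ball_orbit_act[OF g(1), of x] W(2) by auto
    ultimately have "holomorphic2_on (\<lambda>p. (h \<circ> ?c) (?q p)) ?N" by (rule holomorphic2_on_cong)
    then show "\<exists>V. p \<in> V \<and> holomorphic2_on (\<lambda>p. (h \<circ> ?c) (?q p)) V"
      using g p by (intro exI[of _ ?N]) simp
  qed
  then show "h \<circ> ?c \<in> Hol (open_subspace (ball_quotient \<Gamma>) (?q ` U))
      {x \<in> topspace (Top (open_subspace (ball_quotient \<Gamma>) (?q ` U))). ?c x \<in> W}"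
    unfolding top pre[OF W(2)] by (simp add: open_subspace_def Hol_quotient)
qed

lemma complex_surface_quotient: "complex_surface (ball_quotient \<Gamma>)"
  unfolding complex_surface_def
proof (intro conjI ballI)
  let ?q = "ball_orbit \<Gamma>"
  have quotient: "quotient_map (top_of_set ball2) (Top (ball_quotient \<Gamma>)) ?q"
    by (simp add: ball_quotient_def quotient_map_quot_top)
  show "topspace (Top (ball_quotient \<Gamma>)) \<noteq> {}"
    by (simp add: topspace_quotient ball2_eq_ball)
  have "connected_space (top_of_set ball2)"
    by (simp add: connected_space_subtopology ball2_eq_ball connectedin_iff_connected)
  then show "connected_space (Top (ball_quotient \<Gamma>))"
    using connected_space_quotient_map_image[OF quotient] by blast
  show "Hausdorff_space (Top (ball_quotient \<Gamma>))"
    unfolding Hausdorff_space_def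
  proof (intro allI impI)
    fix x y assume "x \<in> topspace (Top (ball_quotient \<Gamma>)) \<and> y \<in> topspace (Top (ball_quotient \<Gamma>)) \<and> x \<noteq> y"
    then obtain p p' where p: "p \<in> ball2" "p' \<in> ball2" "x = ?q p" "y = ?q p'" "?q p \<noteq> ?q p'"
      by (auto simp: topspace_quotient)
    then obtain U V where UV: "open U" "open V" "p \<in> U" "p' \<in> V" "U \<subseteq> ball2" "V \<subseteq> ball2"
      "\<And>g x. g \<in> \<Gamma> \<Longrightarrow> x \<in> U \<Longrightarrow> PU21_act g x \<in> V \<Longrightarrow> PU21_act g p = p'"
      using orbit_neighbourhoods[OF discrete p(1,2)] by metis
    have "disjnt (?q ` U) (?q ` V)"
    proof (rule ccontr)
      assume "\<not> disjnt (?q ` U) (?q ` V)"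
      then obtain u v where "u \<in> U" "v \<in> V" "?q u = ?q v" by (auto simp: disjnt_def)
      then obtain g where "g \<in> \<Gamma>" "PU21_act g u \<in> V"
        using ball_orbit_eq_iff[of u v] UV(5) by blast
      then have "PU21_act g p = p'" using UV(7) \<open>u \<in> U\<close> by blast
      then show False using p ball_orbit_act[OF \<open>g \<in> \<Gamma>\<close>] by blast
    qed
    then show "\<exists>U V. openin (Top (ball_quotient \<Gamma>)) U \<and> openin (Top (ball_quotient \<Gamma>)) V \<and>
        x \<in> U \<and> y \<in> V \<and> disjnt U V"
      using UV p openin_image_orbit by (intro exI[of _ "?q ` U"] exI[of _ "?q ` V"]) auto
  qed
  obtain \<B> :: "(complex^2) set set" where \<B>: "countable \<B>" "\<And>C. C \<in> \<B> \<Longrightarrow> open C"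
    "\<And>S. open S \<Longrightarrow> \<exists>U. U \<subseteq> \<B> \<and> S = \<Union>U"
    by (rule univ_second_countable[where 'a = "complex^2"]) (rule that)
  have "\<exists>V\<in>\<B>. x \<in> V \<and> V \<subseteq> U" if "open U" "x \<in> U" for U x
    using \<B>(3)[OF that(1)] that(2) by blast
  with \<B>(1,2) have "second_countable (euclidean :: (complex^2) topology)"
    unfolding second_countable_def open_openin[symmetric] by (intro exI[of _ \<B>]) simp
  then have "second_countable (top_of_set ball2)" by (rule second_countable_subtopology)
  \<comment> \<open>Openness of the projection is what carries a countable base from the ball to the
    quotient.\<close>
  moreover have "open_map (top_of_set ball2) (Top (ball_quotient \<Gamma>)) ?q"
    by (auto simp: open_map_def openin_open_eq[OF open_ball2] openin_image_orbit)
  ultimately show "second_countable (Top (ball_quotient \<Gamma>))"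
    using second_countable_open_map_image quotient_imp_continuous_map[OF quotient]
      quotient_imp_surjective_map[OF quotient] by metis
  show "function_sheaf (ball_quotient \<Gamma>)" by (rule function_sheaf_quotient)
  fix x assume "x \<in> topspace (Top (ball_quotient \<Gamma>))"
  then obtain p where p: "p \<in> ball2" "x = ?q p" by (auto simp: topspace_quotient)
  obtain U where U: "small U" "p \<in> U" using small_neighbourhood[OF p(1)] .
  have U': "open U" "U \<subseteq> ball2" using U(1) by (auto simp: small_def)
  have "biholomorphic_map (open_subspace (ball_quotient \<Gamma>) (?q ` U)) (C2_domain U) (inv_into U ?q)"
    unfolding biholomorphic_map_def
    using holomorphic_map_chart[OF U(1)] holomorphic_map_orbit[OF U(1)] inj_on_small[OF U(1)]
    by (intro conjI exI[of _ ?q]) (auto simp: open_subspace_def C2_domain_def f_inv_into_f)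
  then show "\<exists>U V c. openin (Top (ball_quotient \<Gamma>)) U \<and> x \<in> U \<and> open V \<and>
      biholomorphic_map (open_subspace (ball_quotient \<Gamma>) U) (C2_domain V) c"
    using openin_image_orbit[OF U'] U p U' by (intro exI[of _ "?q ` U"] exI[of _ U]) auto
qed

end

section \<open>Unramified quotients of ball quotients\<close>

text \<open>Covers both kinds of maps between ball quotients that occur later: projections to a
  larger group, with a the identity, and deck transformations, with N = M.\<close>

lemma holomorphic_map_equivariant:
  assumes N: "ball_lattice N" and M: "ball_lattice M" and a: "a \<in> carrier PU21"
    and F: "\<And>p. p \<in> ball2 \<Longrightarrow> F (ball_orbit N p) = ball_orbit M (PU21_act a p)"
  shows "holomorphic_map (ball_quotient N) (ball_quotient M) F"
  unfolding holomorphic_map_def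
proof (intro conjI allI impI)
  interpret N: ball_lattice N by fact
  interpret M: ball_lattice M by fact
  have quotN: "quotient_map (top_of_set ball2) (Top (ball_quotient N)) (ball_orbit N)"
    and quotM: "quotient_map (top_of_set ball2) (Top (ball_quotient M)) (ball_orbit M)"
    by (simp_all add: ball_quotient_def quotient_map_quot_top)
  have "continuous_map (top_of_set ball2) (top_of_set ball2) (PU21_act a)"
    using continuous_on_PU21_act[OF a] PU21_act_ball2[OF a] by (auto simp: continuous_map_in_subtopology)
  then have "continuous_map (top_of_set ball2) (Top (ball_quotient M)) (ball_orbit M \<circ> PU21_act a)"
    using quotient_imp_continuous_map[OF quotM] by (rule continuous_map_compose)
  then have "continuous_map (top_of_set ball2) (Top (ball_quotient M)) (F \<circ> ball_orbit N)"
    by (rule continuous_map_eq) (simp add: F)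
  then show cont: "continuous_map (Top (ball_quotient N)) (Top (ball_quotient M)) F"
    by (rule continuous_compose_quotient_map[OF quotN])
  fix U h assume *: "openin (Top (ball_quotient M)) U \<and> h \<in> Hol (ball_quotient M) U"
  let ?P = "{x \<in> topspace (Top (ball_quotient N)). F x \<in> U}"
  let ?Q = "{p \<in> ball2. ball_orbit N p \<in> ?P}"
  have P: "openin (Top (ball_quotient N)) ?P"
    using cont * by (simp add: continuous_map_def)
  have "holomorphic2_on (\<lambda>p. h (ball_orbit M (PU21_act a p))) ?Q"
  proof (rule holomorphic2_on_PU21_act[OF a])
    show "holomorphic2_on (\<lambda>p. h (ball_orbit M p)) {p \<in> ball2. ball_orbit M p \<in> U}"
      using * by (simp add: M.Hol_quotient)
    show "PU21_act a p \<in> {p \<in> ball2. ball_orbit M p \<in> U}" if "p \<in> ?Q" for p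
      using that F PU21_act_ball2[OF a] by auto
  qed auto
  then have "holomorphic2_on (\<lambda>p. (h \<circ> F) (ball_orbit N p)) ?Q"
    by (rule holomorphic2_on_cong) (use P F in \<open>simp_all add: N.openin_quotient\<close>)
  then show "h \<circ> F \<in> Hol (ball_quotient N) ?P" by (simp add: N.Hol_quotient)
qed

text \<open>The kernel is a parameter fixed by an equation, so that interpretations can put
  \<open>Gamma_Z\<close> or \<open>Gamma_W\<close> in its place.\<close>

locale ball_lattice_quotient = ball_lattice \<Lambda> for \<Lambda> +
  fixes G :: "('g, 'm) monoid_scheme" and \<psi> :: "(complex^3^3) set \<Rightarrow> 'g" and N
  assumes group_G: "group G" and hom: "\<psi> \<in> hom (PU21\<lparr>carrier := \<Lambda>\<rparr>) G"
    and onto: "\<psi> ` \<Lambda> = carrier G" and N_def: "N = {g \<in> \<Lambda>. \<psi> g = \<one>\<^bsub>G\<^esub>}"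
begin

sublocale P: group PU21 by (rule group_PU21)

sublocale L: group_hom "PU21\<lparr>carrier := \<Lambda>\<rparr>" G \<psi>
  using group_G hom subgroup by (intro group_hom.intro group_hom_axioms.intro P.subgroup_imp_group)

lemma hom_mult: "g \<in> \<Lambda> \<Longrightarrow> h \<in> \<Lambda> \<Longrightarrow> \<psi> (g \<otimes>\<^bsub>PU21\<^esub> h) = \<psi> g \<otimes>\<^bsub>G\<^esub> \<psi> h"
  using L.hom_mult[of g h] by simp

lemma hom_inv: "g \<in> \<Lambda> \<Longrightarrow> \<psi> (inv\<^bsub>PU21\<^esub> g) = inv\<^bsub>G\<^esub> \<psi> g"
  using L.hom_inv[of g] P.m_inv_consistent[OF subgroup] by simp

lemma hom_closed: "g \<in> \<Lambda> \<Longrightarrow> \<psi> g \<in> carrier G"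
  using L.hom_closed[of g] by simp

lemmas mult_closed = subgroup.m_closed[OF subgroup]
lemmas inv_closed = subgroup.m_inv_closed[OF subgroup]

lemma subgroup_N: "subgroup N PU21"
proof -
  have "subgroup (kernel (PU21\<lparr>carrier := \<Lambda>\<rparr>) G \<psi>) (PU21\<lparr>carrier := \<Lambda>\<rparr>)" by (rule L.subgroup_kernel)
  then have "subgroup N (PU21\<lparr>carrier := \<Lambda>\<rparr>)" by (simp add: kernel_def N_def)
  then show ?thesis using P.incl_subgroup[OF subgroup] by blast
qed

sublocale N: ball_lattice N
proof
  have sub: "N \<subseteq> \<Lambda>" by (auto simp: N_def)
  show "acts_freely_on_ball N" using free sub by (auto simp: acts_freely_on_ball_def)
  show "discrete_subgroup N" by (rule discrete_subgroup_subset[OF discrete subgroup_N sub])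
qed

text \<open>Normality of the kernel: conjugation by g permutes N, in both directions.\<close>

lemma act_image_orbit:
  assumes g: "g \<in> \<Lambda>" and p: "p \<in> ball2"
  shows "PU21_act g ` ball_orbit N p = ball_orbit N (PU21_act g p)"
proof -
  have "PU21_act g (PU21_act n p) = PU21_act (g \<otimes>\<^bsub>PU21\<^esub> n \<otimes>\<^bsub>PU21\<^esub> inv\<^bsub>PU21\<^esub> g) (PU21_act g p)"
    "g \<otimes>\<^bsub>PU21\<^esub> n \<otimes>\<^bsub>PU21\<^esub> inv\<^bsub>PU21\<^esub> g \<in> N" if n: "n \<in> N" for n
  proof -
    have nL: "n \<in> \<Lambda>" using n by (simp add: N_def)
    have c: "g \<in> carrier PU21" "n \<in> carrier PU21" using g nL \<Gamma>_closed by auto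
    have "PU21_act (g \<otimes>\<^bsub>PU21\<^esub> n \<otimes>\<^bsub>PU21\<^esub> inv\<^bsub>PU21\<^esub> g) (PU21_act g p) = PU21_act (g \<otimes>\<^bsub>PU21\<^esub> n) p"
      using c p by (simp add: PU21_act_mult inv_act PU21_act_ball2)
    then show "PU21_act g (PU21_act n p) = PU21_act (g \<otimes>\<^bsub>PU21\<^esub> n \<otimes>\<^bsub>PU21\<^esub> inv\<^bsub>PU21\<^esub> g) (PU21_act g p)"
      using c p by (simp add: PU21_act_mult)
    have "\<psi> (g \<otimes>\<^bsub>PU21\<^esub> n \<otimes>\<^bsub>PU21\<^esub> inv\<^bsub>PU21\<^esub> g) = \<psi> g \<otimes>\<^bsub>G\<^esub> \<psi> n \<otimes>\<^bsub>G\<^esub> inv\<^bsub>G\<^esub> \<psi> g"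
      using g nL by (simp add: hom_mult hom_inv mult_closed inv_closed)
    also have "\<dots> = \<one>\<^bsub>G\<^esub>" using n g hom_closed by (simp add: N_def)
    finally show "g \<otimes>\<^bsub>PU21\<^esub> n \<otimes>\<^bsub>PU21\<^esub> inv\<^bsub>PU21\<^esub> g \<in> N"
      using g nL by (simp add: N_def mult_closed inv_closed)
  qed note * = this
  have sub: "PU21_act g ` ball_orbit N p \<subseteq> ball_orbit N (PU21_act g p)"
    using * unfolding N.ball_orbit_eq by blast
  have "\<exists>m\<in>N. PU21_act n (PU21_act g p) = PU21_act g (PU21_act m p)" if n: "n \<in> N" for n
  proof -
    let ?m = "inv\<^bsub>PU21\<^esub> g \<otimes>\<^bsub>PU21\<^esub> n \<otimes>\<^bsub>PU21\<^esub> g"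
    have nL: "n \<in> \<Lambda>" using n by (simp add: N_def)
    have c: "g \<in> carrier PU21" "n \<in> carrier PU21" using g nL \<Gamma>_closed by auto
    have "\<psi> ?m = inv\<^bsub>G\<^esub> \<psi> g \<otimes>\<^bsub>G\<^esub> \<psi> n \<otimes>\<^bsub>G\<^esub> \<psi> g"
      using g nL by (simp add: hom_mult hom_inv mult_closed inv_closed)
    also have "\<dots> = \<one>\<^bsub>G\<^esub>" using n g hom_closed by (simp add: N_def)
    finally have "?m \<in> N" using g nL by (simp add: N_def mult_closed inv_closed)
    moreover have "g \<otimes>\<^bsub>PU21\<^esub> ?m = n \<otimes>\<^bsub>PU21\<^esub> g" using c by (simp add: P.m_assoc flip: P.m_assoc[of g "inv\<^bsub>PU21\<^esub> g"])
    then have "PU21_act g (PU21_act ?m p) = PU21_act n (PU21_act g p)"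
      using c p by (metis PU21_act_mult P.m_closed P.inv_closed)
    ultimately show ?thesis by metis
  qed
  then show ?thesis using sub unfolding N.ball_orbit_eq by blast
qed

text \<open>An element of G acts through any of its preimages in \<Lambda>. The restriction is
  present because \<open>Bij\<close> consists of extensional functions.\<close>

definition deck :: "'g \<Rightarrow> (complex^2) set \<Rightarrow> (complex^2) set" where
  "deck x = restrict (\<lambda>K. PU21_act (SOME g. g \<in> \<Lambda> \<and> \<psi> g = x) ` K) (ball_orbit N ` ball2)"

text \<open>Two preimages of the same element of G differ by an element of N, which does not change
  N-orbits.\<close>

lemma deck_hom:
  assumes g: "g \<in> \<Lambda>" and p: "p \<in> ball2"
  shows "deck (\<psi> g) (ball_orbit N p) = ball_orbit N (PU21_act g p)"
proof -
  define r where "r = (SOME h. h \<in> \<Lambda> \<and> \<psi> h = \<psi> g)"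
  have r: "r \<in> \<Lambda>" "\<psi> r = \<psi> g" using someI[of "\<lambda>h. h \<in> \<Lambda> \<and> \<psi> h = \<psi> g" g] g by (auto simp: r_def)
  have c: "g \<in> carrier PU21" "r \<in> carrier PU21" using g r \<Gamma>_closed by auto
  have n: "r \<otimes>\<^bsub>PU21\<^esub> inv\<^bsub>PU21\<^esub> g \<in> N"
    using g r hom_closed by (simp add: N_def hom_mult hom_inv mult_closed inv_closed)
  have "PU21_act r p = PU21_act (r \<otimes>\<^bsub>PU21\<^esub> inv\<^bsub>PU21\<^esub> g) (PU21_act g p)"
    using c p by (simp add: PU21_act_mult inv_act PU21_act_ball2)
  then have "ball_orbit N (PU21_act r p) = ball_orbit N (PU21_act g p)"
    using N.ball_orbit_act[OF n] c p by (simp add: PU21_act_ball2)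
  then show ?thesis
    using p act_image_orbit[OF r(1) p] by (simp add: deck_def flip: r_def)
qed

lemma deck_action: "group_action G (ball_orbit N ` ball2) deck"
proof -
  let ?E = "ball_orbit N ` ball2"
  have mult: "deck (x \<otimes>\<^bsub>G\<^esub> y) K = deck x (deck y K)"
    and closed: "deck x K \<in> ?E"
    if xy: "x \<in> carrier G" "y \<in> carrier G" and K: "K \<in> ?E" for x y K
  proof -
    obtain g h p where g: "g \<in> \<Lambda>" "x = \<psi> g" and h: "h \<in> \<Lambda>" "y = \<psi> h" and p: "p \<in> ball2" "K = ball_orbit N p"
      using xy K onto by blast
    have hp: "PU21_act h p \<in> ball2" using h p PU21_act_ball2 \<Gamma>_closed by blast
    have "deck (x \<otimes>\<^bsub>G\<^esub> y) K = ball_orbit N (PU21_act (g \<otimes>\<^bsub>PU21\<^esub> h) p)"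
      using deck_hom[OF mult_closed[OF g(1) h(1)] p(1)] g h p by (simp add: hom_mult)
    also have "\<dots> = deck x (deck y K)"
      using g h p hp by (simp add: deck_hom PU21_act_mult \<Gamma>_closed)
    finally show "deck (x \<otimes>\<^bsub>G\<^esub> y) K = deck x (deck y K)" .
    have "PU21_act g p \<in> ball2" using g p PU21_act_ball2 \<Gamma>_closed by blast
    then show "deck x K \<in> ?E" using deck_hom[OF g(1) p(1)] g p by simp
  qed
  have one: "deck \<one>\<^bsub>G\<^esub> K = K" if K: "K \<in> ?E" for K
  proof -
    obtain p where p: "p \<in> ball2" "K = ball_orbit N p" using K by blast
    have "\<one>\<^bsub>PU21\<^esub> \<in> \<Lambda>" "\<psi> \<one>\<^bsub>PU21\<^esub> = \<one>\<^bsub>G\<^esub>"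
      using subgroup.one_closed[OF subgroup] L.hom_one by simp_all
    then show ?thesis using deck_hom[of "\<one>\<^bsub>PU21\<^esub>" p] p by (simp add: PU21_act_one)
  qed
  have Bij: "deck x \<in> Bij ?E" if x: "x \<in> carrier G" for x
  proof -
    have ix: "inv\<^bsub>G\<^esub> x \<in> carrier G" using x by simp
    have "bij_betw (deck x) ?E ?E"
    proof (rule bij_betw_byWitness[where f' = "deck (inv\<^bsub>G\<^esub> x)"])
      show "\<forall>K\<in>?E. deck (inv\<^bsub>G\<^esub> x) (deck x K) = K"
        using mult[OF ix x] one x by simp
      show "\<forall>K\<in>?E. deck x (deck (inv\<^bsub>G\<^esub> x) K) = K"
        using mult[OF x ix] one x by simp
      show "deck x ` ?E \<subseteq> ?E" "deck (inv\<^bsub>G\<^esub> x) ` ?E \<subseteq> ?E"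
        using closed[OF x x] closed[OF ix ix] by blast+
    qed
    then show ?thesis by (simp add: Bij_def deck_def)
  qed
  have "deck \<in> hom G (BijGroup ?E)"
  proof (rule homI)
    show "deck x \<in> carrier (BijGroup ?E)" if "x \<in> carrier G" for x
      using Bij[OF that] by (simp add: BijGroup_def)
    show "deck (x \<otimes>\<^bsub>G\<^esub> y) = deck x \<otimes>\<^bsub>BijGroup ?E\<^esub> deck y" if "x \<in> carrier G" "y \<in> carrier G" for x y
    proof -
      have "deck (x \<otimes>\<^bsub>G\<^esub> y) = compose ?E (deck x) (deck y)"
        using mult[OF that] by (intro ext) (simp add: compose_def restrict_def deck_def)
      then show ?thesis using Bij that by (simp add: BijGroup_def)
    qed
  qed
  then show ?thesis
    unfolding group_action_def
    by (intro group_hom.intro group_hom_axioms.intro group_G group_BijGroup)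
qed

theorem unramified_quotient:
  assumes f: "\<And>p. p \<in> ball2 \<Longrightarrow> f (ball_orbit N p) = ball_orbit \<Lambda> p"
  shows "unramified_quotient_map G (ball_quotient N) (ball_quotient \<Lambda>) f"
  unfolding unramified_quotient_map_def
proof (intro conjI exI[of _ deck] ballI impI)
  have hol: "holomorphic_map (ball_quotient N) (ball_quotient \<Lambda>) f"
    using f by (intro holomorphic_map_equivariant[of _ _ "\<one>\<^bsub>PU21\<^esub>"] N.ball_lattice_axioms ball_lattice_axioms)
      (auto simp: PU21_act_one)
  show "unramified_map (ball_quotient N) (ball_quotient \<Lambda>) f"
    unfolding unramified_map_def
  proof (intro conjI ballI hol)
    fix x assume "x \<in> topspace (Top (ball_quotient N))"
    then obtain p where p: "p \<in> ball2" "x = ball_orbit N p" by (auto simp: N.topspace_quotient)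
    obtain U where U: "small U" "p \<in> U" using small_neighbourhood[OF p(1)] .
    then have U': "open U" "U \<subseteq> ball2" by (auto simp: small_def)
    have "N \<subseteq> \<Lambda>" by (auto simp: N_def)
    \<comment> \<open>Smallness passes to subgroups, so one and the same U gives charts upstairs and
      downstairs.\<close>
    then have NU: "N.small U" using U(1) unfolding small_def N.small_def by blast
    have fU: "f ` ball_orbit N ` U = ball_orbit \<Lambda> ` U"
      unfolding image_image using f U'(2) by (intro image_cong) auto
    have 1: "openin (Top (ball_quotient N)) (ball_orbit N ` U)"
      and 2: "openin (Top (ball_quotient \<Lambda>)) (ball_orbit \<Lambda> ` U)"
      using N.openin_image_orbit openin_image_orbit U' by blast+
    \<comment> \<open>The local inverse goes down to U by the chart of the quotient by \<Lambda> and
      back up by the projection modulo N.\<close>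
    let ?g = "ball_orbit N \<circ> inv_into U (ball_orbit \<Lambda>)"
    have g: "?g (ball_orbit \<Lambda> u) = ball_orbit N u" if "u \<in> U" for u
      using that inj_on_small[OF U(1)] by simp
    have "biholomorphic_map (open_subspace (ball_quotient N) (ball_orbit N ` U))
        (open_subspace (ball_quotient \<Lambda>) (f ` ball_orbit N ` U)) f"
      unfolding biholomorphic_map_def fU
    proof (intro conjI exI[of _ ?g])
      show "holomorphic_map (open_subspace (ball_quotient N) (ball_orbit N ` U))
          (open_subspace (ball_quotient \<Lambda>) (ball_orbit \<Lambda> ` U)) f"
        using fU by (intro holomorphic_map_restrict N.function_sheaf_quotient hol 1 2) simp
      show "holomorphic_map (open_subspace (ball_quotient \<Lambda>) (ball_orbit \<Lambda> ` U))
          (open_subspace (ball_quotient N) (ball_orbit N ` U)) ?g"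
        using holomorphic_map_chart[OF U(1)] N.holomorphic_map_orbit[OF NU]
        by (rule holomorphic_map_compose)
      show "\<forall>x\<in>topspace (Top (open_subspace (ball_quotient N) (ball_orbit N ` U))). ?g (f x) = x"
      proof
        fix x assume "x \<in> topspace (Top (open_subspace (ball_quotient N) (ball_orbit N ` U)))"
        then obtain u where u: "u \<in> U" "x = ball_orbit N u" by (auto simp: open_subspace_def)
        then show "?g (f x) = x" using f[of u] U'(2) g[of u] by auto
      qed
      show "\<forall>y\<in>topspace (Top (open_subspace (ball_quotient \<Lambda>) (ball_orbit \<Lambda> ` U))). f (?g y) = y"
      proof
        fix y assume "y \<in> topspace (Top (open_subspace (ball_quotient \<Lambda>) (ball_orbit \<Lambda> ` U)))"
        then obtain u where u: "u \<in> U" "y = ball_orbit \<Lambda> u" by (auto simp: open_subspace_def)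
        then show "f (?g y) = y" using f[of u] U'(2) g[of u] by (simp add: subset_iff)
      qed
    qed
    then show "\<exists>U. openin (Top (ball_quotient N)) U \<and> x \<in> U \<and> openin (Top (ball_quotient \<Lambda>)) (f ` U) \<and>
        biholomorphic_map (open_subspace (ball_quotient N) U) (open_subspace (ball_quotient \<Lambda>) (f ` U)) f"
      using 1 2 fU p U(2) by (intro exI[of _ "ball_orbit N ` U"]) simp
  qed
  have "f ` ball_orbit N ` ball2 = ball_orbit \<Lambda> ` ball2"
    unfolding image_image by (rule image_cong) (auto simp: f)
  then show "f ` topspace (Top (ball_quotient N)) = topspace (Top (ball_quotient \<Lambda>))"
    by (simp add: topspace_quotient N.topspace_quotient)
  show "group_action G (topspace (Top (ball_quotient N))) deck"
    using deck_action by (simp add: N.topspace_quotient)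
next
  fix x assume x: "x \<in> carrier G"
  have hol: "holomorphic_map (ball_quotient N) (ball_quotient N) (deck y)" if y: "y \<in> carrier G" for y
  proof -
    obtain g where "g \<in> \<Lambda>" "y = \<psi> g" using y onto by blast
    then show ?thesis
      using deck_hom by (intro holomorphic_map_equivariant[of _ _ g] N.ball_lattice_axioms) (auto simp: \<Gamma>_closed)
  qed
  interpret D: group_action G "ball_orbit N ` ball2" deck by (rule deck_action)
  have ix: "inv\<^bsub>G\<^esub> x \<in> carrier G" using x by simp
  have 1: "deck (inv\<^bsub>G\<^esub> x) (deck x K) = K" if "K \<in> ball_orbit N ` ball2" for K
    using D.orbit_sym_aux[OF x that HOL.refl] .
  have 2: "deck x (deck (inv\<^bsub>G\<^esub> x) K) = K" if "K \<in> ball_orbit N ` ball2" for K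
    using D.orbit_sym_aux[OF ix that HOL.refl] x by (simp only: L.H.inv_inv)
  show "biholomorphic_map (ball_quotient N) (ball_quotient N) (deck x)"
    unfolding biholomorphic_map_def N.topspace_quotient
    by (intro conjI exI[of _ "deck (inv\<^bsub>G\<^esub> x)"] ballI hol x ix 1 2)
next
  fix x y assume x: "x \<in> carrier G" and y: "y \<in> topspace (Top (ball_quotient N))" and fixed: "deck x y = y"
  obtain g where g: "g \<in> \<Lambda>" "x = \<psi> g" using x onto by blast
  obtain p where p: "p \<in> ball2" "y = ball_orbit N p" using y by (auto simp: N.topspace_quotient)
  \<comment> \<open>A fixed N-orbit only says that g moves p as some n in N does. Then n inverse
    times g fixes p, and freeness of all of \<Lambda> yields g = n.\<close>
  have "ball_orbit N p = ball_orbit N (PU21_act g p)" using deck_hom[OF g(1) p(1)] g p fixed by simp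
  then obtain n where n: "n \<in> N" "PU21_act g p = PU21_act n p" using N.ball_orbit_eq_iff[OF p(1)] by blast
  have nL: "n \<in> \<Lambda>" using n by (simp add: N_def)
  have c: "g \<in> carrier PU21" "n \<in> carrier PU21" using g nL \<Gamma>_closed by auto
  have "PU21_act (inv\<^bsub>PU21\<^esub> n \<otimes>\<^bsub>PU21\<^esub> g) p = p"
    using c p n by (simp add: PU21_act_mult inv_act)
  then have "inv\<^bsub>PU21\<^esub> n \<otimes>\<^bsub>PU21\<^esub> g = \<one>\<^bsub>PU21\<^esub>"
    using free p mult_closed[OF inv_closed[OF nL] g(1)] by (auto simp: acts_freely_on_ball_def)
  then have "g = n" using c P.inv_solve_left[of "\<one>\<^bsub>PU21\<^esub>" n g] by simp
  then show "x = \<one>\<^bsub>G\<^esub>" using n g by (simp add: N_def)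
next
  fix x y assume x: "x \<in> topspace (Top (ball_quotient N))" and y: "y \<in> topspace (Top (ball_quotient N))"
  obtain p where p: "p \<in> ball2" "x = ball_orbit N p" using x by (auto simp: N.topspace_quotient)
  obtain p' where p': "p' \<in> ball2" "y = ball_orbit N p'" using y by (auto simp: N.topspace_quotient)
  have "f x = f y \<longleftrightarrow> (\<exists>g\<in>\<Lambda>. p' = PU21_act g p)"
    using f p p' ball_orbit_eq_iff[OF p(1)] by simp
  \<comment> \<open>Deck orbits consist of N-orbits, so p' need only agree with a translate of p up
    to N; the discrepancy is absorbed into g.\<close>
  also have "\<dots> \<longleftrightarrow> (\<exists>g\<in>\<Lambda>. y = ball_orbit N (PU21_act g p))"
  proof
    assume "\<exists>g\<in>\<Lambda>. y = ball_orbit N (PU21_act g p)"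
    then obtain g where g: "g \<in> \<Lambda>" "ball_orbit N (PU21_act g p) = ball_orbit N p'" using p' by auto
    have gp: "PU21_act g p \<in> ball2" using g p \<Gamma>_closed PU21_act_ball2 by blast
    obtain n where n: "n \<in> N" "p' = PU21_act n (PU21_act g p)"
      using g N.ball_orbit_eq_iff[OF gp] by blast
    have nL: "n \<in> \<Lambda>" using n by (simp add: N_def)
    have "p' = PU21_act (n \<otimes>\<^bsub>PU21\<^esub> g) p" using n g nL p by (simp add: PU21_act_mult \<Gamma>_closed)
    then show "\<exists>g\<in>\<Lambda>. p' = PU21_act g p" using mult_closed[OF nL g(1)] by blast
  qed (use p' in blast)
  also have "\<dots> \<longleftrightarrow> (\<exists>g\<in>\<Lambda>. y = deck (\<psi> g) x)" using p deck_hom by simp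
  also have "\<dots> \<longleftrightarrow> y \<in> orbit G deck x" unfolding orbit_def onto[symmetric] by blast
  finally show "f x = f y \<longleftrightarrow> y \<in> orbit G deck x" .
qed

end

text \<open>Uses an arbitrary point of K; the value is independent of it when K is the orbit of a
  ball point under a subgroup of \<Lambda>.\<close>

definition induced_map :: "(complex^3^3) set set \<Rightarrow> (complex^2) set \<Rightarrow> (complex^2) set" where
  "induced_map \<Lambda> K = ball_orbit \<Lambda> (SOME p. p \<in> K)"

lemma (in ball_lattice) induced_map_orbit:
  assumes N: "subgroup N PU21" "N \<subseteq> \<Gamma>" and p: "p \<in> ball2"
  shows "induced_map \<Gamma> (ball_orbit N p) = ball_orbit \<Gamma> p"
proof -
  have "p \<in> ball_orbit N p"
    using subgroup.one_closed[OF N(1)] PU21_act_one[of p] by (force simp: ball_orbit_def orbit_def)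
  then have "(SOME q. q \<in> ball_orbit N p) \<in> ball_orbit N p" by (rule someI)
  then obtain n where "n \<in> N" "(SOME q. q \<in> ball_orbit N p) = PU21_act n p"
    by (auto simp: ball_orbit_def orbit_def)
  then show ?thesis using N(2) p by (auto simp: induced_map_def ball_orbit_act)
qed

section \<open>Labelled graphs of a presented group\<close>

text \<open>A path is traversed letter by letter; an edge \<open>(l, i, s)\<close> of its trail is the \<open>l\<close>-edge
  leaving vertex \<open>i\<close>, traversed backwards if \<open>s\<close> is false.\<close>

fun letters :: "word \<Rightarrow> (letter \<times> bool) list" where
  "letters [] = []"
| "letters ((l, k) # w) = replicate (nat \<bar>k\<bar>) (l, 0 \<le> k) @ letters w"

fun dest :: "(letter \<Rightarrow> bool \<Rightarrow> nat \<Rightarrow> nat) \<Rightarrow> (letter \<times> bool) list \<Rightarrow> nat \<Rightarrow> nat" where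
  "dest adj [] i = i"
| "dest adj ((l, s) # w) i = dest adj w (adj l s i)"

fun trail :: "(letter \<Rightarrow> bool \<Rightarrow> nat \<Rightarrow> nat) \<Rightarrow> (letter \<times> bool) list \<Rightarrow> nat
    \<Rightarrow> (letter \<times> nat \<times> bool) list" where
  "trail adj [] i = []"
| "trail adj ((l, s) # w) i = (l, if s then i else adj l s i, s) # trail adj w (adj l s i)"

fun label :: "('a, 'm) monoid_scheme \<Rightarrow> (letter \<Rightarrow> nat \<Rightarrow> 'a) \<Rightarrow> (letter \<times> nat \<times> bool) list \<Rightarrow> 'a" where
  "label G c [] = \<one>\<^bsub>G\<^esub>"
| "label G c ((l, i, s) # es) = (if s then c l i else inv\<^bsub>G\<^esub> (c l i)) \<otimes>\<^bsub>G\<^esub> label G c es"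

lemma letters_append: "letters (u @ v) = letters u @ letters v"
  by (induction u rule: letters.induct) auto

lemma dest_append: "dest adj (u @ v) i = dest adj v (dest adj u i)"
  by (induction adj u i rule: dest.induct) auto

text \<open>Each letter acts as a permutation of the n vertices, with inverse in the backward
  direction. The label group is arbitrary, so the cyclic, the dihedral and the abelianised
  labellings are all instances.\<close>

locale labelled_graph = group G for G (structure) +
  fixes n :: nat and adj :: "letter \<Rightarrow> bool \<Rightarrow> nat \<Rightarrow> nat" and c :: "letter \<Rightarrow> nat \<Rightarrow> 'a"
  assumes adj_less: "i < n \<Longrightarrow> adj l s i < n"
    and adj_adj: "i < n \<Longrightarrow> adj l (\<not> s) (adj l s i) = i"
    and c_closed: "i < n \<Longrightarrow> c l i \<in> carrier G"
begin

lemma dest_less: "i < n \<Longrightarrow> dest adj w i < n"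
  by (induction w arbitrary: i) (auto simp: adj_less)

lemma label_trail_closed: "i < n \<Longrightarrow> label G c (trail adj w i) \<in> carrier G"
  by (induction w arbitrary: i) (auto simp: adj_less c_closed)

lemma trail_vertex_less: "i < n \<Longrightarrow> (l, j, s) \<in> set (trail adj w i) \<Longrightarrow> j < n"
proof (induction w arbitrary: i)
  case (Cons x w)
  then show ?case
    using Cons.IH[OF adj_less[OF Cons.prems(1)]] adj_less[OF Cons.prems(1)]
    by (cases x) (auto split: if_splits)
qed simp

text \<open>Agreement is required from every starting vertex, not only from the base vertex; this
  makes the relation a congruence for concatenation.\<close>

definition path_equiv :: "(letter \<times> bool) list \<Rightarrow> (letter \<times> bool) list \<Rightarrow> bool" (infix "\<bowtie>" 50) where
  "u \<bowtie> v \<longleftrightarrow> (\<forall>i. i < n \<longrightarrow> dest adj u i = dest adj v i \<and>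
     label G c (trail adj u i) = label G c (trail adj v i))"

lemma label_trail_append:
  "i < n \<Longrightarrow> label G c (trail adj (u @ v) i)
    = label G c (trail adj u i) \<otimes> label G c (trail adj v (dest adj u i))"
proof (induction u arbitrary: i)
  case Nil
  then show ?case by (simp add: label_trail_closed)
next
  case (Cons x u)
  then show ?case
    by (cases x) (auto simp: adj_less c_closed m_assoc label_trail_closed dest_less)
qed

lemma path_equiv_trans [trans]: "u \<bowtie> v \<Longrightarrow> v \<bowtie> w \<Longrightarrow> u \<bowtie> w"
  by (simp add: path_equiv_def)

lemma path_equiv_append: "u \<bowtie> u' \<Longrightarrow> v \<bowtie> v' \<Longrightarrow> u @ v \<bowtie> u' @ v'"
  by (simp add: path_equiv_def dest_append label_trail_append dest_less)

lemma path_equiv_cancel: "[(l, s), (l, \<not> s)] \<bowtie> []"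
  using adj_less[of _ l s] adj_adj[of _ l s] c_closed[of _ l]
  by (auto simp: path_equiv_def)

text \<open>The new letter lengthens the run, or cancels against its last letter when the sign of j
  is opposite.\<close>

lemma path_equiv_power_step:
  "letters [(l, j)] @ [(l, True)] \<bowtie> letters [(l, j + 1)]"
  "letters [(l, j)] @ [(l, False)] \<bowtie> letters [(l, j - 1)]"
proof -
  have cancel: "u @ [(l, s), (l, \<not> s)] \<bowtie> u" for u s
    using path_equiv_append[OF _ path_equiv_cancel, of u u l s] by (simp add: path_equiv_def)
  have pos: "letters [(l, k + 1)] = letters [(l, k)] @ [(l, True)]" if "k \<ge> 0" for k
    using that by (simp add: nat_add_distrib replicate_append_same)
  have neg: "letters [(l, k - 1)] = letters [(l, k)] @ [(l, False)]" if "k \<le> 0" for k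
  proof -
    have "nat \<bar>k - 1\<bar> = Suc (nat \<bar>k\<bar>)" using that by simp
    then show ?thesis using that
      by (cases "k = 0") (simp, simp add: replicate_append_same flip: replicate_Suc)
  qed
  have refl: "u \<bowtie> u" for u by (simp add: path_equiv_def)
  show "letters [(l, j)] @ [(l, True)] \<bowtie> letters [(l, j + 1)]"
  proof (cases "j \<ge> 0")
    case True
    then show ?thesis using pos[of j] refl by metis
  next
    case False
    then show ?thesis using neg[of "j + 1"] cancel[of "letters [(l, j + 1)]" False] by simp
  qed
  show "letters [(l, j)] @ [(l, False)] \<bowtie> letters [(l, j - 1)]"
  proof (cases "j \<le> 0")
    case True
    then show ?thesis using neg[of j] refl by metis
  next
    case False
    then show ?thesis using pos[of "j - 1"] cancel[of "letters [(l, j - 1)]" True] by simp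
  qed
qed

lemma path_equiv_merge: "letters [(l, j)] @ letters [(l, k)] \<bowtie> letters [(l, j + k)]"
proof (induction k rule: int_induct[where k = 0])
  case base
  show ?case by (simp add: path_equiv_def)
next
  case (step1 k)
  have "letters [(l, k + 1)] = letters [(l, k)] @ [(l, True)]"
    using step1(1) by (simp add: nat_add_distrib replicate_append_same)
  then have "letters [(l, j)] @ letters [(l, k + 1)]
      = (letters [(l, j)] @ letters [(l, k)]) @ [(l, True)]" by simp
  also have "\<dots> \<bowtie> letters [(l, j + k)] @ [(l, True)]"
    using step1(2) by (intro path_equiv_append) (auto simp: path_equiv_def)
  also have "\<dots> \<bowtie> letters [(l, j + k + 1)]" by (rule path_equiv_power_step)
  finally show ?case by (simp only: add.assoc)
next
  case (step2 k)
  have "nat \<bar>k - 1\<bar> = Suc (nat \<bar>k\<bar>)" using step2(1) by simp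
  then have "letters [(l, k - 1)] = letters [(l, k)] @ [(l, False)]"
    using step2(1) by (cases "k = 0") (simp, simp add: replicate_append_same flip: replicate_Suc)
  then have "letters [(l, j)] @ letters [(l, k - 1)]
      = (letters [(l, j)] @ letters [(l, k)]) @ [(l, False)]" by simp
  also have "\<dots> \<bowtie> letters [(l, j + k)] @ [(l, False)]"
    using step2(2) by (intro path_equiv_append) (auto simp: path_equiv_def)
  also have "\<dots> \<bowtie> letters [(l, j + k - 1)]" by (rule path_equiv_power_step)
  finally show ?case by (simp only: add_diff_eq)
qed

text \<open>The argument of von Dyck: once relators act trivially, every consequence of them
  does.\<close>

lemma pres_eq_path_equiv:
  assumes "pres_eq R u v" and "\<And>r. r \<in> R \<Longrightarrow> letters r \<bowtie> []"
  shows "letters u \<bowtie> letters v"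
  using assms(1)
proof induction
  case (merge x j k)
  show ?case using path_equiv_merge[of x j k] by simp
next
  case (append u u' v v')
  then show ?case by (simp add: letters_append path_equiv_append)
next
  case (relator r)
  then show ?case using assms(2) by simp
qed (simp_all add: path_equiv_def)

end

section \<open>Words representing the elements of a presented group\<close>

fun word_inv :: "word \<Rightarrow> word" where
  "word_inv [] = []"
| "word_inv ((l, k) # w) = word_inv w @ [(l, - k)]"

lemma pres_eq_word_inv_append: "pres_eq R (word_inv w @ w) []"
proof (induction w rule: word_inv.induct)
  case 1
  show ?case by (simp add: pres_eq.refl)
next
  case (2 l k w)
  have "pres_eq R [(l, - k), (l, k)] []"
    by (rule pres_eq.trans[OF pres_eq.merge]) (simp add: pres_eq.null)
  then have "pres_eq R ([(l, - k), (l, k)] @ w) ([] @ w)"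
    by (rule pres_eq.append[OF _ pres_eq.refl])
  then have "pres_eq R (word_inv w @ [(l, - k), (l, k)] @ w) (word_inv w @ [] @ w)"
    by (rule pres_eq.append[OF pres_eq.refl])
  with 2 show ?case by (simp add: pres_eq.trans[of R _ "word_inv w @ w"])
qed

locale group_presentation =
  fixes G (structure) and z b and R
  assumes presented: "presented_by G z b R"
begin

sublocale group G using presented by (simp add: presented_by_def)

lemma gen_closed: "z \<in> carrier G" "b \<in> carrier G"
  using presented by (simp_all add: presented_by_def)

lemma word_val_closed [simp]: "word_val G z b w \<in> carrier G"
  by (induction w rule: letters.induct) (auto simp: gen_closed split: letter.split)

lemma word_val_append: "word_val G z b (u @ v) = word_val G z b u \<otimes> word_val G z b v"
  by (induction u rule: letters.induct) (auto simp: gen_closed m_assoc split: letter.split)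

lemma word_val_word_inv: "word_val G z b (word_inv w) = inv (word_val G z b w)"
proof (rule inv_equality[symmetric])
  show "word_val G z b (word_inv w) \<otimes> word_val G z b w = \<one>"
    using pres_eq_word_inv_append[of R w] presented
    by (simp add: presented_by_def flip: word_val_append)
qed auto

text \<open>\<open>presented_by\<close> speaks only of words with trivial value, so the equation is
  first turned into triviality of u times the inverse word of v.\<close>

lemma word_val_eq_imp_pres_eq:
  assumes "word_val G z b u = word_val G z b v"
  shows "pres_eq R u v"
proof -
  have "word_val G z b (u @ word_inv v) = \<one>"
    by (simp add: word_val_append word_val_word_inv assms)
  then have "pres_eq R (u @ word_inv v) []" using presented by (simp add: presented_by_def)
  then have "pres_eq R ((u @ word_inv v) @ v) ([] @ v)" by (rule pres_eq.append) (rule pres_eq.refl)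
  moreover have "pres_eq R (u @ (word_inv v @ v)) (u @ [])"
    by (rule pres_eq.append) (rule pres_eq.refl pres_eq_word_inv_append)+
  ultimately show ?thesis by (auto intro: pres_eq.trans pres_eq.sym)
qed

lemma range_word_val: "range (word_val G z b) = carrier G"
proof
  show "carrier G \<subseteq> range (word_val G z b)"
  proof
    fix g assume "g \<in> carrier G"
    then have "g \<in> generate G {z, b}" using presented by (simp add: presented_by_def)
    then show "g \<in> range (word_val G z b)"
    proof (induction rule: generate.induct)
      case one
      have "word_val G z b [] = \<one>" by simp
      then show ?case by (metis rangeI)
    next
      case (incl h)
      have "word_val G z b [(Zg, 1)] = z" "word_val G z b [(Bg, 1)] = b"
        using gen_closed by simp_all
      then show ?case using incl by (metis insertE rangeI singletonD)
    next
      case (inv h)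
      have "word_val G z b [(Zg, - 1)] = inv z" "word_val G z b [(Bg, - 1)] = inv b"
        using gen_closed by (simp_all add: int_pow_neg)
      then show ?case using inv by (metis insertE rangeI singletonD)
    next
      case (eng h1 h2)
      then obtain u v where "h1 = word_val G z b u" "h2 = word_val G z b v" by blast
      then show ?case using word_val_append[of u v] by (metis rangeI)
    qed
  qed
qed auto

definition word_of :: "'a \<Rightarrow> word" where
  "word_of g = (SOME w. word_val G z b w = g)"

lemma word_val_word_of: "g \<in> carrier G \<Longrightarrow> word_val G z b (word_of g) = g"
proof -
  assume "g \<in> carrier G"
  then have "g \<in> range (word_val G z b)" using range_word_val by simp
  then obtain w where "word_val G z b w = g" by (metis imageE)
  then show ?thesis unfolding word_of_def by (rule someI)
qed

end

section \<open>The action of a presented group on a labelled graph\<close>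

locale presented_graph = P: group_presentation G z b R + labelled_graph H n adj c
  for G :: "('g, 'm) monoid_scheme" and z b R
    and H :: "('h, 'k) monoid_scheme" and n adj c +
  assumes relator_loop: "r \<in> R \<Longrightarrow> path_equiv (letters r) []"
begin

definition end_pt :: "'g \<Rightarrow> nat \<Rightarrow> nat" where
  "end_pt g i = dest adj (letters (P.word_of g)) i"

definition lab :: "'g \<Rightarrow> nat \<Rightarrow> 'h" where
  "lab g i = label H c (trail adj (letters (P.word_of g)) i)"

text \<open>\<open>end_pt\<close> and \<open>lab\<close> are defined through an arbitrary word for
  g. Here the choice becomes immaterial, since two words for one element are linked by
  relators.\<close>

lemma word_of_path_equiv: "path_equiv (letters (P.word_of (word_val G z b w))) (letters w)"
  by (intro pres_eq_path_equiv[OF P.word_val_eq_imp_pres_eq relator_loop] P.word_val_word_of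
      P.word_val_closed)

lemma end_pt_word_val: "i < n \<Longrightarrow> end_pt (word_val G z b w) i = dest adj (letters w) i"
  and lab_word_val: "i < n \<Longrightarrow> lab (word_val G z b w) i = label H c (trail adj (letters w) i)"
  using word_of_path_equiv[of w] by (simp_all add: path_equiv_def end_pt_def lab_def)

lemma end_pt_less: "i < n \<Longrightarrow> end_pt g i < n"
  by (simp add: end_pt_def dest_less)

lemma lab_closed: "i < n \<Longrightarrow> lab g i \<in> carrier H"
  by (simp add: lab_def label_trail_closed)

text \<open>Paths are read from left to right, so the group acts on vertices from the right and the
  labels form a cocycle. On the stabiliser of the base vertex the cocycle is a homomorphism.\<close>

lemma
  assumes "g \<in> carrier G" "h \<in> carrier G" "i < n"
  shows end_pt_mult: "end_pt (g \<otimes>\<^bsub>G\<^esub> h) i = end_pt h (end_pt g i)"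
    and lab_mult: "lab (g \<otimes>\<^bsub>G\<^esub> h) i = lab g i \<otimes>\<^bsub>H\<^esub> lab h (end_pt g i)"
proof -
  have *: "g \<otimes>\<^bsub>G\<^esub> h = word_val G z b (P.word_of g @ P.word_of h)"
    using assms by (simp add: P.word_val_append P.word_val_word_of)
  show "end_pt (g \<otimes>\<^bsub>G\<^esub> h) i = end_pt h (end_pt g i)"
    using assms(3) unfolding * end_pt_word_val[OF assms(3)]
    by (simp add: letters_append dest_append end_pt_def)
  show "lab (g \<otimes>\<^bsub>G\<^esub> h) i = lab g i \<otimes>\<^bsub>H\<^esub> lab h (end_pt g i)"
    using assms(3) unfolding * lab_word_val[OF assms(3)]
    by (simp add: letters_append label_trail_append end_pt_def lab_def)
qed

lemma end_pt_one: "i < n \<Longrightarrow> end_pt \<one>\<^bsub>G\<^esub> i = i"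
  using end_pt_word_val[of i "[]"] by simp

definition stab :: "'g set" where
  "stab = {g \<in> carrier G. end_pt g 0 = 0}"

lemma subgroup_stab:
  assumes "0 < n" shows "subgroup stab G"
proof (rule P.subgroupI)
  fix g assume "g \<in> stab"
  then have g: "g \<in> carrier G" "end_pt g 0 = 0" by (auto simp: stab_def)
  then have "end_pt (inv\<^bsub>G\<^esub> g) 0 = end_pt (g \<otimes>\<^bsub>G\<^esub> inv\<^bsub>G\<^esub> g) 0"
    using assms by (simp only: end_pt_mult P.inv_closed)
  then show "inv\<^bsub>G\<^esub> g \<in> stab" using g assms by (simp add: stab_def end_pt_one)
qed (use assms end_pt_one[of 0] in \<open>auto simp: stab_def end_pt_mult\<close>)

lemma lab_hom: "0 < n \<Longrightarrow> (\<lambda>g. lab g 0) \<in> hom (G\<lparr>carrier := stab\<rparr>) H"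
  by (auto simp: hom_def stab_def lab_closed lab_mult)

text \<open>An element of a coset of X has the same end point as its representative. Transitivity
  gives n end points, which exhaust the n cosets, so only the coset X itself can end at 0.\<close>

lemma eq_stab_if_index:
  assumes X: "subgroup X G" and "X \<subseteq> stab" and "card (rcosets\<^bsub>G\<^esub> X) = n" and "0 < n"
    and trans: "\<And>i. i < n \<Longrightarrow> \<exists>g\<in>carrier G. end_pt g 0 = i"
  shows "X = stab"
proof (rule subset_antisym)
  obtain t where t: "\<And>i. i < n \<Longrightarrow> t i \<in> carrier G \<and> end_pt (t i) 0 = i"
    using trans by metis
  have XG: "X \<subseteq> carrier G" using X by (rule subgroup.subset)
  have end_coset: "end_pt h 0 = end_pt g 0" if "g \<in> carrier G" "h \<in> X #>\<^bsub>G\<^esub> g" for g h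
    using that \<open>X \<subseteq> stab\<close> XG \<open>0 < n\<close> by (auto simp: r_coset_def stab_def end_pt_mult)
  have self: "g \<in> X #>\<^bsub>G\<^esub> g" if "g \<in> carrier G" for g
    using P.rcos_self[OF that X] .
  let ?f = "\<lambda>i. X #>\<^bsub>G\<^esub> t i"
  have inj: "inj_on ?f {..<n}"
    using end_coset self t by (intro inj_onI) (metis lessThan_iff)
  have sub: "?f ` {..<n} \<subseteq> rcosets\<^bsub>G\<^esub> X"
    using t by (auto simp: RCOSETS_def)
  have "finite (rcosets\<^bsub>G\<^esub> X)" using assms(3,4) by (metis card.infinite not_less_zero)
  then have eq: "?f ` {..<n} = rcosets\<^bsub>G\<^esub> X"
    using sub inj assms(3) by (intro card_subset_eq) (auto simp: card_image)
  have coset0: "X #>\<^bsub>G\<^esub> g = ?f 0" if "g \<in> stab" for g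
  proof -
    have g: "g \<in> carrier G" "end_pt g 0 = 0" using that by (auto simp: stab_def)
    then have "X #>\<^bsub>G\<^esub> g \<in> ?f ` {..<n}" by (auto simp: eq RCOSETS_def)
    then obtain i where i: "i < n" "X #>\<^bsub>G\<^esub> g = ?f i" by auto
    then have "end_pt g 0 = i" using end_coset[of "t i" g] self[of g] t g by auto
    then show ?thesis using i g by simp
  qed
  show "stab \<subseteq> X"
  proof
    fix g assume g: "g \<in> stab"
    have "X #>\<^bsub>G\<^esub> g = X #>\<^bsub>G\<^esub> \<one>\<^bsub>G\<^esub>"
      using coset0[OF g] coset0[of "\<one>\<^bsub>G\<^esub>"] subgroup.one_closed[OF subgroup_stab[OF \<open>0 < n\<close>]]
      by simp
    then show "g \<in> X" using self[of g] g XG by (simp add: stab_def)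
  qed
qed fact

end

section \<open>Integer 1-chains of a labelled graph with abelian labels\<close>

fun edge_count :: "(letter \<times> nat \<times> bool) list \<Rightarrow> letter \<Rightarrow> nat \<Rightarrow> int" where
  "edge_count [] l i = 0"
| "edge_count ((l', i', s) # es) l i =
     (if l' = l \<and> i' = i then (if s then 1 else - 1) else 0) + edge_count es l i"

fun weighted_count :: "(int \<times> (letter \<times> nat \<times> bool) list) list \<Rightarrow> letter \<Rightarrow> nat \<Rightarrow> int" where
  "weighted_count [] l i = 0"
| "weighted_count ((k, es) # L) l i = k * edge_count es l i + weighted_count L l i"

fun weighted_label :: "('a, 'm) monoid_scheme \<Rightarrow> (letter \<Rightarrow> nat \<Rightarrow> 'a)
    \<Rightarrow> (int \<times> (letter \<times> nat \<times> bool) list) list \<Rightarrow> 'a" where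
  "weighted_label G c [] = \<one>\<^bsub>G\<^esub>"
| "weighted_label G c ((k, es) # L) = label G c es [^]\<^bsub>G\<^esub> k \<otimes>\<^bsub>G\<^esub> weighted_label G c L"

instance letter :: finite
proof
  have "finite {Zg, Bg}" by simp
  moreover have "{Zg, Bg} = UNIV" by (auto intro: letter.exhaust)
  ultimately show "finite (UNIV :: letter set)" by metis
qed

locale comm_labelled_graph = labelled_graph + comm_group
begin

definition edges :: "(letter \<times> nat) set" where
  "edges = UNIV \<times> {..<n}"

text \<open>The homomorphism from integer 1-chains to the abelian group that sends each edge to its
  label.\<close>

definition chain :: "(letter \<Rightarrow> nat \<Rightarrow> int) \<Rightarrow> 'a" where
  "chain v = finprod G (\<lambda>(l, i). c l i [^] v l i) edges"

lemma chain_add: "chain (\<lambda>l i. u l i + v l i) = chain u \<otimes> chain v"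
proof -
  have "chain (\<lambda>l i. u l i + v l i)
      = finprod G (\<lambda>e. (case e of (l, i) \<Rightarrow> c l i [^] u l i) \<otimes> (case e of (l, i) \<Rightarrow> c l i [^] v l i)) edges"
    unfolding chain_def
    by (rule finprod_cong) (auto simp: edges_def c_closed int_pow_mult simp_implies_def Pi_def)
  also have "\<dots> = chain u \<otimes> chain v"
    unfolding chain_def by (rule finprod_multf) (auto simp: edges_def c_closed)
  finally show ?thesis .
qed

lemma chain_zero: "(\<And>l i. i < n \<Longrightarrow> v l i = 0) \<Longrightarrow> chain v = \<one>"
  unfolding chain_def by (rule finprod_one_eqI) (auto simp: edges_def)

lemma chain_closed: "chain v \<in> carrier G"
  unfolding chain_def by (rule finprod_closed) (auto simp: edges_def c_closed)

lemma chain_scale: "chain (\<lambda>l i. k * v l i) = chain v [^] (k::int)"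
proof (induction k rule: int_induct[where k = 0])
  case base
  show ?case by (simp add: chain_zero)
next
  case (step1 k)
  then show ?case using chain_add[of "\<lambda>l i. k * v l i" v]
    by (simp add: distrib_right int_pow_mult chain_closed)
next
  case (step2 k)
  have "chain (\<lambda>l i. k * v l i) = chain (\<lambda>l i. (k - 1) * v l i) \<otimes> chain v"
    using chain_add[of "\<lambda>l i. (k - 1) * v l i" v] by (simp add: left_diff_distrib)
  moreover have "chain v [^] k = chain v [^] (k - 1) \<otimes> chain v"
    using int_pow_mult[OF chain_closed, of v "k - 1" 1] by (simp add: chain_closed)
  ultimately show ?case using step2 by (simp add: chain_closed)
qed

lemma chain_single:
  assumes "i < n"
  shows "chain (\<lambda>l' i'. if l = l' \<and> i = i' then k else 0) = c l i [^] k"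
proof -
  have "chain (\<lambda>l' i'. if l = l' \<and> i = i' then k else 0)
      = finprod G (\<lambda>e. if (l, i) = e then (case e of (l, i) \<Rightarrow> c l i [^] k) else \<one>) edges"
    unfolding chain_def
    by (rule finprod_cong) (auto simp: edges_def c_closed simp_implies_def split: if_splits)
  also have "\<dots> = c l i [^] k"
    using assms by (subst finprod_singleton) (auto simp: edges_def c_closed)
  finally show ?thesis .
qed

lemma label_eq_chain:
  "(\<And>l i s. (l, i, s) \<in> set es \<Longrightarrow> i < n) \<Longrightarrow> label G c es = chain (edge_count es)"
proof (induction es)
  case Nil
  then show ?case by (simp add: chain_zero)
next
  case (Cons e es)
  obtain l i s where e: "e = (l, i, s)" by (cases e)
  have i: "i < n" using Cons.prems[of l i s] by (simp add: e)
  have IH: "label G c es = chain (edge_count es)"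
    using Cons.prems by (intro Cons.IH) auto
  have "edge_count (e # es)
      = (\<lambda>l' i'. (if l = l' \<and> i = i' then (if s then 1 else - 1) else 0) + edge_count es l' i')"
    by (intro ext) (simp add: e)
  then show ?case
    using i by (simp add: e chain_add chain_single IH c_closed int_pow_neg)
qed

text \<open>In an abelian group the label of a path depends only on its chain. A combination of
  paths with zero chain is therefore trivial whatever the labels are.\<close>

lemma weighted_label_eq_one:
  assumes "\<And>k es l i s. (k, es) \<in> set L \<Longrightarrow> (l, i, s) \<in> set es \<Longrightarrow> i < n"
    and "\<And>l i. i < n \<Longrightarrow> weighted_count L l i = 0"
  shows "weighted_label G c L = \<one>"
proof -
  have "weighted_label G c L = chain (weighted_count L)"
    using assms(1)
  proof (induction L)
    case Nil
    then show ?case by (simp add: chain_zero)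
  next
    case (Cons x L)
    obtain k es where x: "x = (k, es)" by (cases x)
    have "weighted_count (x # L) = (\<lambda>l i. k * edge_count es l i + weighted_count L l i)"
      by (intro ext) (simp add: x)
    moreover have "label G c es = chain (edge_count es)"
      using Cons.prems[of k es] by (intro label_eq_chain) (auto simp: x)
    moreover have "weighted_label G c L = chain (weighted_count L)"
      by (rule Cons.IH) (metis Cons.prems list.set_intros(2))
    ultimately show ?case by (simp add: x chain_add chain_scale)
  qed
  then show ?thesis using chain_zero[OF assms(2)] by simp
qed

end

section \<open>The coset graphs of the two lattices\<close>

text \<open>Coset tables of \<open>\<Gamma>\<^sub>X\<close> and \<open>\<Gamma>\<^sub>Y\<close> found by coset enumeration, vertex \<open>0\<close> being the
  subgroup itself. The label of an edge is the image of its Schreier generator in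
  \<open>\<Gamma>\<^sub>X/\<Gamma>\<^sub>Z \<cong> C\<^sub>1\<^sub>4\<close> and in \<open>\<Gamma>\<^sub>Y/\<Gamma>\<^sub>Z \<cong> D\<^sub>1\<^sub>4\<close>, respectively; all lists are
  indexed by the initial vertex of the edge.\<close>

definition "adjX l s = (!) (case l of
     Zg \<Rightarrow> if s then [3, 7, 19, 9, 17, 16, 0, 8, 18, 10, 11, 12, 6, 14, 5, 2, 15, 1, 20, 13, 4]
           else [6, 17, 15, 0, 20, 14, 12, 1, 7, 3, 9, 10, 11, 19, 13, 16, 5, 4, 8, 2, 18]
   | Bg \<Rightarrow> if s then [1, 2, 0, 4, 5, 6, 8, 16, 14, 18, 7, 17, 20, 10, 3, 9, 11, 13, 19, 12, 15]
           else [2, 0, 1, 14, 3, 4, 5, 10, 6, 15, 13, 16, 19, 17, 8, 20, 7, 11, 9, 18, 12 :: nat])"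

definition "labX l = (!) (case l of
     Zg \<Rightarrow> [0, 0, 0, 0, 4, 0, 0, 4, 2, 0, 0, 0, 0, 0, 2, 0, 6, 0, 4, 6, 0]
   | Bg \<Rightarrow> [0, 7, 0, 0, 3, 0, 0, 9, 11, 0, 12, 2, 2, 12, 0, 12, 2, 5, 11, 2, 1 :: int])"

definition treeX :: "word list" where
  "treeX = [[], [(Bg, 1)], [(Bg, - 1)], [(Zg, 1)], [(Zg, 1), (Bg, 1)], [(Zg, - 1), (Bg, - 1)],
     [(Zg, - 1)], [(Bg, 1), (Zg, 1)], [(Zg, - 1), (Bg, 1)], [(Zg, 2)], [(Zg, 3)], [(Zg, - 3)],
     [(Zg, - 2)], [(Zg, 1), (Bg, - 1), (Zg, - 1)], [(Zg, 1), (Bg, - 1)], [(Bg, - 1), (Zg, - 1)],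
     [(Zg, - 1), (Bg, - 1), (Zg, 1)], [(Bg, 1), (Zg, - 1)], [(Zg, 2), (Bg, 1)],
     [(Bg, - 1), (Zg, 1)], [(Zg, 1), (Bg, 1), (Zg, - 1)]]"

definition "adjY l s = (!) (case l of
     Zg \<Rightarrow> if s then [3, 8, 7, 10, 11, 4, 19, 6, 20, 17, 13, 12, 1, 14, 15, 16, 0, 18, 2, 9, 5]
           else [16, 12, 18, 0, 5, 20, 7, 2, 1, 19, 3, 4, 11, 10, 13, 14, 15, 9, 17, 6, 8]
   | Bg \<Rightarrow> if s then [1, 2, 0, 4, 6, 17, 3, 14, 9, 10, 8, 18, 19, 11, 20, 12, 5, 16, 13, 15, 7]
           else [2, 0, 1, 6, 3, 16, 4, 20, 10, 8, 9, 13, 15, 18, 7, 19, 17, 5, 11, 12, 14 :: nat])"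

definition "labY l = (!) (case l of
     Zg \<Rightarrow> [(0, False), (0, False), (0, False), (0, False), (0, False), (3, False), (0, False),
       (6, False), (0, False), (3, False), (0, False), (2, False), (0, False), (0, False),
       (0, False), (0, False), (0, False), (6, False), (0, False), (6, False), (2, False)]
   | Bg \<Rightarrow> [(0, False), (0, True), (0, False), (0, False), (6, True), (1, True), (0, False),
       (3, False), (1, True), (0, False), (4, False), (4, True), (2, True), (4, False),
       (1, False), (3, False), (0, False), (0, False), (4, False), (3, False), (5 :: int, True)])"

definition treeY :: "word list" where
  "treeY = [[], [(Bg, 1)], [(Bg, - 1)], [(Zg, 1)], [(Zg, 1), (Bg, 1)], [(Zg, - 1), (Bg, 1)],
     [(Zg, 1), (Bg, - 1)], [(Bg, - 1), (Zg, 1)], [(Bg, 1), (Zg, 1)], [(Zg, 2), (Bg, - 1)],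
     [(Zg, 2)], [(Zg, 1), (Bg, 1), (Zg, 1)], [(Bg, 1), (Zg, - 1)], [(Zg, 3)], [(Zg, - 3)],
     [(Zg, - 2)], [(Zg, - 1)], [(Zg, - 1), (Bg, - 1)], [(Bg, - 1), (Zg, - 1)],
     [(Zg, 1), (Bg, - 1), (Zg, 1)], [(Bg, 1), (Zg, 2)]]"

text \<open>Plain integer counterpart of \<open>label\<close> in the cyclic group, suited to
  evaluation; reduction modulo 14 is postponed to the end. \<open>dsum\<close> does the same for the
  dihedral group, reducing at each step.\<close>

fun zsum :: "(letter \<Rightarrow> nat \<Rightarrow> int) \<Rightarrow> (letter \<times> nat \<times> bool) list \<Rightarrow> int" where
  "zsum c [] = 0"
| "zsum c ((l, i, s) # es) = (if s then c l i else - c l i) + zsum c es"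

fun dmul :: "int \<times> bool \<Rightarrow> int \<times> bool \<Rightarrow> int \<times> bool" where
  "dmul (i, s) (j, t) = ((if s then i - j else i + j) mod 7, s \<noteq> t)"

fun dinv :: "int \<times> bool \<Rightarrow> int \<times> bool" where
  "dinv (i, s) = (if s then i else (- i) mod 7, s)"

fun dsum :: "(letter \<Rightarrow> nat \<Rightarrow> int \<times> bool) \<Rightarrow> (letter \<times> nat \<times> bool) list \<Rightarrow> int \<times> bool" where
  "dsum c [] = (0, False)"
| "dsum c ((l, i, s) # es) = dmul (if s then c l i else dinv (c l i)) (dsum c es)"

section \<open>Finite checks on the tables\<close>

lemma adjX_table:
  "list_all (\<lambda>i. list_all (\<lambda>(l, s). adjX l s i < 21 \<and> adjX l (\<not> s) (adjX l s i) = i \<and>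
     0 \<le> labX l i \<and> labX l i < 14) [(Zg, True), (Zg, False), (Bg, True), (Bg, False)]) [0..<21]"
  by code_simp

lemma adjY_table:
  "list_all (\<lambda>i. list_all (\<lambda>(l, s). adjY l s i < 21 \<and> adjY l (\<not> s) (adjY l s i) = i \<and>
     0 \<le> fst (labY l i) \<and> fst (labY l i) < 7) [(Zg, True), (Zg, False), (Bg, True), (Bg, False)]) [0..<21]"
  by code_simp

text \<open>Testing a relator at every vertex amounts to testing all of its conjugates.\<close>

lemma relatorsX:
  "\<forall>r\<in>CS_relators. list_all (\<lambda>i. dest adjX (letters r) i = i \<and>
     zsum labX (trail adjX (letters r) i) mod 14 = 0) [0..<21]"
  unfolding CS_relators_def ball_simps by code_simp

lemma relatorsY:
  "\<forall>r\<in>CS_relators. list_all (\<lambda>i. dest adjY (letters r) i = i \<and>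
     dsum labY (trail adjY (letters r) i) = (0, False)) [0..<21]"
  unfolding CS_relators_def ball_simps by code_simp

lemma treeX_reaches: "map (\<lambda>w. dest adjX (letters w) 0) treeX = [0..<21]"
  by code_simp

lemma treeY_reaches: "map (\<lambda>w. dest adjY (letters w) 0) treeY = [0..<21]"
  by code_simp

text \<open>The weights below express that, modulo the relator loops, the generators of \<open>\<Gamma>\<^sub>X\<close> are
  congruent to the powers \<open>7\<close>, \<open>1\<close>, \<open>6\<close> of \<open>zb\<^sup>3z\<close> in the abelianisation, and that the
  fourteenth power of \<open>zb\<^sup>3z\<close> is trivial there. They were found by integer linear algebra.\<close>

definition loops :: "(int \<times> nat) list \<Rightarrow> word \<Rightarrow> (int \<times> (letter \<times> nat \<times> bool) list) list" where
  "loops ks w = map (\<lambda>(k, i). (k, trail adjX (letters w) i)) ks"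

definition relation_loops where
  "relation_loops ks0 ks1 ks2 ks3 =
     loops ks0 [(Zg, 7)] @ loops ks1 (word_power [(Bg, - 2), (Zg, 1)] 3) @
     loops ks2 [(Bg, 3), (Zg, - 2), (Bg, - 1), (Zg, 2), (Bg, - 2), (Zg, 1)] @
     map (\<lambda>(k, w). (k, trail adjX (letters w) 0)) ks3"

text \<open>Cancellation is demanded on all edges, those of the spanning tree included, so the
  resulting relation holds for any abelian labelling of the graph.\<close>

definition vanishes where
  "vanishes L \<longleftrightarrow> list_all (\<lambda>i. weighted_count L Zg i = 0 \<and> weighted_count L Bg i = 0) [0..<21]"

lemma vanishes1: "vanishes (relation_loops
   [(6, 17), (- 6, 10), (- 1, 15)]
    [(1, 6), (- 1, 8), (3, 4), (1, 2), (- 1, 12)]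
    [(- 1, 16), (- 2, 18), (4, 20), (- 3, 13), (1, 7), (- 3, 9), (- 4, 0), (- 8, 5), (6, 1), (- 6, 14)]
   [(- 1, [(Bg, 3)]), (7, [(Zg, 1), (Bg, 3), (Zg, 1)])])"
  by code_simp

lemma vanishes2: "vanishes (relation_loops
   [(3, 17), (- 4, 10)]
    [(2, 6), (- 1, 8), (3, 4), (- 1, 12)]
    [(1, 16), (- 3, 18), (- 2, 6), (2, 20), (- 1, 13), (1, 11), (- 2, 9), (- 4, 0), (- 6, 5), (1, 12), (5, 1), (- 3, 14)]
   [(- 1, [(Bg, 1), (Zg, 2), (Bg, - 1), (Zg, 1)]), (6, [(Zg, 1), (Bg, 3), (Zg, 1)])])"
  by code_simp

lemma vanishes3: "vanishes (relation_loops
   [(- 4, 17), (8, 10)]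
    [(- 1, 1), (- 5, 6), (4, 8), (- 7, 4), (2, 12)]
    [(- 4, 16), (8, 18), (5, 6), (- 4, 20), (- 5, 11), (3, 7), (3, 9), (11, 0), (14, 5), (- 3, 12), (- 12, 1), (5, 14)]
   [(- 14, [(Zg, 1), (Bg, 3), (Zg, 1)])])"
  by code_simp

text \<open>The isomorphism between the 14-sheeted coverings of the two graphs defined by the labels; it
  sends the sheet \<open>k\<close> over vertex \<open>0\<close> to the \<open>k\<close>-th listed point and is extended along the
  paths \<open>treeX\<close>.\<close>

definition coverXY :: "nat \<Rightarrow> int \<Rightarrow> nat \<times> (int \<times> bool)" where
  "coverXY i k = (let
     (j, d) = [(0, (0, False)), (13, (2, True)), (16, (3, False)), (10, (6, True)), (15, (6, False)),
        (3, (3, True)), (14, (2, False)), (0, (0, True)), (13, (5, False)), (16, (4, True)),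
        (10, (1, False)), (15, (1, True)), (3, (4, False)), (14, (5, True))] ! nat k;
     w = letters (treeX ! i)
     in (dest adjY w j, dmul d (dsum labY (trail adjY w j))))"

text \<open>Compatibility with the four directed steps makes \<open>coverXY\<close> a map of
  covering graphs. The clause on (0, identity) says that nothing but the base point lies over the
  base point, which is all the injectivity needed to compare kernels.\<close>

lemma coverXY_table:
  "list_all (\<lambda>k. list_all (\<lambda>i. case coverXY i k of (j, d) \<Rightarrow>
     j < 21 \<and> 0 \<le> fst d \<and> fst d < 7 \<and>
     (j = 0 \<and> d = (0, False) \<longrightarrow> i = 0 \<and> k = 0) \<and>
     list_all (\<lambda>(l, s).
       coverXY (adjX l s i) ((k + zsum labX (trail adjX [(l, s)] i)) mod 14) =
         (adjY l s j, dmul d (dsum labY (trail adjY [(l, s)] j))))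
     [(Zg, True), (Zg, False), (Bg, True), (Bg, False)]) [0..<21]) [0..13]"
  by code_simp

section \<open>Reidemeister--Schreier rewriting\<close>

definition letter_word :: "(letter \<times> bool) list \<Rightarrow> word" where
  "letter_word = map (\<lambda>(l, s). (l, if s then 1 else - 1))"

lemma letters_letter_word: "letters (letter_word u) = u"
  by (induction u) (auto simp: letter_word_def)

lemma (in group_presentation) word_val_letter_word: "word_val G z b (letter_word (letters w)) = word_val G z b w"
proof (induction w rule: letters.induct)
  case (2 l k w)
  have rep: "word_val G z b (replicate m (l, e)) = (case l of Zg \<Rightarrow> z | Bg \<Rightarrow> b) [^] (int m * e)" for m e
    by (induction m) (auto simp: gen_closed int_pow_mult distrib_right split: letter.split)
  have "letter_word (letters ((l, k) # w))
      = replicate (nat \<bar>k\<bar>) (l, if 0 \<le> k then 1 else - 1) @ letter_word (letters w)"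
    by (simp add: letter_word_def)
  then show ?case by (simp add: word_val_append rep 2)
qed (simp add: letter_word_def)

context presented_graph
begin

text \<open>Here \<open>\<tau>\<close> is a transversal, so \<open>c'\<close> is the image under \<open>\<theta>\<close> of the Schreier generators.\<close>

lemma schreier:
  assumes A: "group A" and \<theta>: "\<theta> \<in> hom (G\<lparr>carrier := stab\<rparr>) A"
    and \<tau>: "\<And>i. i < n \<Longrightarrow> \<tau> i \<in> carrier G \<and> end_pt (\<tau> i) 0 = i"
    and c': "\<And>l i. c' l i = \<theta> (\<tau> i \<otimes>\<^bsub>G\<^esub> word_val G z b [(l, 1)] \<otimes>\<^bsub>G\<^esub> inv\<^bsub>G\<^esub> \<tau> (adj l True i))"
    and n: "0 < n"
  shows "labelled_graph A n adj c'"
    and "i < n \<Longrightarrow> \<theta> (\<tau> i \<otimes>\<^bsub>G\<^esub> word_val G z b w \<otimes>\<^bsub>G\<^esub> inv\<^bsub>G\<^esub> \<tau> (dest adj (letters w) i))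
      = label A c' (trail adj (letters w) i)"
proof -
  interpret A: group A by fact
  have \<tau>_inv: "end_pt (inv\<^bsub>G\<^esub> \<tau> i) i = 0" if "i < n" for i
    using end_pt_mult[of "\<tau> i" "inv\<^bsub>G\<^esub> \<tau> i" 0] \<tau>[OF that] n by (simp add: end_pt_one)
  have S: "\<tau> i \<otimes>\<^bsub>G\<^esub> word_val G z b w \<otimes>\<^bsub>G\<^esub> inv\<^bsub>G\<^esub> \<tau> (dest adj (letters w) i) \<in> stab"
    if "i < n" for i w
    using that n \<tau>[OF that] \<tau>[OF dest_less[OF that]] \<tau>_inv[OF dest_less[OF that]]
    by (simp add: stab_def end_pt_mult end_pt_word_val end_pt_less)
  show graph: "labelled_graph A n adj c'"
  proof (intro labelled_graph.intro labelled_graph_axioms.intro A)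
    show "c' l i \<in> carrier A" if "i < n" for l i
      using hom_in_carrier[OF \<theta>] S[OF that, of "[(l, 1)]"] by (simp add: c')
  qed (simp_all add: adj_less adj_adj)
  interpret A: labelled_graph A n adj c' by (rule graph)
  have mult: "\<theta> (x \<otimes>\<^bsub>G\<^esub> y) = \<theta> x \<otimes>\<^bsub>A\<^esub> \<theta> y" if "x \<in> stab" "y \<in> stab" for x y
    using hom_mult[OF \<theta>, of x y] that by simp
  have stabG: "x \<in> carrier G" if "x \<in> stab" for x using that by (simp add: stab_def)
  have \<theta>c: "\<theta> x \<in> carrier A" if "x \<in> stab" for x
    using hom_in_carrier[OF \<theta>, of x] that by simp
  have one_stab: "\<one>\<^bsub>G\<^esub> \<in> stab" using subgroup.one_closed[OF subgroup_stab[OF n]] .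
  have \<theta>_one: "\<theta> \<one>\<^bsub>G\<^esub> = \<one>\<^bsub>A\<^esub>"
    using mult[OF one_stab one_stab] \<theta>c[OF one_stab] A.r_cancel_one by simp
  have \<theta>_inv: "\<theta> (inv\<^bsub>G\<^esub> x) = inv\<^bsub>A\<^esub> \<theta> x" if "x \<in> stab" for x
  proof -
    have ix: "inv\<^bsub>G\<^esub> x \<in> stab" using subgroup.m_inv_closed[OF subgroup_stab[OF n] that] .
    then have "\<theta> (inv\<^bsub>G\<^esub> x) \<otimes>\<^bsub>A\<^esub> \<theta> x = \<one>\<^bsub>A\<^esub>"
      using mult[OF ix that] stabG[OF that] by (simp add: \<theta>_one)
    then show ?thesis using A.inv_equality \<theta>c[OF ix] \<theta>c[OF that] by simp
  qed
  \<comment> \<open>A backward step from i to j reverses the forward edge from j to i, so its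
    element is the inverse of the Schreier generator of that edge.\<close>
  have step: "\<theta> (\<tau> i \<otimes>\<^bsub>G\<^esub> word_val G z b [(l, if s then 1 else - 1)] \<otimes>\<^bsub>G\<^esub> inv\<^bsub>G\<^esub> \<tau> (adj l s i))
      = (if s then c' l i else inv\<^bsub>A\<^esub> (c' l (adj l s i)))" if "i < n" for i l s
  proof (cases s)
    case False
    define j where "j = adj l False i"
    have j: "j < n" "adj l True j = i" using adj_less[OF that, of l False] adj_adj[OF that, of l False]
      by (auto simp: j_def)
    define x where "x = \<tau> j \<otimes>\<^bsub>G\<^esub> word_val G z b [(l, 1)] \<otimes>\<^bsub>G\<^esub> inv\<^bsub>G\<^esub> \<tau> i"
    have x: "x \<in> stab" using S[OF j(1), of "[(l, 1)]"] j(2) by (simp add: x_def)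
    have "word_val G z b [(l, - 1)] = inv\<^bsub>G\<^esub> word_val G z b [(l, 1)]"
      using P.word_val_word_inv[of "[(l, 1)]"] by simp
    then have "\<tau> i \<otimes>\<^bsub>G\<^esub> word_val G z b [(l, - 1)] \<otimes>\<^bsub>G\<^esub> inv\<^bsub>G\<^esub> \<tau> j = inv\<^bsub>G\<^esub> x"
      using \<tau>[OF that] \<tau>[OF j(1)]
      by (simp add: x_def P.inv_mult_group P.m_assoc del: word_val.simps)
    then show ?thesis using False x j
      by (simp add: \<theta>_inv c' x_def flip: j_def del: word_val.simps)
  qed (simp add: c' del: word_val.simps)
  have "i < n \<Longrightarrow> \<theta> (\<tau> i \<otimes>\<^bsub>G\<^esub> word_val G z b (letter_word u) \<otimes>\<^bsub>G\<^esub> inv\<^bsub>G\<^esub> \<tau> (dest adj u i))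
      = label A c' (trail adj u i)" for u i
  proof (induction u arbitrary: i)
    case Nil
    then show ?case using \<tau>[of i] by (simp add: letter_word_def \<theta>_one)
  next
    case (Cons x u)
    obtain l s where x: "x = (l, s)" by (cases x)
    define j where "j = adj l s i"
    have j: "j < n" using Cons.prems adj_less by (simp add: j_def)
    define g where "g = word_val G z b [(l, if s then 1 else - 1)]"
    define h where "h = word_val G z b (letter_word u)"
    define k where "k = dest adj u j"
    have k: "k < n" using dest_less[OF j] by (simp add: k_def)
    have gh: "g \<in> carrier G" "h \<in> carrier G" by (simp_all add: g_def h_def del: word_val.simps)
    have w: "word_val G z b (letter_word (x # u)) = g \<otimes>\<^bsub>G\<^esub> h"
      using P.word_val_append[of "[(l, if s then 1 else - 1)]" "letter_word u"]
      by (simp add: g_def h_def x letter_word_def del: word_val.simps)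
    \<comment> \<open>The transversal element at the intermediate vertex j is inserted together with
      its inverse, splitting the product into two elements of the stabiliser.\<close>
    have "\<tau> i \<otimes>\<^bsub>G\<^esub> (g \<otimes>\<^bsub>G\<^esub> h) \<otimes>\<^bsub>G\<^esub> inv\<^bsub>G\<^esub> \<tau> k
        = (\<tau> i \<otimes>\<^bsub>G\<^esub> g \<otimes>\<^bsub>G\<^esub> inv\<^bsub>G\<^esub> \<tau> j) \<otimes>\<^bsub>G\<^esub> (\<tau> j \<otimes>\<^bsub>G\<^esub> h \<otimes>\<^bsub>G\<^esub> inv\<^bsub>G\<^esub> \<tau> k)"
      using \<tau>[OF Cons.prems] \<tau>[OF j] \<tau>[OF k] gh
      by (simp add: P.m_assoc) (simp flip: P.m_assoc)
    moreover have "\<tau> i \<otimes>\<^bsub>G\<^esub> g \<otimes>\<^bsub>G\<^esub> inv\<^bsub>G\<^esub> \<tau> j \<in> stab"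
      using S[OF Cons.prems, of "[(l, if s then 1 else - 1)]"]
      by (simp add: g_def j_def split: if_splits del: word_val.simps)
    moreover have "\<tau> j \<otimes>\<^bsub>G\<^esub> h \<otimes>\<^bsub>G\<^esub> inv\<^bsub>G\<^esub> \<tau> k \<in> stab"
      using S[OF j, of "letter_word u"] by (simp add: h_def k_def letters_letter_word)
    ultimately have "\<theta> (\<tau> i \<otimes>\<^bsub>G\<^esub> (g \<otimes>\<^bsub>G\<^esub> h) \<otimes>\<^bsub>G\<^esub> inv\<^bsub>G\<^esub> \<tau> k)
        = \<theta> (\<tau> i \<otimes>\<^bsub>G\<^esub> g \<otimes>\<^bsub>G\<^esub> inv\<^bsub>G\<^esub> \<tau> j) \<otimes>\<^bsub>A\<^esub> \<theta> (\<tau> j \<otimes>\<^bsub>G\<^esub> h \<otimes>\<^bsub>G\<^esub> inv\<^bsub>G\<^esub> \<tau> k)"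
      by (simp add: mult)
    then show ?case
      using step[OF Cons.prems, of l s] Cons.IH[OF j] unfolding w
      by (simp add: x g_def h_def j_def k_def del: word_val.simps)
  qed
  from this[of i "letters w"] show "i < n \<Longrightarrow>
      \<theta> (\<tau> i \<otimes>\<^bsub>G\<^esub> word_val G z b w \<otimes>\<^bsub>G\<^esub> inv\<^bsub>G\<^esub> \<tau> (dest adj (letters w) i))
      = label A c' (trail adj (letters w) i)"
    by (simp add: P.word_val_letter_word)
qed

end

section \<open>The lattices as stabilisers\<close>

lemma label_integer_mod_group:
  assumes "0 < m" and "\<And>l i s. (l, i, s) \<in> set es \<Longrightarrow> c l i \<in> carrier (integer_mod_group m)"
  shows "label (integer_mod_group m) c es = zsum c es mod int m"
  using assms(2)
proof (induction es)
  case (Cons e es)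
  obtain l i s where e: "e = (l, i, s)" by (cases e)
  have "label (integer_mod_group m) c es = zsum c es mod int m"
    by (rule Cons.IH) (metis Cons.prems list.set_intros(2))
  moreover have "c l i \<in> carrier (integer_mod_group m)" using Cons.prems[of l i s] by (simp add: e)
  ultimately show ?case by (simp add: e mod_simps)
qed simp

lemma dmul_eq: "dmul x y = x \<otimes>\<^bsub>dihedral_group 7\<^esub> y"
  by (cases x; cases y) (simp add: dihedral_group_def)

lemma dinv_eq: "x \<in> carrier (dihedral_group 7) \<Longrightarrow> inv\<^bsub>dihedral_group 7\<^esub> x = dinv x"
  by (rule group.inv_equality[OF group_dihedral_group])
    (auto simp: dihedral_group_def mod_simps)

lemma label_dihedral_group:
  assumes "\<And>l i s. (l, i, s) \<in> set es \<Longrightarrow> c l i \<in> carrier (dihedral_group 7)"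
  shows "label (dihedral_group 7) c es = dsum c es"
  using assms
proof (induction es)
  case Nil
  show ?case by (simp add: dihedral_group_def)
next
  case (Cons e es)
  obtain l i s where e: "e = (l, i, s)" by (cases e)
  have "label (dihedral_group 7) c es = dsum c es"
    by (rule Cons.IH) (metis Cons.prems list.set_intros(2))
  moreover have "c l i \<in> carrier (dihedral_group 7)" using Cons.prems[of l i s] by (simp add: e)
  ultimately show ?case by (simp add: e dmul_eq dinv_eq)
qed

lemma labelled_graph_X: "labelled_graph (integer_mod_group 14) 21 adjX labX"
proof (intro labelled_graph.intro labelled_graph_axioms.intro group_integer_mod_group)
  have *: "adjX l s i < 21 \<and> adjX l (\<not> s) (adjX l s i) = i \<and> 0 \<le> labX l i \<and> labX l i < 14"
    if "i < 21" for l s i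
    using adjX_table that by (cases l; cases s) (auto simp: list_all_iff)
  show "adjX l s i < 21" "adjX l (\<not> s) (adjX l s i) = i" "labX l i \<in> carrier (integer_mod_group 14)"
    if "i < 21" for l s i
    using *[OF that, of l s] by (auto simp: carrier_integer_mod_group)
qed

lemma labelled_graph_Y: "labelled_graph (dihedral_group 7) 21 adjY labY"
proof (intro labelled_graph.intro labelled_graph_axioms.intro group_dihedral_group)
  have *: "adjY l s i < 21 \<and> adjY l (\<not> s) (adjY l s i) = i \<and> 0 \<le> fst (labY l i) \<and> fst (labY l i) < 7"
    if "i < 21" for l s i
    using adjY_table that by (cases l; cases s) (auto simp: list_all_iff)
  show "adjY l s i < 21" "adjY l (\<not> s) (adjY l s i) = i" "labY l i \<in> carrier (dihedral_group 7)"
    if "i < 21" for l s i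
    using *[OF that, of l s] by (auto simp: dihedral_group_def mem_Times_iff)
qed simp

interpretation X: labelled_graph "integer_mod_group 14" 21 adjX labX by (rule labelled_graph_X)
interpretation Y: labelled_graph "dihedral_group 7" 21 adjY labY by (rule labelled_graph_Y)

lemma label_X: "i < 21 \<Longrightarrow> label (integer_mod_group 14) labX (trail adjX u i) = zsum labX (trail adjX u i) mod 14"
  using X.trail_vertex_less X.c_closed by (subst label_integer_mod_group) auto

lemma label_Y: "i < 21 \<Longrightarrow> label (dihedral_group 7) labY (trail adjY u i) = dsum labY (trail adjY u i)"
  using Y.trail_vertex_less Y.c_closed by (intro label_dihedral_group) blast

text \<open>The edgewise compatibility in \<open>coverXY_table\<close> is composed along a path,
  which is the lifting of paths to the two coverings.\<close>

lemma coverXY_path: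
  assumes "i < 21" "0 \<le> k" "k < 14" "coverXY i k = (j, d)"
  shows "coverXY (dest adjX u i) ((k + label (integer_mod_group 14) labX (trail adjX u i)) mod 14)
    = (dest adjY u j, d \<otimes>\<^bsub>dihedral_group 7\<^esub> label (dihedral_group 7) labY (trail adjY u j))"
  using assms
proof (induction u arbitrary: i j k d)
  case Nil
  have "k \<in> set [0..13]" "i \<in> set [0..<21]" using Nil by auto
  then have "j < 21 \<and> 0 \<le> fst d \<and> fst d < 7"
    using coverXY_table Nil(4) by (fastforce simp: list_all_iff simp del: set_upto set_upt)
  then have "d \<in> carrier (dihedral_group 7)" by (simp add: dihedral_group_def mem_Times_iff)
  then show ?case using Nil Y.r_one by simp
next
  case (Cons x u)
  obtain l s where x: "x = (l, s)" by (cases x)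
  have mem: "k \<in> set [0..13]" "i \<in> set [0..<21]" using Cons.prems by auto
  have ls: "(l, s) \<in> set [(Zg, True), (Zg, False), (Bg, True), (Bg, False)]"
    by (cases l; cases s) auto
  define i' where "i' = adjX l s i"
  define j' where "j' = adjY l s j"
  define a where "a = label (integer_mod_group 14) labX (trail adjX [(l, s)] i)"
  define e where "e = label (dihedral_group 7) labY (trail adjY [(l, s)] j)"
  have *: "j < 21 \<and> 0 \<le> fst d \<and> fst d < 7 \<and>
      coverXY i' ((k + zsum labX (trail adjX [(l, s)] i)) mod 14)
      = (j', dmul d (dsum labY (trail adjY [(l, s)] j)))"
    using coverXY_table mem ls Cons.prems(4) unfolding list_all_iff i'_def j'_def
    by (fastforce simp del: set_upto set_upt trail.simps zsum.simps dsum.simps)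
  then have j: "j < 21" and d: "d \<in> carrier (dihedral_group 7)"
    by (auto simp: dihedral_group_def mem_Times_iff)
  have i': "i' < 21" using X.adj_less Cons.prems(1) by (simp add: i'_def)
  have j': "j' < 21" using Y.adj_less j by (simp add: j'_def)
  have "coverXY i' ((k + a) mod 14) = (j', d \<otimes>\<^bsub>dihedral_group 7\<^esub> e)"
    using * unfolding a_def e_def label_X[OF Cons.prems(1)] label_Y[OF j] dmul_eq
    by (simp add: mod_simps)
  from Cons.IH[OF i' _ _ this]
  have "coverXY (dest adjX u i') (((k + a) mod 14 + label (integer_mod_group 14) labX (trail adjX u i')) mod 14)
    = (dest adjY u j', d \<otimes>\<^bsub>dihedral_group 7\<^esub> e \<otimes>\<^bsub>dihedral_group 7\<^esub> label (dihedral_group 7) labY (trail adjY u j'))"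
    by simp
  moreover have "label (integer_mod_group 14) labX (trail adjX (x # u) i)
      = (a + label (integer_mod_group 14) labX (trail adjX u i')) mod 14"
    using X.label_trail_append[OF Cons.prems(1), of "[(l, s)]" u] by (simp add: x a_def i'_def)
  moreover have "label (dihedral_group 7) labY (trail adjY (x # u) j)
      = e \<otimes>\<^bsub>dihedral_group 7\<^esub> label (dihedral_group 7) labY (trail adjY u j')"
    using Y.label_trail_append[OF j, of "[(l, s)]" u] by (simp add: x e_def j'_def)
  moreover have "e \<in> carrier (dihedral_group 7)" unfolding e_def by (rule Y.label_trail_closed[OF j])
  moreover note d Y.label_trail_closed[OF j', of u]
  ultimately show ?case
    by (simp add: x i'_def[symmetric] j'_def[symmetric] Y.m_assoc mod_simps add.assoc)
qed

text \<open>The combinatorial part is kept free of matrices: G is any group with this presentation,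
  and the subgroups enter by their generators and their index.\<close>

locale cartwright_steger = group_presentation G z b CS_relators for G (structure) and z b +
  fixes X Y
  assumes X_def: "X = generate G (word_val G z b `
      {[(Bg, 3)], [(Zg, 1), (Bg, 3), (Zg, 1)], [(Bg, 1), (Zg, 2), (Bg, - 1), (Zg, 1)]})"
    and Y_def: "Y = generate G (word_val G z b `
      {[(Bg, 3)], word_power [(Zg, 1), (Bg, 1), (Zg, - 1)] 3,
       [(Bg, 1), (Zg, 1), (Bg, 2), (Zg, - 2)], [(Zg, 1), (Bg, 1), (Zg, 3), (Bg, - 1)]})"
    and index_X: "card (rcosets X) = 21" and index_Y: "card (rcosets Y) = 21"
begin

sublocale X: presented_graph G z b CS_relators "integer_mod_group 14" 21 adjX labX
proof (intro presented_graph.intro presented_graph_axioms.intro labelled_graph_X)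
  show "X.path_equiv (letters r) []" if "r \<in> CS_relators" for r
    using relatorsX that by (simp add: X.path_equiv_def label_X list_all_iff)
qed unfold_locales

sublocale Y: presented_graph G z b CS_relators "dihedral_group 7" 21 adjY labY
proof (intro presented_graph.intro presented_graph_axioms.intro labelled_graph_Y)
  show "Y.path_equiv (letters r) []" if "r \<in> CS_relators" for r
    using relatorsY that label_Y label_Y[of _ "[]"] by (simp add: Y.path_equiv_def list_all_iff)
qed unfold_locales

lemma nth_treeX: "i < 21 \<Longrightarrow> X.end_pt (word_val G z b (treeX ! i)) 0 = i"
proof -
  assume i: "i < 21"
  have "length treeX = 21" by (simp add: treeX_def)
  then show ?thesis using i treeX_reaches X.end_pt_word_val[of 0]
    by (metis (no_types, lifting) add.left_neutral nth_map nth_upt zero_less_numeral)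
qed

lemma nth_treeY: "i < 21 \<Longrightarrow> Y.end_pt (word_val G z b (treeY ! i)) 0 = i"
proof -
  assume i: "i < 21"
  have "length treeY = 21" by (simp add: treeY_def)
  then show ?thesis using i treeY_reaches Y.end_pt_word_val[of 0]
    by (metis (no_types, lifting) add.left_neutral nth_map nth_upt zero_less_numeral)
qed

lemma X_eq_stab: "X = X.stab"
proof (rule X.eq_stab_if_index)
  show "subgroup X G" unfolding X_def by (rule generate_is_subgroup) (auto simp del: word_val.simps)
  have "list_all (\<lambda>w. dest adjX (letters w) 0 = 0)
      [[(Bg, 3)], [(Zg, 1), (Bg, 3), (Zg, 1)], [(Bg, 1), (Zg, 2), (Bg, - 1), (Zg, 1)]]"
    by code_simp
  then show "X \<subseteq> X.stab" unfolding X_def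
    by (intro generate_subgroup_incl X.subgroup_stab)
      (auto simp: X.stab_def X.end_pt_word_val simp del: word_val.simps)
qed (use nth_treeX index_X word_val_closed in \<open>simp_all, blast\<close>)

lemma Y_eq_stab: "Y = Y.stab"
proof (rule Y.eq_stab_if_index)
  show "subgroup Y G" unfolding Y_def by (rule generate_is_subgroup) (auto simp del: word_val.simps)
  have "list_all (\<lambda>w. dest adjY (letters w) 0 = 0)
      [[(Bg, 3)], word_power [(Zg, 1), (Bg, 1), (Zg, - 1)] 3,
       [(Bg, 1), (Zg, 1), (Bg, 2), (Zg, - 2)], [(Zg, 1), (Bg, 1), (Zg, 3), (Bg, - 1)]]"
    by code_simp
  then show "Y \<subseteq> Y.stab" unfolding Y_def
    by (intro generate_subgroup_incl Y.subgroup_stab)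
      (auto simp: Y.stab_def Y.end_pt_word_val simp del: word_val.simps)
qed (use nth_treeY index_Y word_val_closed in \<open>simp_all, blast\<close>)

text \<open>Being in a kernel means that the lifted path from the base point of the covering closes
  up, and \<open>coverXY\<close> carries the lift for \<open>X\<close> to the lift for
  \<open>Y\<close>.\<close>

lemma kernels_eq: "{g \<in> X. X.lab g 0 = 0} = {g \<in> Y. Y.lab g 0 = \<one>\<^bsub>dihedral_group 7\<^esub>}"
proof -
  have base: "coverXY 0 0 = (0, \<one>\<^bsub>dihedral_group 7\<^esub>)" by code_simp
  have cover: "coverXY (X.end_pt g 0) (X.lab g 0) = (Y.end_pt g 0, Y.lab g 0)" for g
    using coverXY_path[OF _ _ _ base, of "letters (word_of g)"]
      X.lab_closed[of 0 g] Y.lab_closed[of 0 g]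
    by (simp add: carrier_integer_mod_group flip: X.end_pt_def X.lab_def Y.end_pt_def Y.lab_def)
  \<comment> \<open>This is the direction from \<open>Y\<close> to \<open>X\<close>: a lift closed
    over \<open>Y\<close> must come from one that is closed over \<open>X\<close>.\<close>
  have unique: "i = 0 \<and> k = 0"
    if "coverXY i k = (0, \<one>\<^bsub>dihedral_group 7\<^esub>)" "i < 21" "k \<in> carrier (integer_mod_group 14)" for i k
  proof -
    have "k \<in> set [0..13]" "i \<in> set [0..<21]" using that by (auto simp: carrier_integer_mod_group)
    then show ?thesis using coverXY_table that(1) unfolding list_all_iff
      by (fastforce simp: dihedral_group_def simp del: set_upto set_upt trail.simps zsum.simps dsum.simps)
  qed
  show ?thesis
  proof (intro equalityI subsetI)
    fix g assume "g \<in> {g \<in> X. X.lab g 0 = 0}"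
    then have "g \<in> carrier G" "X.end_pt g 0 = 0" "X.lab g 0 = 0"
      by (auto simp: X_eq_stab X.stab_def)
    then show "g \<in> {g \<in> Y. Y.lab g 0 = \<one>\<^bsub>dihedral_group 7\<^esub>}"
      using cover[of g] base by (simp add: Y_eq_stab Y.stab_def)
  next
    fix g assume "g \<in> {g \<in> Y. Y.lab g 0 = \<one>\<^bsub>dihedral_group 7\<^esub>}"
    then have "g \<in> carrier G" "Y.end_pt g 0 = 0" "Y.lab g 0 = \<one>\<^bsub>dihedral_group 7\<^esub>"
      by (auto simp: Y_eq_stab Y.stab_def)
    then show "g \<in> {g \<in> X. X.lab g 0 = 0}"
      using cover[of g] unique[of "X.end_pt g 0" "X.lab g 0"] X.lab_closed[of 0 g] X.end_pt_less[of 0 g]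
      by (simp add: X_eq_stab X.stab_def)
  qed
qed

end

section \<open>The cyclic and the dihedral quotient\<close>

lemma (in labelled_graph) weighted_label_closed:
  assumes "\<And>k es. (k, es) \<in> set L \<Longrightarrow> label G c es \<in> carrier G"
  shows "weighted_label G c L \<in> carrier G"
  using assms
proof (induction L)
  case (Cons x L)
  have "weighted_label G c L \<in> carrier G"
    by (rule Cons.IH) (metis Cons.prems list.set_intros(2))
  then show ?case using Cons.prems[of "fst x" "snd x"] by (cases x) simp
qed simp

lemma (in labelled_graph) weighted_label_append:
  assumes "\<And>k es. (k, es) \<in> set (L @ M) \<Longrightarrow> label G c es \<in> carrier G"
  shows "weighted_label G c (L @ M) = weighted_label G c L \<otimes> weighted_label G c M"
  using assms
proof (induction L)
  case Nil
  then show ?case using weighted_label_closed[of M] by simp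
next
  case (Cons x L)
  have "weighted_label G c (L @ M) = weighted_label G c L \<otimes> weighted_label G c M"
    by (rule Cons.IH) (metis Cons.prems append_Cons list.set_intros(2))
  moreover have "weighted_label G c L \<in> carrier G" "weighted_label G c M \<in> carrier G"
    using Cons.prems by (auto intro!: weighted_label_closed)
  ultimately show ?case using Cons.prems[of "fst x" "snd x"] by (cases x) (simp add: m_assoc)
qed

lemma (in labelled_graph) weighted_label_trivial:
  assumes "\<And>k es. (k, es) \<in> set L \<Longrightarrow> label G c es = \<one>"
  shows "weighted_label G c L = \<one>"
  using assms
proof (induction L)
  case (Cons x L)
  have "weighted_label G c L = \<one>"
    by (rule Cons.IH) (metis Cons.prems list.set_intros(2))
  then show ?case using Cons.prems[of "fst x" "snd x"] by (cases x) simp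
qed simp

context cartwright_steger
begin

lemma subgroup_X: "subgroup X G" and subgroup_Y: "subgroup Y G"
  by (simp_all add: X_eq_stab X.subgroup_stab Y_eq_stab Y.subgroup_stab)

lemma labX_hom: "(\<lambda>g. X.lab g 0) \<in> hom (G\<lparr>carrier := X\<rparr>) (integer_mod_group 14)"
  using X.lab_hom by (simp add: X_eq_stab)

lemma labY_hom: "(\<lambda>g. Y.lab g 0) \<in> hom (G\<lparr>carrier := Y\<rparr>) (dihedral_group 7)"
  using Y.lab_hom by (simp add: Y_eq_stab)

abbreviation "x1 \<equiv> word_val G z b [(Bg, 3)]"
abbreviation "x2 \<equiv> word_val G z b [(Zg, 1), (Bg, 3), (Zg, 1)]"
abbreviation "x3 \<equiv> word_val G z b [(Bg, 1), (Zg, 2), (Bg, - 1), (Zg, 1)]"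

lemma labX_gens: "X.lab x1 0 = 7" "X.lab x2 0 = 3" "X.lab x3 0 = 4"
proof -
  have "map (\<lambda>w. zsum labX (trail adjX (letters w) 0) mod 14)
      [[(Bg, 3)], [(Zg, 1), (Bg, 3), (Zg, 1)], [(Bg, 1), (Zg, 2), (Bg, - 1), (Zg, 1)]] = [7, 3, 4]"
    by code_simp
  then show "X.lab x1 0 = 7" "X.lab x2 0 = 3" "X.lab x3 0 = 4"
    by (simp_all add: X.lab_word_val label_X del: word_val.simps letters.simps)
qed

text \<open>The abelianisation of \<open>X\<close> is generated by the class t of \<open>x2\<close>,
  and t has exponent dividing 14. Since the label of \<open>x2\<close> is invertible modulo 14, a
  trivial label forces a trivial class.\<close>

lemma kernel_subset_derived: "{g \<in> X. X.lab g 0 = 0} \<subseteq> derived G X"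
proof -
  define D where "D = derived G X"
  define A where "A = G\<lparr>carrier := X\<rparr> Mod D"
  define \<theta> where "\<theta> g = D #>\<^bsub>G\<lparr>carrier := X\<rparr>\<^esub> g" for g
  interpret A: comm_group A
    unfolding A_def D_def by (rule derived_quot_of_subgroup_is_comm_group[OF subgroup_X])
  have normal: "D \<lhd> G\<lparr>carrier := X\<rparr>"
    unfolding D_def by (rule derived_subgroup_is_normal[OF subgroup_X])
  have \<theta>_hom: "\<theta> \<in> hom (G\<lparr>carrier := X\<rparr>) A"
    using normal.r_coset_hom_Mod[OF normal] unfolding \<theta>_def[abs_def] A_def .
  interpret \<theta>: group_hom "G\<lparr>carrier := X\<rparr>" A \<theta>
    by (intro group_hom.intro group_hom_axioms.intro \<theta>_hom A.is_group subgroup_imp_group subgroup_X)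
  have \<theta>_kernel: "g \<in> D" if "g \<in> X" "\<theta> g = \<one>\<^bsub>A\<^esub>" for g
  proof -
    have "g \<in> D #>\<^bsub>G\<lparr>carrier := X\<rparr>\<^esub> g"
      using that by (intro group.rcos_self[OF subgroup_imp_group[OF subgroup_X]])
        (auto intro: normal_imp_subgroup normal)
    then show ?thesis using that by (simp add: \<theta>_def A_def FactGroup_def)
  qed
  define \<tau> where "\<tau> i = word_val G z b (treeX ! i)" for i
  have \<tau>: "\<tau> i \<in> carrier G \<and> X.end_pt (\<tau> i) 0 = i" if "i < 21" for i
    using nth_treeX[OF that] by (simp add: \<tau>_def)
  have \<tau>0: "\<tau> 0 = \<one>" by (simp add: \<tau>_def treeX_def)
  \<comment> \<open>The graph is relabelled in the abelianisation itself, where relator loops are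
    trivial because the relators hold in G.\<close>
  define c where "c l i = \<theta> (\<tau> i \<otimes> word_val G z b [(l, 1)] \<otimes> inv \<tau> (adjX l True i))" for l i
  note schreier = X.schreier[of A \<theta> \<tau> c, OF A.is_group \<theta>_hom[unfolded X_eq_stab] \<tau> c_def, simplified]
  interpret C: comm_labelled_graph A 21 adjX c
    using schreier(1) by (intro comm_labelled_graph.intro A.comm_group_axioms)
  have relator: "label A c (trail adjX (letters r) i) = \<one>\<^bsub>A\<^esub>" if "r \<in> CS_relators" "i < 21" for r i
  proof -
    have "word_val G z b r = \<one>"
      using presented pres_eq.relator[OF that(1)] by (simp add: presented_by_def)
    moreover have "dest adjX (letters r) i = i"
      using relatorsX that by (auto simp: list_all_iff)
    ultimately show ?thesis using schreier(2)[OF that(2), of r] \<tau>[OF that(2)] \<theta>.hom_one by simp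
  qed
  have gen: "label A c (trail adjX (letters w) 0) = \<theta> (word_val G z b w)"
    if "dest adjX (letters w) 0 = 0" for w
    using schreier(2)[of 0 w] that \<tau>0 by simp
  \<comment> \<open>The full combination has zero chain and its relator part is trivial, so what
    remains is a relation between the classes of the generators.\<close>
  have relation: "weighted_label A c (map (\<lambda>(k, w). (k, trail adjX (letters w) 0)) ks3) = \<one>\<^bsub>A\<^esub>"
    if v: "vanishes (relation_loops ks0 ks1 ks2 ks3)"
      and i: "list_all (\<lambda>(k, i). i < 21) (ks0 @ ks1 @ ks2)" for ks0 ks1 ks2 ks3
  proof -
    let ?L = "loops ks0 [(Zg, 7)] @ loops ks1 (word_power [(Bg, - 2), (Zg, 1)] 3) @
      loops ks2 [(Bg, 3), (Zg, - 2), (Bg, - 1), (Zg, 2), (Bg, - 2), (Zg, 1)]"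
    let ?M = "map (\<lambda>(k, w). (k, trail adjX (letters w) 0)) ks3"
    have L: "\<exists>r\<in>CS_relators. \<exists>i<21. es = trail adjX (letters r) i" if "(k, es) \<in> set ?L" for k es
    proof -
      have R: "[(Zg, 7)] \<in> CS_relators" "word_power [(Bg, - 2), (Zg, 1)] 3 \<in> CS_relators"
          "[(Bg, 3), (Zg, - 2), (Bg, - 1), (Zg, 2), (Bg, - 2), (Zg, 1)] \<in> CS_relators"
        by (simp_all add: CS_relators_def)
      have "\<exists>i<21. es = trail adjX (letters r) i"
        if "(k, es) \<in> set (loops ks r)" "ks \<in> {ks0, ks1, ks2}" for ks r
        using that i unfolding loops_def list_all_iff by fastforce
      then show ?thesis using that R unfolding set_append Un_iff by blast
    qed
    have M: "\<exists>w. es = trail adjX (letters w) 0" if "(k, es) \<in> set ?M" for k es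
      using that by auto
    have 1: "weighted_label A c ?L = \<one>\<^bsub>A\<^esub>"
    proof (rule C.weighted_label_trivial)
      fix k es assume "(k, es) \<in> set ?L"
      from L[OF this] show "label A c es = \<one>\<^bsub>A\<^esub>" using relator by blast
    qed
    have trails: "\<exists>w i. es = trail adjX (letters w) i \<and> i < 21"
      if "(k, es) \<in> set ?L \<or> (k, es) \<in> set ?M" for k es
      using that
    proof
      assume "(k, es) \<in> set ?L"
      from L[OF this] show ?thesis by blast
    next
      assume "(k, es) \<in> set ?M"
      from M[OF this] show ?thesis by (metis zero_less_numeral)
    qed
    have closed: "label A c es \<in> carrier A" if "(k, es) \<in> set ?L \<or> (k, es) \<in> set ?M" for k es
      using trails[OF that] C.label_trail_closed by blast
    have "weighted_label A c (?L @ ?M) = \<one>\<^bsub>A\<^esub>"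
    proof (rule C.weighted_label_eq_one)
      show "weighted_count (?L @ ?M) l i = 0" if "i < 21" for l i
        using v that unfolding relation_loops_def vanishes_def list_all_iff append_assoc
        by (cases l) auto
    next
      fix k es l i s assume "(k, es) \<in> set (?L @ ?M)" and e: "(l, i, s) \<in> set es"
      then have "(k, es) \<in> set ?L \<or> (k, es) \<in> set ?M" unfolding set_append Un_iff by blast
      from trails[OF this] show "i < 21" using C.trail_vertex_less e by blast
    qed
    moreover have "weighted_label A c (?L @ ?M) = weighted_label A c ?L \<otimes>\<^bsub>A\<^esub> weighted_label A c ?M"
      using closed by (intro C.weighted_label_append) auto
    moreover have "weighted_label A c ?M \<in> carrier A"
      using closed by (intro C.weighted_label_closed) blast
    ultimately show ?thesis using 1 by simp
  qed
  have x_in: "x1 \<in> X" "x2 \<in> X" "x3 \<in> X" unfolding X_def by (auto intro: generate.incl)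
  define t where "t = \<theta> x2"
  have t: "t \<in> carrier A" using \<theta>.hom_closed[of x2] x_in by (simp add: t_def)
  have \<theta>x: "\<theta> x1 \<in> carrier A" "\<theta> x3 \<in> carrier A" using \<theta>.hom_closed x_in by simp_all
  have loops0: "dest adjX (letters [(Bg, 3)]) 0 = 0" "dest adjX (letters [(Zg, 1), (Bg, 3), (Zg, 1)]) 0 = 0"
      "dest adjX (letters [(Bg, 1), (Zg, 2), (Bg, - 1), (Zg, 1)]) 0 = 0"
    by code_simp+
  have r1: "inv\<^bsub>A\<^esub> \<theta> x1 \<otimes>\<^bsub>A\<^esub> t [^]\<^bsub>A\<^esub> (7::int) = \<one>\<^bsub>A\<^esub>"
    using relation[OF vanishes1] t \<theta>x
    by (simp add: gen loops0 A.int_pow_neg t_def del: word_val.simps letters.simps)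
  have r2: "inv\<^bsub>A\<^esub> \<theta> x3 \<otimes>\<^bsub>A\<^esub> t [^]\<^bsub>A\<^esub> (6::int) = \<one>\<^bsub>A\<^esub>"
    using relation[OF vanishes2] t \<theta>x
    by (simp add: gen loops0 A.int_pow_neg t_def del: word_val.simps letters.simps)
  have "t [^]\<^bsub>A\<^esub> (- 14::int) = \<one>\<^bsub>A\<^esub>"
    using relation[OF vanishes3] t
    by (simp add: gen loops0 t_def del: word_val.simps letters.simps)
  then have t14: "t [^]\<^bsub>A\<^esub> (14::int) = \<one>\<^bsub>A\<^esub>"
    using t A.int_pow_neg[of t "14"] A.inv_eq_1_iff by simp
  have x1: "\<theta> x1 = t [^]\<^bsub>A\<^esub> (7::int)" and x3: "\<theta> x3 = t [^]\<^bsub>A\<^esub> (6::int)"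
    using r1 r2 t \<theta>x by (metis A.int_pow_closed A.inv_closed A.inv_equality A.inv_inv)+
  \<comment> \<open>The factor 3 is the label of \<open>x2\<close>. The labels 7 and 4 of
    \<open>x1\<close> and \<open>x3\<close> agree with 3 * 7 and 3 * 6 modulo 14, matching their
    classes as powers of t.\<close>
  have "\<exists>k::int. \<theta> g = t [^]\<^bsub>A\<^esub> k \<and> X.lab g 0 = 3 * k mod 14" if "g \<in> X" for g
  proof -
    interpret lab: group_hom "G\<lparr>carrier := X\<rparr>" "integer_mod_group 14" "\<lambda>g. X.lab g 0"
      by (intro group_hom.intro group_hom_axioms.intro labX_hom group_integer_mod_group
          subgroup_imp_group subgroup_X)
    have gens: "\<exists>k::int. \<theta> h = t [^]\<^bsub>A\<^esub> k \<and> X.lab h 0 = 3 * k mod 14" if "h \<in> {x1, x2, x3}" for h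
    proof -
      have "\<theta> x1 = t [^]\<^bsub>A\<^esub> (7::int) \<and> X.lab x1 0 = 3 * 7 mod 14" using x1 by (simp add: labX_gens del: word_val.simps)
      moreover have "\<theta> x2 = t [^]\<^bsub>A\<^esub> (1::int) \<and> X.lab x2 0 = 3 * 1 mod 14"
        using t by (simp add: labX_gens t_def del: word_val.simps)
      moreover have "\<theta> x3 = t [^]\<^bsub>A\<^esub> (6::int) \<and> X.lab x3 0 = 3 * 6 mod 14" using x3 by (simp add: labX_gens del: word_val.simps)
      ultimately show ?thesis using that by blast
    qed
    have "g \<in> generate G {x1, x2, x3}" using that by (simp add: X_def del: word_val.simps)
    then show ?thesis
    proof induction
      case one
      have "\<theta> \<one> = t [^]\<^bsub>A\<^esub> (0::int)" "X.lab \<one> 0 = 3 * 0 mod 14"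
        using \<theta>.hom_one lab.hom_one by simp_all
      then show ?case by blast
    next
      case (incl h)
      then show ?case by (rule gens)
    next
      case (inv h)
      then obtain k :: int where k: "\<theta> h = t [^]\<^bsub>A\<^esub> k" "X.lab h 0 = 3 * k mod 14" using gens by blast
      have h: "h \<in> X" using inv x_in by blast
      have "inv\<^bsub>G\<lparr>carrier := X\<rparr>\<^esub> h = inv h" using m_inv_consistent[OF subgroup_X h] .
      then have "\<theta> (inv h) = t [^]\<^bsub>A\<^esub> (- k)" "X.lab (inv h) 0 = 3 * (- k) mod 14"
        using \<theta>.hom_inv[of h] lab.hom_inv[of h] h k t lab.hom_closed[of h]
        by (simp_all add: A.int_pow_neg mod_simps)
      then show ?case by blast
    next
      case (eng g h)
      then have "g \<in> X" "h \<in> X" by (simp_all add: X_def del: word_val.simps)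
      moreover obtain j k :: int where "\<theta> g = t [^]\<^bsub>A\<^esub> j" "X.lab g 0 = 3 * j mod 14"
          "\<theta> h = t [^]\<^bsub>A\<^esub> k" "X.lab h 0 = 3 * k mod 14" using eng by blast
      ultimately have "\<theta> (g \<otimes> h) = t [^]\<^bsub>A\<^esub> (j + k)" "X.lab (g \<otimes> h) 0 = 3 * (j + k) mod 14"
        using \<theta>.hom_mult[of g h] lab.hom_mult[of g h] t
        by (simp_all add: A.int_pow_mult mod_simps distrib_left)
      then show ?case by blast
    qed
  qed note exponent = this
  show ?thesis
  proof
    fix g assume "g \<in> {g \<in> X. X.lab g 0 = 0}"
    then have g: "g \<in> X" "X.lab g 0 = 0" by auto
    then obtain k :: int where k: "\<theta> g = t [^]\<^bsub>A\<^esub> k" "3 * k mod 14 = 0" using exponent by metis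
    \<comment> \<open>3 is a unit modulo 14.\<close>
    have "14 dvd k" using k(2) by presburger
    then obtain m where "k = 14 * m" by (rule dvdE)
    then have "\<theta> g = \<one>\<^bsub>A\<^esub>" using k t t14 A.int_pow_pow[OF t, of 14 m] by simp
    then show "g \<in> derived G X" using \<theta>_kernel g by (simp add: D_def)
  qed
qed

text \<open>The target group is abelian, so commutators have trivial label.\<close>

lemma derived_subset_kernel: "derived G X \<subseteq> {g \<in> X. X.lab g 0 = 0}"
proof -
  interpret lab: group_hom "G\<lparr>carrier := X\<rparr>" "integer_mod_group 14" "\<lambda>g. X.lab g 0"
    by (intro group_hom.intro group_hom_axioms.intro labX_hom group_integer_mod_group
        subgroup_imp_group subgroup_X)
  interpret Z: comm_group "integer_mod_group 14" by simp
  have K: "kernel (G\<lparr>carrier := X\<rparr>) (integer_mod_group 14) (\<lambda>g. X.lab g 0) = {g \<in> X. X.lab g 0 = 0}"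
    by (simp add: kernel_def)
  have "derived G X = derived (G\<lparr>carrier := X\<rparr>) X"
    by (rule derived_consistent[OF _ subgroup_X, symmetric]) simp
  also have "\<dots> \<subseteq> {g \<in> X. X.lab g 0 = 0}"
  proof -
    have "(\<lambda>g. X.lab g 0) ` derived (G\<lparr>carrier := X\<rparr>) X
        = derived (integer_mod_group 14) ((\<lambda>g. X.lab g 0) ` X)"
      using lab.derived_img[of X] by simp
    also have "\<dots> = {0}" using Z.derived_eq_singleton lab.hom_closed by (simp add: image_subset_iff)
    finally show ?thesis
      using group.derived_in_carrier[OF subgroup_imp_group[OF subgroup_X], of X] by auto
  qed
  finally show ?thesis .
qed

lemma derived_X: "derived G X = {g \<in> X. X.lab g 0 = 0}"
  using kernel_subset_derived derived_subset_kernel by blast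

lemma labX_surj: "(\<lambda>g. X.lab g 0) ` X = carrier (integer_mod_group 14)"
proof
  interpret lab: group_hom "G\<lparr>carrier := X\<rparr>" "integer_mod_group 14" "\<lambda>g. X.lab g 0"
    by (intro group_hom.intro group_hom_axioms.intro labX_hom group_integer_mod_group
        subgroup_imp_group subgroup_X)
  show "(\<lambda>g. X.lab g 0) ` X \<subseteq> carrier (integer_mod_group 14)" using lab.hom_closed by auto
  show "carrier (integer_mod_group 14) \<subseteq> (\<lambda>g. X.lab g 0) ` X"
  proof
    fix k assume k: "k \<in> carrier (integer_mod_group 14)"
    have "x2 \<in> X" unfolding X_def by (auto intro: generate.incl)
    \<comment> \<open>5 inverts 3 modulo 14, so the power 5k of \<open>x2\<close>, whose label is 3,
      has label k.\<close>
    then have "X.lab (x2 [^]\<^bsub>G\<lparr>carrier := X\<rparr>\<^esub> (5 * k)) 0 = 5 * k * 3 mod 14"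
      using lab.hom_int_pow[of x2 "5 * k"]
      by (simp add: labX_gens int_pow_integer_mod_group del: word_val.simps)
    also have "5 * k * 3 = k + k * 14" by simp
    also have "\<dots> mod 14 = k mod 14" by (rule mod_mult_self1)
    also have "\<dots> = k" using k by (simp add: carrier_integer_mod_group)
    finally have "k = X.lab (x2 [^]\<^bsub>G\<lparr>carrier := X\<rparr>\<^esub> (5 * k)) 0" by (rule HOL.sym)
    moreover have "x2 [^]\<^bsub>G\<lparr>carrier := X\<rparr>\<^esub> (5 * k) \<in> X"
      using \<open>x2 \<in> X\<close> lab.G.int_pow_closed[of x2 "5 * k"] by (simp del: word_val.simps)
    ultimately show "k \<in> (\<lambda>g. X.lab g 0) ` X" by (rule image_eqI)
  qed
qed

section \<open>Dihedral labels on \<open>Gamma_Y\<close> and the preimage of the rotations\<close>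

abbreviation "y1 \<equiv> word_val G z b [(Bg, 3)]"
abbreviation "w \<equiv> word_val G z b [(Bg, 1), (Zg, 1), (Bg, 2), (Zg, - 2), (Bg, 3)]"

text \<open>A rotation by one step and a reflection, which together generate the dihedral group. The
  final b^3 in \<open>w\<close> cancels the reflection carried by the generator b z b^2 z^(-2) of
  \<open>Y\<close>.\<close>

lemma labY_gens: "w \<in> Y" "Y.lab w 0 = (1, False)" "y1 \<in> Y" "Y.lab y1 0 = (0, True)"
proof -
  have "map (\<lambda>w. (dest adjY (letters w) 0, dsum labY (trail adjY (letters w) 0)))
      [[(Bg, 1), (Zg, 1), (Bg, 2), (Zg, - 2), (Bg, 3)], [(Bg, 3)]] = [(0, (1, False)), (0, (0, True))]"
    by code_simp
  then show "w \<in> Y" "Y.lab w 0 = (1, False)" "y1 \<in> Y" "Y.lab y1 0 = (0, True)"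
    by (simp_all add: Y.lab_word_val Y.end_pt_word_val label_Y Y_eq_stab Y.stab_def
        del: word_val.simps letters.simps)
qed

lemma labY_w_pow:
  "w [^]\<^bsub>G\<lparr>carrier := Y\<rparr>\<^esub> m \<in> Y" "Y.lab (w [^]\<^bsub>G\<lparr>carrier := Y\<rparr>\<^esub> (m::nat)) 0 = (int m mod 7, False)"
proof -
  interpret lab: group_hom "G\<lparr>carrier := Y\<rparr>" "dihedral_group 7" "\<lambda>g. Y.lab g 0"
    by (intro group_hom.intro group_hom_axioms.intro labY_hom group_dihedral_group
        subgroup_imp_group subgroup_Y) simp
  show *: "w [^]\<^bsub>G\<lparr>carrier := Y\<rparr>\<^esub> m \<in> Y" for m :: nat
    using lab.G.nat_pow_closed[of w m] labY_gens(1) by simp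
  show "Y.lab (w [^]\<^bsub>G\<lparr>carrier := Y\<rparr>\<^esub> m) 0 = (int m mod 7, False)"
  proof (induction m)
    case 0
    then show ?case using lab.hom_one by (simp add: dihedral_group_def)
  next
    case (Suc m)
    have "Y.lab (w [^]\<^bsub>G\<lparr>carrier := Y\<rparr>\<^esub> Suc m) 0
        = Y.lab (w [^]\<^bsub>G\<lparr>carrier := Y\<rparr>\<^esub> m) 0 \<otimes>\<^bsub>dihedral_group 7\<^esub> Y.lab w 0"
      using lab.hom_mult[of "w [^]\<^bsub>G\<lparr>carrier := Y\<rparr>\<^esub> m" w] *[of m] labY_gens(1) by simp
    then show ?case using Suc labY_gens(2) by (simp add: dihedral_group_def mod_simps add.commute)
  qed
qed

lemma labY_surj: "(\<lambda>g. Y.lab g 0) ` Y = carrier (dihedral_group 7)"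
proof
  show "(\<lambda>g. Y.lab g 0) ` Y \<subseteq> carrier (dihedral_group 7)" using Y.lab_closed[of 0] by auto
  show "carrier (dihedral_group 7) \<subseteq> (\<lambda>g. Y.lab g 0) ` Y"
  proof
    fix x assume x: "x \<in> carrier (dihedral_group 7)"
    obtain i s where x_eq: "x = (i, s)" by (cases x)
    then have i: "int (nat i) mod 7 = i" using x by (simp add: dihedral_group_def)
    let ?g = "w [^]\<^bsub>G\<lparr>carrier := Y\<rparr>\<^esub> (nat i)"
    show "x \<in> (\<lambda>g. Y.lab g 0) ` Y"
    proof (cases s)
      case False
      then have "x = Y.lab ?g 0" using labY_w_pow(2)[of "nat i"] i x_eq by simp
      then show ?thesis using labY_w_pow(1)[of "nat i"] by (rule image_eqI)
    next
      case True
      have "?g \<otimes> y1 \<in> Y" using labY_w_pow(1) labY_gens(3) subgroup_Y by (intro subgroup.m_closed)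
      moreover have "Y.lab (?g \<otimes> y1) 0 = (i, False) \<otimes>\<^bsub>dihedral_group 7\<^esub> (0, True)"
        using hom_mult[OF labY_hom, of ?g y1] labY_w_pow[of "nat i"] labY_gens i by simp
      then have "Y.lab (?g \<otimes> y1) 0 = x" using x_eq True i
        by (auto simp: dihedral_group_def)
      ultimately show ?thesis by blast
    qed
  qed
qed

definition W where "W = generate G (derived G X \<union> {w})"

lemma derived_eq_kernelY: "derived G X = {g \<in> Y. Y.lab g 0 = \<one>\<^bsub>dihedral_group 7\<^esub>}"
  using derived_X kernels_eq by simp

text \<open>\<open>w\<close> maps to a generator of the rotations and the other generators of
  \<open>W\<close> form the kernel, so together they generate the full preimage of the rotation
  subgroup.\<close>

lemma W_eq: "W = {g \<in> Y. \<not> snd (Y.lab g 0)}"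
proof
  interpret lab: group_hom "G\<lparr>carrier := Y\<rparr>" "dihedral_group 7" "\<lambda>g. Y.lab g 0"
    by (intro group_hom.intro group_hom_axioms.intro labY_hom group_dihedral_group
        subgroup_imp_group subgroup_Y) simp
  have YG: "Y \<subseteq> carrier G" using subgroup_Y by (rule subgroup.subset)
  have mult: "Y.lab (g \<otimes> h) 0 = Y.lab g 0 \<otimes>\<^bsub>dihedral_group 7\<^esub> Y.lab h 0" if "g \<in> Y" "h \<in> Y" for g h
    using lab.hom_mult[of g h] that by simp
  have sub: "derived G X \<union> {w} \<subseteq> {g \<in> Y. \<not> snd (Y.lab g 0)}"
    using labY_gens by (auto simp: derived_eq_kernelY dihedral_group_def)
  have snd_mult: "snd (x \<otimes>\<^bsub>dihedral_group 7\<^esub> y) = (snd x \<noteq> snd y)" for x y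
    by (cases x; cases y) (simp add: dihedral_group_def)
  have "subgroup {g \<in> Y. \<not> snd (Y.lab g 0)} G"
  proof (rule subgroupI)
    show "{g \<in> Y. \<not> snd (Y.lab g 0)} \<subseteq> carrier G" using YG by blast
    show "{g \<in> Y. \<not> snd (Y.lab g 0)} \<noteq> {}" using labY_gens by fastforce
  next
    fix g assume g: "g \<in> {g \<in> Y. \<not> snd (Y.lab g 0)}"
    then have i: "inv g \<in> Y" using subgroup.m_inv_closed[OF subgroup_Y] by simp
    have "snd (Y.lab (inv g \<otimes> g) 0) = (snd (Y.lab (inv g) 0) \<noteq> snd (Y.lab g 0))"
      using mult[of "inv g" g] i g snd_mult by simp
    moreover have "inv g \<otimes> g = \<one>" using g YG by (intro l_inv) auto
    moreover have "Y.lab \<one> 0 = (0, False)" using lab.hom_one by (simp add: dihedral_group_def)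
    ultimately show "inv g \<in> {g \<in> Y. \<not> snd (Y.lab g 0)}" using i g by simp
  qed (use mult snd_mult subgroup.m_closed[OF subgroup_Y] in auto)
  then show "W \<subseteq> {g \<in> Y. \<not> snd (Y.lab g 0)}"
    unfolding W_def using sub by (rule generate_subgroup_incl[rotated])
  show "{g \<in> Y. \<not> snd (Y.lab g 0)} \<subseteq> W"
  proof
    fix g assume "g \<in> {g \<in> Y. \<not> snd (Y.lab g 0)}"
    then obtain i where g: "g \<in> Y" "Y.lab g 0 = (i, False)" by (cases "Y.lab g 0") auto
    have i: "0 \<le> i" "i < 7" using Y.lab_closed[of 0 g] g by (auto simp: dihedral_group_def)
    \<comment> \<open>The power of \<open>w\<close> that undoes the rotation of g. A nonnegative
      representative of -i modulo 7 allows natural powers.\<close>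
    define m where "m = nat ((- i) mod 7)"
    let ?h = "w [^]\<^bsub>G\<lparr>carrier := Y\<rparr>\<^esub> m"
    have hG: "?h = w [^] m" using nat_pow_consistent[of w m Y] by simp
    have "Y.lab (g \<otimes> ?h) 0 = \<one>\<^bsub>dihedral_group 7\<^esub>"
      using mult[OF g(1) labY_w_pow(1)[of m]] labY_w_pow(2)[of m] g(2)
      by (simp add: dihedral_group_def m_def mod_simps)
    then have "g \<otimes> ?h \<in> derived G X"
      using g labY_w_pow(1) subgroup.m_closed[OF subgroup_Y] by (simp add: derived_eq_kernelY)
    moreover have WG: "subgroup W G"
      unfolding W_def using sub YG by (intro generate_is_subgroup) auto
    ultimately have gh: "g \<otimes> ?h \<in> W" unfolding W_def by (auto intro: generate.incl)
    have "w \<in> W" unfolding W_def by (auto intro: generate.incl)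
    then have h: "?h \<in> W" unfolding hG
      using WG by (induction m) (auto intro: subgroup.one_closed subgroup.m_closed)
    have "g = (g \<otimes> ?h) \<otimes> inv ?h" using g YG labY_w_pow(1)[of m] by (simp add: m_assoc subset_iff)
    moreover have "(g \<otimes> ?h) \<otimes> inv ?h \<in> W"
      using subgroup.m_closed[OF WG gh subgroup.m_inv_closed[OF WG h]] .
    ultimately show "g \<in> W" by simp
  qed
qed

end

context cartwright_steger
begin

section \<open>The sign and the angle as homomorphisms\<close>

lemma labY_mult:
  "g \<in> Y \<Longrightarrow> h \<in> Y \<Longrightarrow> Y.lab (g \<otimes> h) 0 = Y.lab g 0 \<otimes>\<^bsub>dihedral_group 7\<^esub> Y.lab h 0"
  using hom_mult[OF labY_hom] by simp

text \<open>The sign character of the dihedral group, whose kernel in \<open>Y\<close> is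
  \<open>W\<close>; it provides the double covering.\<close>

lemma flip_hom: "(\<lambda>g. if snd (Y.lab g 0) then 1 else 0) \<in> hom (G\<lparr>carrier := Y\<rparr>) (integer_mod_group 2)"
proof (rule homI)
  fix g h assume "g \<in> carrier (G\<lparr>carrier := Y\<rparr>)" "h \<in> carrier (G\<lparr>carrier := Y\<rparr>)"
  then show "(if snd (Y.lab (g \<otimes>\<^bsub>G\<lparr>carrier := Y\<rparr>\<^esub> h) 0) then 1 else 0)
      = (if snd (Y.lab g 0) then 1 else 0) \<otimes>\<^bsub>integer_mod_group 2\<^esub> (if snd (Y.lab h 0) then 1 else 0)"
    by (cases "Y.lab g 0"; cases "Y.lab h 0") (simp add: labY_mult flip: dmul_eq)
qed (simp add: carrier_integer_mod_group)

lemma flip_surj: "(\<lambda>g. if snd (Y.lab g 0) then 1 else 0) ` Y = carrier (integer_mod_group 2)"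
proof
  show "carrier (integer_mod_group 2) \<subseteq> (\<lambda>g. if snd (Y.lab g 0) then 1 else 0) ` Y"
  proof
    fix k assume "k \<in> carrier (integer_mod_group 2)"
    then have "k = 0 \<or> k = 1" by (auto simp: carrier_integer_mod_group)
    then show "k \<in> (\<lambda>g. if snd (Y.lab g 0) then 1 else 0) ` Y"
    proof
      assume "k = 0"
      then have "k = (if snd (Y.lab w 0) then 1 else 0)" using labY_gens(2) by simp
      then show ?thesis using labY_gens(1) by (rule image_eqI)
    next
      assume "k = 1"
      then have "k = (if snd (Y.lab y1 0) then 1 else 0)" using labY_gens(4) by simp
      then show ?thesis using labY_gens(3) by (rule image_eqI)
    qed
  qed
qed (auto simp: carrier_integer_mod_group)

lemma flip_kernel: "W = {g \<in> Y. (if snd (Y.lab g 0) then 1 else 0) = \<one>\<^bsub>integer_mod_group 2\<^esub>}"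
  by (auto simp: W_eq)

text \<open>Angles add only between rotations, hence the restriction to \<open>W\<close>.\<close>

lemma rotation_hom: "(\<lambda>g. fst (Y.lab g 0)) \<in> hom (G\<lparr>carrier := W\<rparr>) (integer_mod_group 7)"
proof (rule homI)
  fix g assume "g \<in> carrier (G\<lparr>carrier := W\<rparr>)"
  then show "fst (Y.lab g 0) \<in> carrier (integer_mod_group 7)"
    using Y.lab_closed[of 0 g] by (auto simp: dihedral_group_def carrier_integer_mod_group mem_Times_iff)
next
  fix g h assume "g \<in> carrier (G\<lparr>carrier := W\<rparr>)" "h \<in> carrier (G\<lparr>carrier := W\<rparr>)"
  then show "fst (Y.lab (g \<otimes>\<^bsub>G\<lparr>carrier := W\<rparr>\<^esub> h) 0)
      = fst (Y.lab g 0) \<otimes>\<^bsub>integer_mod_group 7\<^esub> fst (Y.lab h 0)"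
    by (cases "Y.lab g 0"; cases "Y.lab h 0") (simp add: W_eq labY_mult flip: dmul_eq)
qed

lemma rotation_surj: "(\<lambda>g. fst (Y.lab g 0)) ` W = carrier (integer_mod_group 7)"
proof
  show "(\<lambda>g. fst (Y.lab g 0)) ` W \<subseteq> carrier (integer_mod_group 7)"
    using hom_in_carrier[OF rotation_hom] by auto
  show "carrier (integer_mod_group 7) \<subseteq> (\<lambda>g. fst (Y.lab g 0)) ` W"
  proof
    fix k assume k: "k \<in> carrier (integer_mod_group 7)"
    then have "(k, False) \<in> carrier (dihedral_group 7)"
      by (auto simp: dihedral_group_def carrier_integer_mod_group)
    then have "(k, False) \<in> (\<lambda>g. Y.lab g 0) ` Y" by (simp only: labY_surj)
    then obtain g where g: "g \<in> Y" "Y.lab g 0 = (k, False)" by auto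
    then have "g \<in> W" "k = fst (Y.lab g 0)" by (simp_all add: W_eq)
    then show "k \<in> (\<lambda>g. fst (Y.lab g 0)) ` W" by blast
  qed
qed

lemma rotation_kernel: "derived G X = {g \<in> W. fst (Y.lab g 0) = \<one>\<^bsub>integer_mod_group 7\<^esub>}"
  by (auto simp: derived_eq_kernelY W_eq dihedral_group_def prod_eq_iff)

end

theorem mainTheorem1:
  fixes z b :: "(complex^3^3) set" and \<Gamma> :: "(complex^3^3) set set"
  assumes "discrete_subgroup \<Gamma>" and "cocompact_subgroup \<Gamma>"
    and "maximal_arithmetic_subgroup \<Gamma>"
    and "presented_by (PU21\<lparr>carrier := \<Gamma>\<rparr>) z b CS_relators"
    and "card (rcosets\<^bsub>PU21\<lparr>carrier := \<Gamma>\<rparr>\<^esub> (Gamma_X z b)) = 21"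
    and "card (rcosets\<^bsub>PU21\<lparr>carrier := \<Gamma>\<rparr>\<^esub> (Gamma_Y z b)) = 21"
    and "acts_freely_on_ball (Gamma_X z b)"
    and "acts_freely_on_ball (Gamma_Y z b)"
  shows "complex_surface (ball_quotient (Gamma_X z b)) \<and>
    complex_surface (ball_quotient (Gamma_Y z b)) \<and>
    complex_surface (ball_quotient (Gamma_Z z b)) \<and>
    complex_surface (ball_quotient (Gamma_W z b)) \<and>
    (\<exists>\<mu> \<pi> \<rho>.
       unramified_quotient_map (integer_mod_group 2)
         (ball_quotient (Gamma_W z b)) (ball_quotient (Gamma_Y z b)) \<mu> \<and>
       unramified_quotient_map (integer_mod_group 7)
         (ball_quotient (Gamma_Z z b)) (ball_quotient (Gamma_W z b)) \<pi> \<and>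
       unramified_quotient_map (dihedral_group 7)
         (ball_quotient (Gamma_Z z b)) (ball_quotient (Gamma_Y z b)) (\<mu> \<circ> \<pi>) \<and>
       unramified_quotient_map (integer_mod_group 14)
         (ball_quotient (Gamma_Z z b)) (ball_quotient (Gamma_X z b)) \<rho>)"
proof -
  interpret P: group PU21 by (rule group_PU21)
  \<comment> \<open>The combinatorics takes place in the group with carrier \<Gamma>, the geometry
    in \<open>PU21\<close>. The facts that follow identify word values, generated subgroups and
    commutator subgroups computed in either.\<close>
  let ?G = "PU21\<lparr>carrier := \<Gamma>\<rparr>"
  have sub: "subgroup \<Gamma> PU21" using assms(1) by (simp add: discrete_subgroup_def)
  interpret pres: group_presentation ?G z b CS_relators
    by (rule group_presentation.intro) fact
  have zb: "z \<in> \<Gamma>" "b \<in> \<Gamma>" using pres.gen_closed by simp_all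
  have word_val: "word_val PU21 z b = word_val ?G z b"
  proof
    show "word_val PU21 z b u = word_val ?G z b u" for u
      by (induction u rule: letters.induct)
        (auto simp: P.int_pow_consistent[OF sub] zb split: letter.split)
  qed
  have in_\<Gamma>: "word_val PU21 z b ` S \<subseteq> \<Gamma>" for S
    using pres.word_val_closed by (auto simp: word_val simp del: word_val.simps)
  have gen: "generate PU21 (word_val PU21 z b ` S) = generate ?G (word_val ?G z b ` S)" for S
    using P.generate_consistent[OF in_\<Gamma> sub, of S] by (simp only: word_val)
  interpret CS: cartwright_steger ?G z b "Gamma_X z b" "Gamma_Y z b"
    by unfold_locales (simp_all only: Gamma_X_def Gamma_Y_def gen assms(5,6)[unfolded Gamma_X_def Gamma_Y_def gen])
  have X: "subgroup (Gamma_X z b) PU21" "Gamma_X z b \<subseteq> \<Gamma>"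
    and Y: "subgroup (Gamma_Y z b) PU21" "Gamma_Y z b \<subseteq> \<Gamma>"
    using P.incl_subgroup[OF sub] CS.subgroup_X CS.subgroup_Y subgroup.subset by force+
  have Z_eq: "derived ?G (Gamma_X z b) = Gamma_Z z b"
    unfolding Gamma_Z_def by (rule P.derived_consistent[OF X(2) sub])
  have Z: "Gamma_Z z b \<subseteq> Gamma_X z b" "Gamma_Z z b \<subseteq> Gamma_Y z b"
    using CS.derived_X CS.derived_eq_kernelY Z_eq by auto
  have W_eq: "CS.W = Gamma_W z b"
  proof -
    have "Gamma_Z z b \<union> {CS.w} \<subseteq> \<Gamma>" using Z X(2) pres.word_val_closed by (auto simp del: word_val.simps)
    from P.generate_consistent[OF this sub] show ?thesis
      unfolding CS.W_def Gamma_W_def Z_eq word_val .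
  qed
  \<comment> \<open>Freeness is supplied for the two large groups; \<open>Gamma_Z\<close> and
    \<open>Gamma_W\<close> receive it as kernels in the interpretations below.\<close>
  interpret X: ball_lattice "Gamma_X z b"
    by unfold_locales (rule discrete_subgroup_subset[OF assms(1) X], fact)
  interpret Y: ball_lattice "Gamma_Y z b"
    by unfold_locales (rule discrete_subgroup_subset[OF assms(1) Y], fact)
  interpret X_Z: ball_lattice_quotient "Gamma_X z b" "integer_mod_group 14" "\<lambda>g. CS.X.lab g 0" "Gamma_Z z b"
    using CS.labX_hom CS.labX_surj CS.derived_X[unfolded Z_eq]
    by (intro ball_lattice_quotient.intro ball_lattice_quotient_axioms.intro X.ball_lattice_axioms
        group_integer_mod_group) simp_all
  interpret Y_Z: ball_lattice_quotient "Gamma_Y z b" "dihedral_group 7" "\<lambda>g. CS.Y.lab g 0" "Gamma_Z z b"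
    using CS.labY_hom CS.labY_surj CS.derived_eq_kernelY[unfolded Z_eq]
    by (intro ball_lattice_quotient.intro ball_lattice_quotient_axioms.intro Y.ball_lattice_axioms
        group_dihedral_group) simp_all
  interpret Y_W: ball_lattice_quotient "Gamma_Y z b" "integer_mod_group 2"
      "\<lambda>g. if snd (CS.Y.lab g 0) then 1 else 0" "Gamma_W z b"
  proof (intro ball_lattice_quotient.intro ball_lattice_quotient_axioms.intro Y.ball_lattice_axioms
        group_integer_mod_group)
    show "(\<lambda>g. if snd (CS.Y.lab g 0) then 1 else 0)
        \<in> hom (PU21\<lparr>carrier := Gamma_Y z b\<rparr>) (integer_mod_group 2)"
      using CS.flip_hom by simp
  qed (rule CS.flip_surj, rule CS.flip_kernel[unfolded W_eq])
  \<comment> \<open>\<open>Gamma_W\<close> is already known to be a free lattice as the kernel of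
    the sign, so it can now take the role of the larger group.\<close>
  interpret W_Z: ball_lattice_quotient "Gamma_W z b" "integer_mod_group 7" "\<lambda>g. fst (CS.Y.lab g 0)" "Gamma_Z z b"
    using CS.rotation_hom[unfolded W_eq] CS.rotation_surj[unfolded W_eq]
      CS.rotation_kernel[unfolded W_eq Z_eq]
    by (intro ball_lattice_quotient.intro ball_lattice_quotient_axioms.intro Y_W.N.ball_lattice_axioms
        group_integer_mod_group) simp_all
  have W: "Gamma_W z b \<subseteq> Gamma_Y z b" "Gamma_Z z b \<subseteq> Gamma_W z b"
    using Y_W.N_def W_Z.N_def by blast+
  let ?\<mu> = "induced_map (Gamma_Y z b)" and ?\<pi> = "induced_map (Gamma_W z b)"
    and ?\<rho> = "induced_map (Gamma_X z b)"
  have \<mu>: "?\<mu> (ball_orbit (Gamma_W z b) p) = ball_orbit (Gamma_Y z b) p"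
    and \<pi>: "?\<pi> (ball_orbit (Gamma_Z z b) p) = ball_orbit (Gamma_W z b) p"
    and \<rho>: "?\<rho> (ball_orbit (Gamma_Z z b) p) = ball_orbit (Gamma_X z b) p"
    if "p \<in> ball2" for p
    using that Y.induced_map_orbit[OF Y_W.subgroup_N W(1)] Y_W.N.induced_map_orbit[OF W_Z.subgroup_N W(2)]
      X.induced_map_orbit[OF X_Z.subgroup_N Z(1)] by blast+
  \<comment> \<open>The dihedral quotient is obtained from the values of the composite on orbits and
    not by composing two quotient maps, since the group of the composite is not determined by the
    two factors.\<close>
  have "(?\<mu> \<circ> ?\<pi>) (ball_orbit (Gamma_Z z b) p) = ball_orbit (Gamma_Y z b) p" if "p \<in> ball2" for p
    using \<mu> \<pi> that by simp
  then show ?thesis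
    using X.complex_surface_quotient Y.complex_surface_quotient X_Z.N.complex_surface_quotient
      Y_W.N.complex_surface_quotient Y_W.unramified_quotient[OF \<mu>] W_Z.unramified_quotient[OF \<pi>]
      Y_Z.unramified_quotient X_Z.unramified_quotient[OF \<rho>]
    by (intro conjI exI[of _ ?\<mu>] exI[of _ ?\<pi>] exI[of _ ?\<rho>]) simp_all
qed

end
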